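(* There exists an algorithm that, given copies of an unknown $n$-qubit state $\rho$, answers $M$ adaptively chosen rank-one projectors $|\psi^1\rangle\langle\psi^1|,\dots,|\psi^M\rangle\langle\psi^M|$, outputting estimates of $\langle\psi^i|\rho|\psi^i\rangle$ within error $\epsilon$ for all $i$, with probability at least $1-\delta$, using $$N=\mathcal{O}\left(\frac{\log(M)\log(1/\epsilon\delta)^{3/2}\log(1/\epsilon)}{\epsilon^3}\right)$$ copies of $\rho$.
   Context: Adaptive model: in round $i$ a classical analyst chooses the unit vector $|\psi^i\rangle$ possibly depending on all previous queries and answers; the algorithm (which may be computationally inefficient) returns an estimate $\hat o_i$. *)

theory Defs
  imports "Jordan_Normal_Form.Matrix" Complex_Main
begin

definition adj :: "complex mat \<Rightarrow> complex mat" where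
  "adj K = mat (dim_col K) (dim_row K) (\<lambda>(i,j). cnj (K $$ (j,i)))"

definition tr :: "complex mat \<Rightarrow> complex" where
  "tr A = (\<Sum>i<dim_row A. A $$ (i,i))"

definition qform :: "complex mat \<Rightarrow> complex vec \<Rightarrow> complex" where
  "qform A v = (\<Sum>i<dim_vec v. \<Sum>j<dim_vec v. cnj (v $ i) * A $$ (i,j) * v $ j)"

definition psd :: "nat \<Rightarrow> complex mat \<Rightarrow> bool" where
  "psd d A \<longleftrightarrow> A \<in> carrier_mat d d \<and>
     (\<forall>v \<in> carrier_vec d. Im (qform A v) = 0 \<and> Re (qform A v) \<ge> 0)"

definition qstate :: "nat \<Rightarrow> complex mat \<Rightarrow> bool" where
  "qstate n \<rho> \<longleftrightarrow> psd (2^n) \<rho> \<and> tr \<rho> = 1"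

definition unit_vec :: "nat \<Rightarrow> complex vec \<Rightarrow> bool" where
  "unit_vec n v \<longleftrightarrow> v \<in> carrier_vec (2^n) \<and> (\<Sum>i<2^n. (cmod (v $ i))\<^sup>2) = 1"

definition expval :: "complex mat \<Rightarrow> complex vec \<Rightarrow> real" where
  "expval \<rho> \<psi> = Re (qform \<rho> \<psi>)"

text \<open>The N-fold tensor power of a d x d matrix, with the standard (Kronecker) ordering of
  the basis of (C^d)^{\<otimes>N}: the index a < d^N has base-d digits (a div d^k) mod d.\<close>
definition tensor_pow :: "nat \<Rightarrow> complex mat \<Rightarrow> nat \<Rightarrow> complex mat" where
  "tensor_pow d \<rho> N = mat (d^N) (d^N)
     (\<lambda>(a,b). \<Prod>k<N. \<rho> $$ ((a div d^(N-1-k)) mod d, (b div d^(N-1-k)) mod d))"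

text \<open>rho^{\<otimes>N} embedded in a D-dimensional memory (D >= d^N), i.e. rho^{\<otimes>N} (+) 0,
  which is unitarily equivalent to rho^{\<otimes>N} tensored with a fixed ancilla state.\<close>
definition init_state :: "nat \<Rightarrow> complex mat \<Rightarrow> nat \<Rightarrow> nat \<Rightarrow> complex mat" where
  "init_state d \<rho> N D = mat D D (\<lambda>(a,b).
     if a < d^N \<and> b < d^N then tensor_pow d \<rho> N $$ (a,b) else 0)"

text \<open>A quantum instrument on a D-dimensional system with real-valued (estimate) outcomes:
  a finite list of branches (outcome, Kraus operators of the CP map of that branch),
  jointly trace preserving.\<close>
definition msum :: "nat \<Rightarrow> complex mat list \<Rightarrow> complex mat" where
  "msum D xs = foldr (+) xs (0\<^sub>m D D)"

type_synonym instrument = "(real \<times> complex mat list) list"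

definition valid_instrument :: "nat \<Rightarrow> instrument \<Rightarrow> bool" where
  "valid_instrument D I \<longleftrightarrow>
     (\<forall>(out,Ks) \<in> set I. \<forall>K \<in> set Ks. K \<in> carrier_mat D D) \<and>
     msum D (map (\<lambda>(out,Ks). msum D (map (\<lambda>K. adj K * K) Ks)) I) = 1\<^sub>m D"

definition apply_kraus :: "nat \<Rightarrow> complex mat list \<Rightarrow> complex mat \<Rightarrow> complex mat" where
  "apply_kraus D Ks \<sigma> = msum D (map (\<lambda>K. K * \<sigma> * adj K) Ks)"

text \<open>History of the interaction: list of (query vector, returned estimate).
  An adaptive analyst maps the history to the next query.
  An algorithm (with quantum memory) maps history and the current query to the instrument it
  performs on its current post-measurement state; it knows n, N, M, eps, delta but not rho.\<close>
type_synonym history = "(complex vec \<times> real) list"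
type_synonym analyst = "history \<Rightarrow> complex vec"
type_synonym algorithm = "history \<Rightarrow> complex vec \<Rightarrow> instrument"

text \<open>Probability that all remaining k answers are eps-accurate, starting from the
  unnormalised post-measurement state sigma after history h.\<close>
fun succ_prob :: "nat \<Rightarrow> algorithm \<Rightarrow> analyst \<Rightarrow> complex mat \<Rightarrow> real \<Rightarrow>
                  complex mat \<Rightarrow> history \<Rightarrow> nat \<Rightarrow> real" where
  "succ_prob D alg A \<rho> \<epsilon> \<sigma> h 0 = Re (tr \<sigma>)"
| "succ_prob D alg A \<rho> \<epsilon> \<sigma> h (Suc k) =
     (let \<psi> = A h in
      sum_list (map (\<lambda>(out,Ks).
         if \<bar>out - expval \<rho> \<psi>\<bar> \<le> \<epsilon>
         then succ_prob D alg A \<rho> \<epsilon> (apply_kraus D Ks \<sigma>) (h @ [(\<psi>, out)]) k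
         else 0) (alg h \<psi>)))"

end

(* Measure each copy with the POVM {E v |v><v|}, where v has independent entries that match the
   first four moments of complex Gaussians: for every unit psi, |<v|psi>|^2 - 1 is then an unbiased
   estimator of <psi|rho|psi> with exponential tails, independently of the dimension.  The outcomes
   v_1, ..., v_N are stored and all queries are answered from this classical sample.

   Adaptivity is handled by differential privacy.  The algorithm keeps a matrix H, determined by the
   public history, and answers <psi|H|psi> unless this is far from the empirical value, in which case
   the exponential mechanism returns a rounded empirical value u and H is projected (in Frobenius
   norm) onto the matrices with <psi|H|psi> = u.  Each such correction decreases
   ||H - rho||_F^2 <= 1 by at least alpha^2, so only O(1/alpha^2) corrections occur.  Only corrections
   cost privacy: the Renyi moment of order n of the likelihood ratio of two transcripts for
   neighbouring samples is at most exp(O(n^2 eta^2) (number of corrections)).  A private transcript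
   cannot correlate with the sample, hence empirical values and true values are close at the first
   bad answer.  For extremely small delta the Renyi bound is not available, and a union bound
   over the tree of all transcripts with O(1/alpha^2) corrections takes its place. *)
theory Submission
  imports Defs "HOL-Library.FuncSet"
begin

section \<open>Elementary estimates and the exponential mechanism\<close>

text \<open>The exponents of the bound come from balancing the privacy account. Replacing one copy
  changes the log-likelihood of an answer by at most \<open>y = 2 * (B / N) / b\<close>, and
  accuracy in all rounds forces \<open>b = \<alpha> / \<Gamma>\<close> with \<Gamma> of order ln(M)
  + ln(1/(\<epsilon>\<delta>)). A moment of order n yields a small failure probability only if
  n\<alpha> exceeds \<Lambda>, of order ln(1/(\<epsilon>\<delta>)), so n is about
  \<Lambda>/\<alpha>. Its cost over the corrections, about n^2 y^2/\<alpha>^2, must stay below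
  \<Lambda>, hence y is about \<alpha>^2/sqrt(\<Lambda>) and N about B \<Gamma>
  sqrt(\<Lambda>)/\<alpha>^3. The power 3/2 is thus one logarithm from \<Gamma> and half of one from
  \<Lambda>. The factor ln(1/\<epsilon>) is \<open>B\<close>, the level at which |<v|psi>|^2 is
  truncated; untruncated, a single copy could move an empirical value arbitrarily far. The moment
  inequality requires n*y to be bounded, that is \<alpha> sqrt(\<Lambda>) bounded. Beyond that,
  sqrt(\<Lambda>) is at least 1/\<alpha> and the same N has order 1/\<alpha>^4, which is what the
  union bound asks for. The entries of v have finite support because an instrument is a finite list
  of branches.\<close>

lemma exp_le_quadratic:
  fixes x :: real
  assumes "\<bar>x\<bar> \<le> 1"
  shows "exp x \<le> 1 + x + x\<^sup>2"
proof (cases "x \<ge> 0")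
  case True
  then show ?thesis using assms exp_bound[of x] by simp
next
  case False
  define y where "y = - x"
  have y: "0 \<le> y" "y \<le> 1" using False assms by (auto simp: y_def)
  have "1 + y + y\<^sup>2/2 \<le> exp y" using exp_lower_Taylor_quadratic[of y] y by simp
  then have "inverse (exp y) \<le> inverse (1 + y + y\<^sup>2/2)"
    using y by (intro le_imp_inverse_le) (auto intro!: add_pos_nonneg)
  then have "exp x \<le> 1 / (1 + y + y\<^sup>2/2)"
    by (simp add: y_def exp_minus inverse_eq_divide)
  also have "\<dots> \<le> 1 - y + y\<^sup>2"
  proof -
    have "(1 - y + y\<^sup>2) * (1 + y + y\<^sup>2/2) = 1 + y\<^sup>2/2 + y^3/2 + y^4/2"
      by (simp add: power2_eq_square power3_eq_cube power4_eq_xxxx field_simps)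
    then have "1 \<le> (1 - y + y\<^sup>2) * (1 + y + y\<^sup>2/2)" using y by simp
    moreover have "0 < 1 + y + y\<^sup>2/2" using y by (simp add: add_pos_nonneg)
    ultimately show ?thesis by (simp add: divide_le_eq)
  qed
  finally show ?thesis by (simp add: y_def)
qed

text \<open>The outcome \<open>c0\<close> is undiscounted: since both kernels sum to one, its second-order loss is
  itself proportional to the total probability of the other outcomes, whose discount pays for it.\<close>
lemma renyi_step:
  fixes K K' :: "'o \<Rightarrow> real"
  assumes fin: "finite C" and c0: "c0 \<in> C"
    and pos: "\<And>u. u \<in> C \<Longrightarrow> K u > 0" "\<And>u. u \<in> C \<Longrightarrow> K' u > 0"
    and sums: "sum K C = 1" "sum K' C = 1"
    and ratio: "\<And>u. u \<in> C \<Longrightarrow> K u \<le> exp y * K' u" "\<And>u. u \<in> C \<Longrightarrow> K' u \<le> exp y * K u"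
    and y: "0 \<le> y" "real n * y \<le> 1/6" and n: "n \<ge> 1"
  shows "(\<Sum>u\<in>C. K u ^ n / K' u ^ (n-1) * (if u = c0 then 1 else exp (- (32 * (real n * y)\<^sup>2)))) \<le> 1"
proof -
  define r where "r u = K u / K' u" for u
  \<comment> \<open>The discount gains at least \<open>(g/2) * (k/2)\<close>, from
    \<open>r u ^ n \<ge> 1/2\<close> and \<open>1 - exp (-k) \<ge> k/2\<close>; equating this with
    the second-order loss \<open>8 * (n * y)\<^sup>2 * g\<close> gives the factor 32. The bound 1/6
    on \<open>n * y\<close> keeps \<open>k\<close> below 1.\<close>
  define k where "k = 32 * (real n * y)\<^sup>2"
  define U where "U = C - {c0}"
  define g where "g = sum K' U"
  have finU: "finite U" using fin by (simp add: U_def)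
  have split: "sum f C = f c0 + sum f U" for f :: "'o \<Rightarrow> real"
    unfolding U_def using fin c0 by (simp add: sum.remove)
  have g0: "g \<ge> 0" unfolding g_def by (rule sum_nonneg) (use pos in \<open>auto simp: U_def less_imp_le\<close>)
  have y1: "y \<le> 1/6" using y n mult_right_mono[of 1 "real n" y] by simp
  have k0: "k \<ge> 0" by (simp add: k_def)
  have k1: "k \<le> 1"
  proof -
    have "(real n * y)\<^sup>2 \<le> (1/6)\<^sup>2" by (rule power_mono) (use y in auto)
    then show ?thesis by (simp add: k_def power2_eq_square)
  qed
  have Kr: "K u = K' u * r u" if "u \<in> C" for u using pos(2)[OF that] by (simp add: r_def)
  have rb: "r u \<le> exp y" "exp (-y) \<le> r u" "r u > 0" if "u \<in> C" for u
    using ratio[OF that] pos[OF that] by (auto simp: r_def field_simps exp_minus)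
  have rabs: "\<bar>r u - 1\<bar> \<le> 2 * y" if "u \<in> C" for u
  proof -
    have "exp y \<le> 1 + y + y\<^sup>2" using y1 y by (intro exp_le_quadratic) auto
    moreover have "y\<^sup>2 \<le> y * 1" unfolding power2_eq_square by (rule mult_left_mono) (use y y1 in auto)
    moreover have "exp (-y) \<ge> 1 - y" using exp_ge_add_one_self[of "-y"] by simp
    ultimately show ?thesis using rb[OF that] y by linarith
  qed
  have ratio_form: "K u ^ n / K' u ^ (n-1) = K' u * r u ^ n" if "u \<in> C" for u
  proof -
    obtain m where m: "n = Suc m" using n by (cases n) auto
    show ?thesis using pos(2)[OF that] unfolding r_def m by (simp add: power_divide field_simps)
  qed
  have rn: "r u ^ n \<le> 1 + n * (r u - 1) + (n * (r u - 1))\<^sup>2" if "u \<in> C" for u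
  proof -
    have "r u \<le> exp (r u - 1)" using exp_ge_add_one_self[of "r u - 1"] by simp
    then have "r u ^ n \<le> exp (r u - 1) ^ n" using rb[OF that] by (intro power_mono) auto
    also have "\<dots> = exp (n * (r u - 1))" by (simp add: exp_of_nat_mult)
    also have "\<dots> \<le> 1 + n * (r u - 1) + (n * (r u - 1))\<^sup>2"
    proof (rule exp_le_quadratic)
      have "\<bar>n * (r u - 1)\<bar> \<le> n * (2 * y)" unfolding abs_mult
        using rabs[OF that] by (intro mult_mono) auto
      then show "\<bar>n * (r u - 1)\<bar> \<le> 1" using y by simp
    qed
    finally show ?thesis .
  qed
  have rn_low: "r u ^ n \<ge> 1/2" if "u \<in> C" for u
  proof -
    have "exp (-y) ^ n \<le> r u ^ n" using rb[OF that] by (intro power_mono) auto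
    moreover have "exp (-y) ^ n = exp (- (n * y))" by (simp flip: exp_of_nat_mult)
    moreover have "exp (- (n*y)) \<ge> 1 - n * y" using exp_ge_add_one_self[of "-(n*y)"] by simp
    ultimately show ?thesis using y by linarith
  qed
  have sq: "(\<Sum>u\<in>C. K' u * (r u - 1)\<^sup>2) \<le> 8 * y\<^sup>2 * g"
  proof -
    have U: "(\<Sum>u\<in>U. K' u * (r u - 1)\<^sup>2) \<le> (2*y)\<^sup>2 * g"
      unfolding g_def sum_distrib_left
    proof (rule sum_mono)
      fix u assume "u \<in> U"
      then have u: "u \<in> C" by (simp add: U_def)
      have "(r u - 1)\<^sup>2 \<le> (2*y)\<^sup>2" using power_mono[OF rabs[OF u], of 2] by simp
      then show "K' u * (r u - 1)\<^sup>2 \<le> (2*y)\<^sup>2 * K' u"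
        using pos(2)[OF u] by (simp add: mult.commute mult_left_mono)
    qed
    have "(\<Sum>u\<in>C. K' u * (r u - 1)) = (\<Sum>u\<in>C. K u - K' u)"
      by (rule sum.cong) (auto simp: Kr algebra_simps)
    also have "\<dots> = 0" using sums by (simp add: sum_subtractf)
    finally have "K' c0 * (r c0 - 1) = - (\<Sum>u\<in>U. K' u * (r u - 1))" by (simp add: split)
    then have "\<bar>K' c0 * (r c0 - 1)\<bar> \<le> (\<Sum>u\<in>U. \<bar>K' u * (r u - 1)\<bar>)" by (simp add: sum_abs)
    also have "\<dots> \<le> (\<Sum>u\<in>U. (2*y) * K' u)"
    proof (rule sum_mono)
      fix u assume "u \<in> U"
      then have u: "u \<in> C" by (simp add: U_def)
      show "\<bar>K' u * (r u - 1)\<bar> \<le> 2*y*K' u"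
        using rabs[OF u] pos(2)[OF u] by (simp add: abs_mult mult.commute mult_left_mono)
    qed
    also have "\<dots> = 2*y*g" by (simp add: g_def sum_distrib_left)
    finally have c: "\<bar>K' c0 * (r c0 - 1)\<bar> \<le> 2*y*g" .
    have "K' c0 * (r c0 - 1)\<^sup>2 = \<bar>K' c0 * (r c0 - 1)\<bar> * \<bar>r c0 - 1\<bar>"
      using pos(2)[OF c0] by (simp add: abs_mult power2_eq_square)
    also have "\<dots> \<le> (2*y*g) * (2*y)"
      by (rule mult_mono[OF c rabs[OF c0]]) (use y g0 in auto)
    finally show ?thesis using U unfolding split by (simp add: power2_eq_square algebra_simps)
  qed
  \<comment> \<open>The first-order terms sum to \<open>n\<close> times the difference of the two
    total masses, which is 0.\<close>
  have all: "(\<Sum>u\<in>C. K' u * r u ^ n) \<le> 1 + (real n)\<^sup>2 * (8 * y\<^sup>2 * g)"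
  proof -
    have "(\<Sum>u\<in>C. K' u * r u ^ n) \<le> (\<Sum>u\<in>C. K' u * (1 + n * (r u - 1) + (n * (r u - 1))\<^sup>2))"
      by (rule sum_mono) (use rn pos in \<open>auto intro!: mult_left_mono simp: less_imp_le\<close>)
    also have "\<dots> = (\<Sum>u\<in>C. K' u + n * (K u - K' u) + (real n)\<^sup>2 * (K' u * (r u - 1)\<^sup>2))"
      by (rule sum.cong) (auto simp: Kr algebra_simps power2_eq_square)
    also have "\<dots> = 1 + (real n)\<^sup>2 * (\<Sum>u\<in>C. K' u * (r u - 1)\<^sup>2)"
      using sums by (simp add: sum.distrib sum_subtractf flip: sum_distrib_left)
    also have "\<dots> \<le> 1 + (real n)\<^sup>2 * (8 * y\<^sup>2 * g)" using sq by (simp add: mult_left_mono)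
    finally show ?thesis .
  qed
  have ek: "1 - exp (-k) \<ge> k/2"
  proof -
    have "exp (-k) \<le> 1 + (-k) + (-k)\<^sup>2/2"
    proof -
      have "1 / exp k \<le> 1 / (1 + k + k\<^sup>2/2)" 
        using exp_lower_Taylor_quadratic[of k] k0 by (intro divide_left_mono) (auto intro!: mult_pos_pos add_pos_nonneg)
      also have "\<dots> \<le> 1 - k + k\<^sup>2/2"
      proof -
        have "(1 - k + k\<^sup>2/2) * (1 + k + k\<^sup>2/2) = 1 + k^4/4"
          by (simp add: power2_eq_square power4_eq_xxxx field_simps)
        moreover have "0 < 1 + k + k\<^sup>2/2" using k0 by (simp add: add_pos_nonneg)
        ultimately show ?thesis by (simp add: divide_le_eq)
      qed
      finally show ?thesis by (simp add: exp_minus inverse_eq_divide)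
    qed
    moreover have "k\<^sup>2 \<le> k" using k0 k1 by (simp add: power2_eq_square mult_left_le)
    ultimately show ?thesis by simp
  qed
  have disc: "(\<Sum>u\<in>U. K' u * r u ^ n) * (1 - exp (-k)) \<ge> (g/2) * (k/2)"
  proof (rule mult_mono)
    have "g / 2 = (\<Sum>u\<in>U. K' u * (1/2))" by (simp add: g_def sum_divide_distrib)
    also have "\<dots> \<le> (\<Sum>u\<in>U. K' u * r u ^ n)"
      by (rule sum_mono) (use rn_low pos in \<open>auto intro!: mult_left_mono simp: less_imp_le U_def simp del: mult_1_right\<close>)
    finally show le: "g / 2 \<le> (\<Sum>u\<in>U. K' u * r u ^ n)" .
    show "0 \<le> (\<Sum>u\<in>U. K' u * r u ^ n)" using le g0 by linarith
  qed (use ek k0 in auto)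
  have "(\<Sum>u\<in>C. K u ^ n / K' u ^ (n-1) * (if u = c0 then 1 else exp (- k))) =
        (\<Sum>u\<in>C. K' u * r u ^ n * (if u = c0 then 1 else exp (- k)))"
    by (rule sum.cong) (simp_all only: ratio_form)
  also have "\<dots> = K' c0 * r c0 ^ n + (\<Sum>u\<in>U. K' u * r u ^ n * exp (-k))"
    unfolding split by (auto simp: U_def intro!: arg_cong2[where f="(+)"] sum.cong)
  also have "\<dots> = (\<Sum>u\<in>C. K' u * r u ^ n) - (\<Sum>u\<in>U. K' u * r u ^ n) * (1 - exp (-k))"
    unfolding split by (simp add: algebra_simps sum_distrib_left sum_subtractf)
  also have "\<dots> \<le> 1 + (real n)\<^sup>2 * (8 * y\<^sup>2 * g) - (g/2) * (k/2)"
    using all disc by linarith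
  also have "\<dots> = 1" by (simp add: k_def power_mult_distrib)
  finally show ?thesis unfolding k_def .
qed

text \<open>The shift by \<open>1\<close> anticipates \<open>E \<bar>\<langle>v|\<psi>\<rangle>\<bar>\<^sup>2 = 1 + \<langle>\<psi>|\<rho>|\<psi>\<rangle>\<close>.\<close>
definition emp_mean :: "nat \<Rightarrow> ('z \<Rightarrow> real) \<Rightarrow> (nat \<Rightarrow> 'z) \<Rightarrow> real" where
  "emp_mean N q x = (\<Sum>i<N. q (x i)) / N - 1"

text \<open>The surcharge makes the mechanism leave the hypothesis value \<open>c\<close> only if this is far from \<open>t\<close>.\<close>
definition score :: "real \<Rightarrow> real \<Rightarrow> real \<Rightarrow> real \<Rightarrow> real" where
  "score \<alpha> c t out = \<bar>out - t\<bar> + (if out = c then 0 else 4 * \<alpha>)"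

definition exp_mech :: "real set \<Rightarrow> real \<Rightarrow> real \<Rightarrow> real \<Rightarrow> real \<Rightarrow> real \<Rightarrow> real" where
  "exp_mech G \<alpha> b c t out =
     exp (- score \<alpha> c t out / b) / (\<Sum>u\<in>insert c G. exp (- score \<alpha> c t u / b))"

lemma exp_mech_pos: "finite G \<Longrightarrow> exp_mech G \<alpha> b c t out > 0"
  unfolding exp_mech_def by (intro divide_pos_pos sum_pos) auto

lemma exp_mech_sum: "finite G \<Longrightarrow> (\<Sum>u\<in>insert c G. exp_mech G \<alpha> b c t u) = 1"
proof -
  assume G: "finite G"
  have "(\<Sum>u\<in>insert c G. exp (- score \<alpha> c t u / b)) > 0" using G by (intro sum_pos) auto
  then show ?thesis unfolding exp_mech_def sum_divide_distrib[symmetric] by simp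
qed

text \<open>The weight of \<open>out\<close> and the normalising sum each change by at most a factor
  \<open>exp (\<Delta> / b)\<close>, whence the 2. The surcharge in \<open>score\<close> is
  independent of \<open>t\<close>.\<close>

lemma exp_mech_ratio:
  assumes G: "finite G" and b: "b > 0" and t: "\<bar>t - t'\<bar> \<le> \<Delta>"
  shows "exp_mech G \<alpha> b c t out \<le> exp (2 * \<Delta> / b) * exp_mech G \<alpha> b c t' out"
proof -
  let ?S = "\<lambda>t. \<Sum>u\<in>insert c G. exp (- score \<alpha> c t u / b)"
  have w: "exp (- score \<alpha> c s u / b) \<le> exp (\<Delta> / b) * exp (- score \<alpha> c s' u / b)"
    if "\<bar>s - s'\<bar> \<le> \<Delta>" for s s' u
  proof -
    have "score \<alpha> c s' u \<le> score \<alpha> c s u + \<Delta>" using that by (auto simp: score_def)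
    then have "- score \<alpha> c s u / b \<le> (\<Delta> + - score \<alpha> c s' u) / b"
      using b by (intro divide_right_mono) auto
    then show ?thesis by (simp add: diff_divide_distrib flip: exp_add)
  qed
  have pos: "?S s > 0" for s using G by (intro sum_pos) auto
  have "?S t' \<le> exp (\<Delta> / b) * ?S t"
    unfolding sum_distrib_left by (intro sum_mono w) (use t in auto)
  then have "1 / ?S t \<le> exp (\<Delta>/b) / ?S t'" using pos[of t] pos[of t'] by (simp add: field_simps)
  then have "exp (- score \<alpha> c t out / b) * (1 / ?S t) \<le>
     (exp (\<Delta> / b) * exp (- score \<alpha> c t' out / b)) * (exp (\<Delta>/b) / ?S t')"
    by (intro mult_mono w t) (use pos[of t] in \<open>auto simp: less_imp_le\<close>)
  also have "exp (\<Delta>/b) * exp (\<Delta>/b) = exp (2 * \<Delta> / b)" by (simp flip: exp_add)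
  then have "(exp (\<Delta> / b) * exp (- score \<alpha> c t' out / b)) * (exp (\<Delta>/b) / ?S t') =
     exp (2 * \<Delta> / b) * exp_mech G \<alpha> b c t' out"
    unfolding exp_mech_def by (simp add: mult.commute mult.left_commute)
  finally show ?thesis by (simp add: exp_mech_def)
qed

text \<open>The normalising sum contains the weight of the competitor \<open>u\<close>, so the
  probability of \<open>out\<close> is at most the ratio of these two weights.\<close>

lemma exp_mech_tail:
  assumes G: "finite G" and b: "b > 0" and u: "u \<in> insert c G"
    and big: "score \<alpha> c t out > score \<alpha> c t u + \<alpha>"
  shows "exp_mech G \<alpha> b c t out \<le> exp (- \<alpha> / b)"
proof -
  let ?S = "\<Sum>u\<in>insert c G. exp (- score \<alpha> c t u / b)"
  have S: "exp (- score \<alpha> c t u / b) \<le> ?S" using G u by (intro member_le_sum) auto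
  have "exp_mech G \<alpha> b c t out \<le> exp (- score \<alpha> c t out / b) / exp (- score \<alpha> c t u / b)"
    unfolding exp_mech_def using S
    by (intro divide_left_mono mult_pos_pos) (use less_le_trans[OF exp_gt_zero S] in auto)
  also have "\<dots> = exp (- (score \<alpha> c t out - score \<alpha> c t u) / b)"
    by (simp flip: exp_diff add: diff_divide_distrib)
  also have "\<dots> \<le> exp (- \<alpha> / b)"
    unfolding exp_le_cancel_iff using big b by (intro divide_right_mono) auto
  finally show ?thesis .
qed

section \<open>Adaptive queries on a classical sample\<close>

text \<open>The classical abstraction of the problem: \<open>P\<close> is the outcome law of one
  copy, \<open>q\<close> the truncated statistic of a query, \<open>p\<close> its true answer.
  Truncation only lowers the mean, hence the one-sided error \<open>\<alpha> / 4\<close>. Of the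
  squared distance between hypothesis and state, only nonnegativity, the initial bound and the
  effect of one update are kept. The analyst is fixed, so the assumptions concern the queries
  \<open>A h\<close> alone.\<close>

locale adaptive_analysis =
  fixes X :: "'z set" and P :: "'z \<Rightarrow> real" and q :: "'a \<Rightarrow> 'z \<Rightarrow> real"
    and N :: nat and B \<alpha> b :: real and G :: "real set"
    and hyp :: "('a \<times> real) list \<Rightarrow> 'a \<Rightarrow> real" and A :: "('a \<times> real) list \<Rightarrow> 'a"
    and p :: "'a \<Rightarrow> real" and dist :: "('a \<times> real) list \<Rightarrow> real"
  assumes finX: "finite X" and P_nonneg: "\<And>z. z \<in> X \<Longrightarrow> P z \<ge> 0" and P_sum: "sum P X = 1"
    and q_nonneg: "\<And>h z. z \<in> X \<Longrightarrow> 0 \<le> q (A h) z" and q_le: "\<And>h z. z \<in> X \<Longrightarrow> q (A h) z \<le> B"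
    and mean_le: "\<And>h. (\<Sum>z\<in>X. P z * q (A h) z) \<le> 1 + p (A h)"
    and mean_ge: "\<And>h. 1 + p (A h) - \<alpha> / 4 \<le> (\<Sum>z\<in>X. P z * q (A h) z)"
    and p_nonneg: "\<And>h. 0 \<le> p (A h)" and p_le: "\<And>h. p (A h) \<le> 1"
    and dist_nonneg: "\<And>h. dist h \<ge> 0" and dist_Nil: "dist [] \<le> 1"
    and dist_snoc: "\<And>h u. dist (h @ [(A h, u)]) =
      dist h - (hyp h (A h) - p (A h))\<^sup>2 + (u - p (A h))\<^sup>2"
    and N_pos: "N > 0" and B_ge: "B \<ge> 3" and \<alpha>_pos: "0 < \<alpha>" and \<alpha>_le: "\<alpha> \<le> 1" and b_pos: "b > 0"
    and finG: "finite G"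
    and grid: "\<And>t. -1 \<le> t \<Longrightarrow> t \<le> B - 1 \<Longrightarrow> \<exists>u\<in>G. \<bar>u - t\<bar> \<le> \<alpha>"
begin

definition cand :: "('a \<times> real) list \<Rightarrow> real set" where
  "cand h = insert (hyp h (A h)) G"

definition emp :: "(nat \<Rightarrow> 'z) \<Rightarrow> ('a \<times> real) list \<Rightarrow> real" where
  "emp x h = emp_mean N (q (A h)) x"

definition ker :: "(nat \<Rightarrow> 'z) \<Rightarrow> ('a \<times> real) list \<Rightarrow> real \<Rightarrow> real" where
  "ker x h u = exp_mech G \<alpha> b (hyp h (A h)) (emp x h) u"

text \<open>The second conjunct makes every accepted correction profitable, see
  \<open>dist_good\<close>. The constants are those of \<open>near_opt\<close> after moving
  \<open>t\<close> by at most \<alpha>: 6 + 1 = 7 and 3 - 2 = 1.\<close>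

definition good :: "('a \<times> real) list \<Rightarrow> real \<Rightarrow> bool" where
  "good h u \<longleftrightarrow> \<bar>u - p (A h)\<bar> \<le> 7 * \<alpha> \<and>
     (u \<noteq> hyp h (A h) \<longrightarrow> \<bar>hyp h (A h) - p (A h)\<bar> - \<bar>u - p (A h)\<bar> \<ge> \<alpha>)"

text \<open>What the mechanism achieves up to a slack of \<alpha> in \<open>score\<close>. Some grid
  point has score at most 5\<alpha> (rounding \<alpha>, surcharge 4\<alpha>), hence 6\<alpha>;
  leaving the hypothesis value costs 4\<alpha>, hence an improvement of at least 3\<alpha>.\<close>

definition near_opt :: "('a \<times> real) list \<Rightarrow> real \<Rightarrow> real \<Rightarrow> bool" where
  "near_opt h u t \<longleftrightarrow> \<bar>u - t\<bar> \<le> 6 * \<alpha> \<and>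
     (u \<noteq> hyp h (A h) \<longrightarrow> \<bar>hyp h (A h) - t\<bar> - \<bar>u - t\<bar> \<ge> 3 * \<alpha>)"

text \<open>\<open>near_opt h u\<close> is an interval of empirical values that plausibly lead to the answer \<open>u\<close>.
  If \<open>u\<close> is bad, the true value has distance more than \<open>\<alpha>\<close> from it, on one of its two sides.\<close>
definition below :: "('a \<times> real) list \<Rightarrow> real \<Rightarrow> bool" where
  "below h u \<longleftrightarrow> (\<forall>t. near_opt h u t \<longrightarrow> t < p (A h) - \<alpha>)"

definition above :: "('a \<times> real) list \<Rightarrow> real \<Rightarrow> bool" where
  "above h u \<longleftrightarrow> (\<forall>t. near_opt h u t \<longrightarrow> t > p (A h) + \<alpha>)"

text \<open>Expected value of \<open>\<Phi>\<close> at the first round whose answer is not \<open>good\<close>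
  (and \<open>0\<close> if there is none within \<open>k\<close> rounds), for a fixed data set \<open>x\<close>.\<close>
primrec stop_exp :: "(nat \<Rightarrow> 'z) \<Rightarrow> (('a \<times> real) list \<Rightarrow> real \<Rightarrow> real) \<Rightarrow> ('a \<times> real) list \<Rightarrow> nat \<Rightarrow> real" where
  "stop_exp x \<Phi> h 0 = 0"
| "stop_exp x \<Phi> h (Suc k) =
     (\<Sum>u\<in>cand h. ker x h u * (if good h u then stop_exp x \<Phi> (h @ [(A h, u)]) k else \<Phi> h u))"

definition XS :: "(nat \<Rightarrow> 'z) set" where "XS = PiE {..<N} (\<lambda>_. X)"

definition PN :: "(nat \<Rightarrow> 'z) \<Rightarrow> real" where "PN x = (\<Prod>i<N. P (x i))"

definition avg :: "((nat \<Rightarrow> 'z) \<Rightarrow> real) \<Rightarrow> real" where "avg F = (\<Sum>x\<in>XS. PN x * F x)"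

section \<open>Good answers and the decrease of the potential\<close>

lemma fin_cand: "finite (cand h)" using finG by (simp add: cand_def)

lemma ker_pos: "ker x h u > 0" unfolding ker_def by (rule exp_mech_pos[OF finG])

lemma ker_sum: "(\<Sum>u\<in>cand h. ker x h u) = 1" unfolding ker_def cand_def by (rule exp_mech_sum[OF finG])

lemma ker_le_1: "u \<in> cand h \<Longrightarrow> ker x h u \<le> 1"
  using member_le_sum[OF _ _ fin_cand, of u h "ker x h"] ker_sum[of x h] ker_pos[of x h]
  by (simp add: less_imp_le)

text \<open>If neither side is excluded, there are plausible empirical values \<open>s\<close> not
  far below and \<open>t\<close> not far above the truth. If one of them is within \<alpha> of the
  truth, \<open>good\<close> follows directly; otherwise the truth lies between them and inherits
  their estimates.\<close>

lemma not_good_cases: "\<not> good h u \<Longrightarrow> below h u \<or> above h u"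
proof (rule ccontr)
  assume ng: "\<not> good h u" and "\<not> (below h u \<or> above h u)"
  then obtain s t where s: "near_opt h u s" "s \<ge> p (A h) - \<alpha>" and t: "near_opt h u t" "t \<le> p (A h) + \<alpha>"
    unfolding below_def above_def by (auto simp: not_less)
  show False
  proof (cases "s \<le> p (A h) + \<alpha>")
    case True
    then have "\<bar>s - p (A h)\<bar> \<le> \<alpha>" using s by auto
    then have "good h u" using s(1) unfolding good_def near_opt_def by auto
    then show False using ng by simp
  next
    case s': False
    show False
    proof (cases "t \<ge> p (A h) - \<alpha>")
      case True
      then have "\<bar>t - p (A h)\<bar> \<le> \<alpha>" using t by auto
      then have "good h u" using t(1) unfolding good_def near_opt_def by auto
      then show False using ng by simp
    next
      case False
      then have "t \<le> p (A h)" "p (A h) \<le> s" using s' \<alpha>_pos by auto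
      moreover have "\<bar>u - s\<bar> \<le> 6 * \<alpha>" "\<bar>u - t\<bar> \<le> 6 * \<alpha>" using s(1) t(1) by (auto simp: near_opt_def)
      ultimately have close: "\<bar>u - p (A h)\<bar> \<le> 7 * \<alpha>" using \<alpha>_pos by linarith
      have "\<bar>hyp h (A h) - p (A h)\<bar> - \<bar>u - p (A h)\<bar> \<ge> \<alpha>" if "u \<noteq> hyp h (A h)"
      proof -
        have s3: "\<bar>hyp h (A h) - s\<bar> - \<bar>u - s\<bar> \<ge> 3 * \<alpha>" and t3: "\<bar>hyp h (A h) - t\<bar> - \<bar>u - t\<bar> \<ge> 3 * \<alpha>"
          using s(1) t(1) that by (auto simp: near_opt_def)
        show ?thesis
        \<comment> \<open>With c the hypothesis value,
          \<open>\<bar>c - t\<bar> - \<bar>u - t\<bar>\<close> is nonincreasing in \<open>t\<close>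
          if u is below c and nondecreasing otherwise, so the bound at one of the two endpoints
          carries over to the truth.\<close>
        proof (cases "u \<le> hyp h (A h)")
          case True then show ?thesis using s3 \<alpha>_pos \<open>p (A h) \<le> s\<close> by linarith
        next
          case False then show ?thesis using t3 \<alpha>_pos \<open>t \<le> p (A h)\<close> by linarith
        qed
      qed
      then have "good h u" using close by (simp add: good_def)
      then show False using ng by simp
    qed
  qed
qed

text \<open>Keeping the hypothesis value makes the two squares in \<open>dist_snoc\<close> cancel. A
  correction lowers the error from \<open>s\<close> to \<open>t\<close> with
  \<open>s \<ge> t + \<alpha>\<close>, so the squares differ by at least
  \<open>\<alpha>\<^sup>2\<close>.\<close>

lemma dist_good:
  assumes "good h u"
  shows "dist (h @ [(A h, u)]) \<le> dist h - (if u = hyp h (A h) then 0 else \<alpha>\<^sup>2)"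
proof (cases "u = hyp h (A h)")
  case True then show ?thesis by (simp add: dist_snoc)
next
  case False
  define s t where "s = \<bar>hyp h (A h) - p (A h)\<bar>" and "t = \<bar>u - p (A h)\<bar>"
  have st: "s \<ge> t + \<alpha>" "t \<ge> 0" using assms False by (auto simp: good_def s_def t_def)
  have "(t + \<alpha>)\<^sup>2 \<le> s\<^sup>2" using st \<alpha>_pos by (intro power_mono) auto
  moreover have "(t + \<alpha>)\<^sup>2 \<ge> t\<^sup>2 + \<alpha>\<^sup>2" using st \<alpha>_pos by (simp add: power2_sum)
  ultimately have "s\<^sup>2 - t\<^sup>2 \<ge> \<alpha>\<^sup>2" by linarith
  then show ?thesis using False by (simp add: dist_snoc s_def t_def)
qed

section \<open>The stopped expectation as a positive linear functional\<close>

lemma stop_exp_mono: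
  assumes "\<And>h u. \<Phi> h u \<le> \<Psi> h u"
  shows "stop_exp x \<Phi> h k \<le> stop_exp x \<Psi> h k"
  by (induction k arbitrary: h)
     (auto intro!: sum_mono mult_left_mono assms simp: ker_pos less_imp_le)

lemma stop_exp_const0: "stop_exp x (\<lambda>h u. 0) h k = 0"
  by (induction k arbitrary: h) (auto intro!: sum.neutral)

lemma stop_exp_nonneg: "(\<And>h u. 0 \<le> \<Phi> h u) \<Longrightarrow> 0 \<le> stop_exp x \<Phi> h k"
  using stop_exp_mono[of "\<lambda>_ _. 0" \<Phi> x h k] by (simp add: stop_exp_const0)

lemma stop_exp_linear:
  "stop_exp x (\<lambda>h u. a * \<Phi> h u + c * \<Psi> h u) h k = a * stop_exp x \<Phi> h k + c * stop_exp x \<Psi> h k"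
proof (induction k arbitrary: h)
  case (Suc k)
  show ?case
    unfolding stop_exp.simps sum_distrib_left sum.distrib[symmetric]
  proof (rule sum.cong[OF refl])
    fix u
    show "ker x h u * (if good h u then stop_exp x (\<lambda>h u. a * \<Phi> h u + c * \<Psi> h u) (h @ [(A h, u)]) k
        else a * \<Phi> h u + c * \<Psi> h u) =
      a * (ker x h u * (if good h u then stop_exp x \<Phi> (h @ [(A h, u)]) k else \<Phi> h u)) +
      c * (ker x h u * (if good h u then stop_exp x \<Psi> (h @ [(A h, u)]) k else \<Psi> h u))"
      by (cases "good h u") (simp_all add: Suc distrib_left mult.left_commute)
  qed
qed simp

lemma stop_exp_add: "stop_exp x (\<lambda>h u. \<Phi> h u + \<Psi> h u) h k = stop_exp x \<Phi> h k + stop_exp x \<Psi> h k"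
  using stop_exp_linear[of x 1 \<Phi> 1 \<Psi> h k] by simp

lemma stop_exp_cmult: "stop_exp x (\<lambda>h u. c * \<Phi> h u) h k = c * stop_exp x \<Phi> h k"
  using stop_exp_linear[of x c \<Phi> 0 \<Phi> h k] by simp

lemma stop_exp_sum:
  "stop_exp x (\<lambda>h u. \<Sum>i\<in>I. \<Phi> i h u) h k = (\<Sum>i\<in>I. stop_exp x (\<Phi> i) h k)"
proof (induction I rule: infinite_finite_induct)
  case (insert i I) then show ?case by (simp add: stop_exp_add)
qed (auto simp: stop_exp_const0)

section \<open>Accuracy of the answers with respect to the sample\<close>

lemma q_data: "x \<in> XS \<Longrightarrow> i < N \<Longrightarrow> x i \<in> X"
  by (auto simp: XS_def PiE_def Pi_def)

lemma emp_range:
  assumes "x \<in> XS" shows "-1 \<le> emp x h" "emp x h \<le> B - 1"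
proof -
  have "0 \<le> (\<Sum>i<N. q (A h) (x i))" using assms by (intro sum_nonneg) (auto intro: q_nonneg q_data)
  then show "-1 \<le> emp x h" by (simp add: emp_def emp_mean_def)
  have "(\<Sum>i<N. q (A h) (x i)) \<le> (\<Sum>i<N. B)" using assms by (intro sum_mono) (auto intro: q_le q_data)
  then have "(\<Sum>i<N. q (A h) (x i)) / N \<le> B" using N_pos by (simp add: field_simps)
  then show "emp x h \<le> B - 1" by (simp add: emp_def emp_mean_def)
qed

lemma emp_upd:
  assumes x: "x \<in> XS" and z: "z \<in> X" and i: "i < N"
  shows "\<bar>emp x h - emp (x(i:=z)) h\<bar> \<le> B / N"
proof -
  let ?f = "q (A h)"
  have "(\<Sum>j<N. ?f (x j)) - (\<Sum>j<N. ?f ((x(i:=z)) j)) = ?f (x i) - ?f z"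
    using i by (simp add: sum.remove[of "{..<N}" i])
  then have "emp x h - emp (x(i:=z)) h = (?f (x i) - ?f z) / N"
    by (simp add: emp_def emp_mean_def flip: diff_divide_distrib)
  moreover have "\<bar>?f (x i) - ?f z\<bar> \<le> B"
    using q_nonneg[OF z, of h] q_le[OF z, of h] q_nonneg[OF q_data[OF x i], of h] q_le[OF q_data[OF x i], of h]
    by auto
  ultimately show ?thesis using N_pos by (simp add: abs_divide divide_right_mono)
qed

text \<open>A union bound over at most \<open>card G + 1\<close> candidates, each beaten by more
  than \<alpha> in score.\<close>

definition \<beta> :: real where "\<beta> = (card G + 1) * exp (- \<alpha> / b)"

lemma not_near_opt_prob:
  assumes "x \<in> XS"
  shows "(\<Sum>u\<in>cand h. ker x h u * of_bool (\<not> near_opt h u (emp x h))) \<le> \<beta>"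
proof -
  let ?t = "emp x h" and ?c = "hyp h (A h)"
  obtain g where g: "g \<in> G" "\<bar>g - ?t\<bar> \<le> \<alpha>" using grid emp_range[OF assms] by blast
  have term_le: "ker x h u * of_bool (\<not> near_opt h u ?t) \<le> exp (- \<alpha> / b)" if "u \<in> cand h" for u
  proof (cases "near_opt h u ?t")
    case False
    \<comment> \<open>If the distance condition of \<open>near_opt\<close> fails, the nearby grid
      point \<open>g\<close> beats \<open>u\<close>; if the improvement condition fails, the
      hypothesis value does.\<close>
    then have "score \<alpha> ?c ?t u > score \<alpha> ?c ?t ?c + \<alpha> \<or> score \<alpha> ?c ?t u > score \<alpha> ?c ?t g + \<alpha>"
      using g \<alpha>_pos by (auto simp: near_opt_def score_def split: if_splits)
    then have "ker x h u \<le> exp (- \<alpha> / b)" unfolding ker_def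
      using exp_mech_tail[OF finG b_pos, of _ ?c \<alpha> ?t u] g(1) by blast
    then show ?thesis using False by simp
  qed auto
  have "(\<Sum>u\<in>cand h. ker x h u * of_bool (\<not> near_opt h u ?t)) \<le> (\<Sum>u\<in>cand h. exp (- \<alpha> / b))"
    by (rule sum_mono) (rule term_le)
  also have "\<dots> = card (cand h) * exp (- \<alpha> / b)" by simp
  also have "\<dots> \<le> \<beta>" unfolding \<beta>_def cand_def
    using finG by (intro mult_right_mono) (auto simp: card_insert_if)
  finally show ?thesis .
qed

lemma stop_exp_not_near_opt:
  assumes "x \<in> XS"
  shows "stop_exp x (\<lambda>h u. of_bool (\<not> near_opt h u (emp x h))) h k \<le> k * \<beta>"
proof (induction k arbitrary: h)
  case (Suc k)
  have b0: "\<beta> \<ge> 0" by (simp add: \<beta>_def)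
  have "stop_exp x (\<lambda>h u. of_bool (\<not> near_opt h u (emp x h))) h (Suc k) \<le>
     (\<Sum>u\<in>cand h. ker x h u * (k * \<beta>) + ker x h u * of_bool (\<not> near_opt h u (emp x h)))"
    unfolding stop_exp.simps
  proof (rule sum_mono)
    fix u
    have "(if good h u then stop_exp x (\<lambda>h u. of_bool (\<not> near_opt h u (emp x h))) (h @ [(A h, u)]) k
        else of_bool (\<not> near_opt h u (emp x h))) \<le> k * \<beta> + of_bool (\<not> near_opt h u (emp x h))"
      using Suc[of "h @ [(A h, u)]"] b0 by auto
    then show "ker x h u * (if good h u then stop_exp x (\<lambda>h u. of_bool (\<not> near_opt h u (emp x h))) (h @ [(A h, u)]) k
        else of_bool (\<not> near_opt h u (emp x h))) \<le>
      ker x h u * (k * \<beta>) + ker x h u * of_bool (\<not> near_opt h u (emp x h))"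
      unfolding distrib_left[symmetric] by (intro mult_left_mono less_imp_le[OF ker_pos])
  qed
  also have "\<dots> = k * \<beta> + (\<Sum>u\<in>cand h. ker x h u * of_bool (\<not> near_opt h u (emp x h)))"
    by (simp only: sum.distrib ker_sum mult_1_left flip: sum_distrib_right)
  also have "\<dots> \<le> k * \<beta> + \<beta>" using not_near_opt_prob[OF assms] by simp
  finally show ?case by (simp add: algebra_simps)
qed simp

text \<open>Markov's inequality for likelihood ratios: where \<open>a\<close> exceeds
  \<open>t * a'\<close>, the factor \<open>(a / (t * a')) ^ m\<close> is at least 1. This converts
  moment bounds into an approximate privacy guarantee.\<close>

lemma split_by_ratio:
  fixes a a' t :: real
  assumes "a > 0" "a' > 0" "t > 0"
  shows "a \<le> t * a' + a * (a / (t * a')) ^ m"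
proof (cases "a \<le> t * a'")
  case True then show ?thesis using assms by (simp add: add_increasing2)
next
  case False
  then have "1 \<le> (a / (t * a')) ^ m" using assms by (intro one_le_power) auto
  then have "a * 1 \<le> a * (a / (t * a')) ^ m" using assms by (intro mult_left_mono) auto
  moreover have "t * a' > 0" using assms by simp
  ultimately show ?thesis by linarith
qed

text \<open>The weights \<open>a\<close>, \<open>a'\<close> are the likelihoods of the transcript so far under the two samples; the
  potential \<open>dist\<close> pays \<open>exp \<kappa>\<close> for each correction.\<close>
lemma stop_exp_private_weighted:
  assumes close: "\<And>h. \<bar>emp x h - emp x' h\<bar> \<le> B / N"
    and y: "y = 2 * (B / N) / b" and ny: "real (Suc m) * y \<le> 1/6"
    and \<kappa>: "\<kappa> = 32 * (real (Suc m) * y)\<^sup>2"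
    and \<Phi>: "\<And>h u. 0 \<le> \<Phi> h u" "\<And>h u. \<Phi> h u \<le> c" and c: "c \<ge> 0"
    and t: "t > 0"
  shows "a > 0 \<Longrightarrow> a' > 0 \<Longrightarrow> a * stop_exp x \<Phi> h k \<le>
     t * a' * stop_exp x' \<Phi> h k + c * (a * (a / (t * a')) ^ m) * exp (\<kappa> * (1 + dist h / \<alpha>\<^sup>2))"
proof (induction k arbitrary: h a a')
  case 0 then show ?case using c t by simp
next
  case (Suc k)
  note a = Suc.prems
  let ?V = "\<lambda>h. exp (\<kappa> * (1 + dist h / \<alpha>\<^sup>2))"
  let ?c = "hyp h (A h)"
  have y0: "y \<ge> 0" unfolding y using B_ge b_pos by simp
  have \<kappa>0: "\<kappa> \<ge> 0" by (simp add: \<kappa>)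
  have ratio: "ker x h u \<le> exp y * ker x' h u" "ker x' h u \<le> exp y * ker x h u" for u
    using exp_mech_ratio[OF finG b_pos close[of h]]
      exp_mech_ratio[OF finG b_pos, of "emp x' h" "emp x h" "B / N"] close[of h]
    unfolding ker_def y by (simp_all add: abs_minus_commute)
  \<comment> \<open>The m-th power of the ratio integrated against \<open>ker x\<close> is its
    moment of order \<open>Suc m\<close> against \<open>ker x'\<close>.\<close>
  have step: "(\<Sum>u\<in>cand h. ker x h u * (ker x h u / ker x' h u) ^ m * (if u = ?c then 1 else exp (-\<kappa>))) \<le> 1"
  proof -
    have "(\<Sum>u\<in>cand h. ker x h u ^ Suc m / ker x' h u ^ (Suc m - 1) * (if u = ?c then 1 else exp (- (32 * (real (Suc m) * y)\<^sup>2)))) \<le> 1"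
      by (rule renyi_step[OF fin_cand]) (use ratio ker_pos ker_sum y0 ny in \<open>auto simp: cand_def\<close>)
    moreover have "ker x h u ^ Suc m / ker x' h u ^ (Suc m - 1) = ker x h u * (ker x h u / ker x' h u) ^ m" for u
      by (simp add: power_divide)
    ultimately show ?thesis by (simp only: \<kappa>)
  qed
  define E where "E u = c * (a * (a / (t * a')) ^ m) * ?V h *
     (ker x h u * (ker x h u / ker x' h u) ^ m * (if u = ?c then 1 else exp (-\<kappa>)))" for u
  have base0: "c * (a * (a / (t * a')) ^ m) \<ge> 0" using c a t by simp
  have main: "a * (ker x h u * (if good h u then stop_exp x \<Phi> (h @ [(A h, u)]) k else \<Phi> h u)) \<le>
     t * a' * (ker x' h u * (if good h u then stop_exp x' \<Phi> (h @ [(A h, u)]) k else \<Phi> h u)) + E u" for u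
  proof -
    let ?k = "ker x h u" and ?k' = "ker x' h u"
    define r where "r = ?k * (?k / ?k') ^ m"
    define s where "s = a * (a / (t * a')) ^ m"
    have kp: "?k > 0" "?k' > 0" by (simp_all add: ker_pos)
    \<comment> \<open>The error weight is multiplicative along a transcript: every round contributes
      one factor \<open>r\<close>.\<close>
    have pr: "(a * ?k) * ((a * ?k) / (t * (a' * ?k'))) ^ m = s * r"
      by (simp add: r_def s_def power_divide power_mult_distrib mult_ac)
    have wt: "0 \<le> c * s * r" and sr: "0 \<le> s * r"
      using c a t kp by (simp_all add: r_def s_def)
    have E: "E u = (c * s * r) * (?V h * (if u = ?c then 1 else exp (-\<kappa>)))"
      by (simp add: E_def r_def s_def)
    show ?thesis
    proof (cases "good h u")
      case True
      have "dist (h @ [(A h, u)]) / \<alpha>\<^sup>2 \<le> (dist h - (if u = ?c then 0 else \<alpha>\<^sup>2)) / \<alpha>\<^sup>2"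
        using dist_good[OF True] by (intro divide_right_mono) auto
      also have "\<dots> = dist h / \<alpha>\<^sup>2 - (if u = ?c then 0 else 1)" using \<alpha>_pos by (simp add: field_simps)
      finally have "\<kappa> * (1 + dist (h @ [(A h, u)]) / \<alpha>\<^sup>2) \<le> \<kappa> * (1 + (dist h / \<alpha>\<^sup>2 - (if u = ?c then 0 else 1)))"
        using \<kappa>0 by (intro mult_left_mono) auto
      then have "?V (h @ [(A h, u)]) \<le> exp (\<kappa> * (1 + (dist h / \<alpha>\<^sup>2 - (if u = ?c then 0 else 1))))"
        by simp
      also have "\<dots> = ?V h * (if u = ?c then 1 else exp (-\<kappa>))"
        by (auto simp: algebra_simps simp flip: exp_add)
      finally have V: "(c * s * r) * ?V (h @ [(A h, u)]) \<le> E u"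
        unfolding E using wt by (rule mult_left_mono)
      have "(a * ?k) * stop_exp x \<Phi> (h @ [(A h, u)]) k \<le>
         t * (a' * ?k') * stop_exp x' \<Phi> (h @ [(A h, u)]) k + c * (s * r) * ?V (h @ [(A h, u)])"
        using Suc.IH[of "a * ?k" "a' * ?k'" "h @ [(A h, u)]"] a kp unfolding pr by simp
      then show ?thesis using True V by (simp add: mult.assoc)
    next
      case False
      have "a * ?k \<le> t * (a' * ?k') + (a * ?k) * ((a * ?k) / (t * (a' * ?k'))) ^ m"
        by (rule split_by_ratio) (use a kp t in auto)
      then have "a * ?k * \<Phi> h u \<le> (t * (a' * ?k') + s * r) * \<Phi> h u"
        unfolding pr using \<Phi>(1) by (rule mult_right_mono)
      also have "\<dots> = t * (a' * ?k') * \<Phi> h u + s * r * \<Phi> h u"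
        by (simp add: distrib_right)
      also have "s * r * \<Phi> h u \<le> s * r * c"
        using \<Phi>(2) sr by (rule mult_left_mono)
      also have "s * r * c \<le> E u"
      proof -
        \<comment> \<open>The summand 1 in the exponent pays for the stopping answer itself, which
          may be a correction that does not decrease \<open>dist\<close>.\<close>
        have "1 \<le> exp (\<kappa> * (1 + dist h / \<alpha>\<^sup>2) - \<kappa>)" using \<kappa>0 dist_nonneg by (simp add: algebra_simps)
        moreover have "1 \<le> ?V h" using \<kappa>0 dist_nonneg by simp
        ultimately have "1 \<le> ?V h * (if u = ?c then 1 else exp (-\<kappa>))" by (auto simp flip: exp_add)
        from mult_left_mono[OF this wt] show ?thesis unfolding E by (simp add: mult_ac)
      qed
      finally show ?thesis using False by (simp add: mult.assoc)
    qed
  qed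
  have "a * stop_exp x \<Phi> h (Suc k) \<le> t * a' * stop_exp x' \<Phi> h (Suc k) + (\<Sum>u\<in>cand h. E u)"
    unfolding stop_exp.simps sum_distrib_left sum.distrib[symmetric] by (rule sum_mono) (rule main)
  also have "(\<Sum>u\<in>cand h. E u) \<le> c * (a * (a / (t * a')) ^ m) * ?V h * 1"
    unfolding E_def sum_distrib_left[symmetric] using base0 by (intro mult_left_mono step) auto
  finally show ?case by simp
qed

text \<open>Approximate differential privacy of the whole stopped interaction: start with both
  likelihoods 1 and threshold \<open>t = exp \<epsilon>\<close>. The term
  \<open>m * \<epsilon>\<close> comes from the m-th power of the threshold, the other one from the
  initial potential.\<close>

lemma stop_exp_private:
  assumes x: "x \<in> XS" and z: "z \<in> X" and i: "i < N"
    and y: "y = 2 * (B / N) / b" and ny: "real (Suc m) * y \<le> 1/6"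
    and \<Phi>: "\<And>h u. 0 \<le> \<Phi> h u" "\<And>h u. \<Phi> h u \<le> c" and c: "c \<ge> 0"
    and \<delta>: "\<delta> = exp (- (m * \<epsilon>) + 32 * (real (Suc m) * y)\<^sup>2 * (1 + 1 / \<alpha>\<^sup>2))"
  shows "stop_exp x \<Phi> [] k \<le> exp \<epsilon> * stop_exp (x(i:=z)) \<Phi> [] k + c * \<delta>"
    and "stop_exp (x(i:=z)) \<Phi> [] k \<le> exp \<epsilon> * stop_exp x \<Phi> [] k + c * \<delta>"
proof -
  let ?\<kappa> = "32 * (real (Suc m) * y)\<^sup>2"
  have "dist [] / \<alpha>\<^sup>2 \<le> 1 / \<alpha>\<^sup>2" using dist_Nil by (intro divide_right_mono) auto
  then have "?\<kappa> * (1 + dist [] / \<alpha>\<^sup>2) \<le> ?\<kappa> * (1 + 1 / \<alpha>\<^sup>2)" by (intro mult_left_mono) auto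
  then have le: "(1 / (exp \<epsilon>)) ^ m * exp (?\<kappa> * (1 + dist [] / \<alpha>\<^sup>2)) \<le> \<delta>"
  proof -
    have "(1 / exp \<epsilon>) ^ m = exp (- (m * \<epsilon>))"
      by (simp add: power_one_over exp_of_nat_mult exp_minus inverse_eq_divide)
    then show ?thesis
      unfolding \<delta> exp_add using \<open>?\<kappa> * (1 + dist [] / \<alpha>\<^sup>2) \<le> _\<close> by simp
  qed
  have close: "\<bar>emp x h - emp (x(i:=z)) h\<bar> \<le> B / N" "\<bar>emp (x(i:=z)) h - emp x h\<bar> \<le> B / N" for h
    using emp_upd[OF x z i, of h] by (simp_all add: abs_minus_commute)
  have one: "(0::real) < 1" by simp
  from stop_exp_private_weighted[where \<Phi>=\<Phi> and a=1 and a'=1 and t="exp \<epsilon>" and h="[]" and k=k,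
      OF close(1) y ny refl \<Phi> c exp_gt_zero one one] mult_left_mono[OF le c]
  show "stop_exp x \<Phi> [] k \<le> exp \<epsilon> * stop_exp (x(i:=z)) \<Phi> [] k + c * \<delta>"
    by (simp only: mult_1_left mult_1_right mult.assoc)
  from stop_exp_private_weighted[where \<Phi>=\<Phi> and a=1 and a'=1 and t="exp \<epsilon>" and h="[]" and k=k,
      OF close(2) y ny refl \<Phi> c exp_gt_zero one one] mult_left_mono[OF le c]
  show "stop_exp (x(i:=z)) \<Phi> [] k \<le> exp \<epsilon> * stop_exp x \<Phi> [] k + c * \<delta>"
    by (simp only: mult_1_left mult_1_right mult.assoc)
qed

section \<open>Averages over independent samples, and generalization from privacy\<close>

lemma PN_nonneg: "x \<in> XS \<Longrightarrow> PN x \<ge> 0"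
  unfolding PN_def by (intro prod_nonneg) (auto intro: P_nonneg q_data)

lemma PN_sum: "(\<Sum>x\<in>XS. PN x) = 1"
  unfolding PN_def XS_def using prod_sum_PiE[of "{..<N}" "\<lambda>_. X" "\<lambda>_. P"] by (simp add: finX P_sum)

lemma avg_mono: "(\<And>x. x \<in> XS \<Longrightarrow> F x \<le> F' x) \<Longrightarrow> avg F \<le> avg F'"
  unfolding avg_def by (intro sum_mono mult_left_mono PN_nonneg) auto

lemma avg_linear: "avg (\<lambda>x. a * F x + c * F' x) = a * avg F + c * avg F'"
  unfolding avg_def by (simp add: sum_distrib_left sum.distrib algebra_simps)

lemma avg_const: "avg (\<lambda>x. c) = c"
  unfolding avg_def by (simp add: PN_sum flip: sum_distrib_right)

lemma avg_affine: "avg (\<lambda>x. a * F x + c) = a * avg F + c"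
  using avg_linear[of a F 1 "\<lambda>_. c"] by (simp add: avg_const)

lemma avg_sum: "avg (\<lambda>x. \<Sum>i\<in>I. F i x) = (\<Sum>i\<in>I. avg (F i))"
  unfolding avg_def sum_distrib_left by (rule sum.swap)

text \<open>A fresh draw \<open>z\<close> and the entry \<open>x i\<close> that it replaces are exchangeable.\<close>
lemma avg_resample:
  assumes i: "i < N"
  shows "avg (\<lambda>x. \<Sum>z\<in>X. P z * F (x(i:=z)) (x i)) = avg (\<lambda>x. \<Sum>z\<in>X. P z * F x z)"
proof -
  have w: "PN x * P z = PN (x(i:=z)) * P (x i)" for x z
    using i by (simp add: PN_def prod.remove[of "{..<N}" i])
  have mem: "x(i:=z) \<in> XS" if "x \<in> XS" "z \<in> X" for x z
    using that i by (auto simp: XS_def PiE_def extensional_def)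
  have "avg (\<lambda>x. \<Sum>z\<in>X. P z * F (x(i:=z)) (x i)) =
    (\<Sum>(x,z)\<in>XS \<times> X. PN x * P z * F (x(i:=z)) (x i))"
    unfolding avg_def by (simp add: sum_distrib_left sum.cartesian_product mult.assoc)
  also have "\<dots> = (\<Sum>(x,z)\<in>XS \<times> X. PN x * P z * F x z)"
    by (rule sum.reindex_bij_witness[of _ "\<lambda>(x,z). (x(i:=z), x i)" "\<lambda>(x,z). (x(i:=z), x i)"])
       (auto simp: mem q_data i w[symmetric])
  also have "\<dots> = avg (\<lambda>x. \<Sum>z\<in>X. P z * F x z)"
    unfolding avg_def by (simp add: sum_distrib_left sum.cartesian_product mult.assoc)
  finally show ?thesis .
qed

definition mu :: "('a \<times> real) list \<Rightarrow> real" where "mu h = (\<Sum>z\<in>X. P z * q (A h) z)"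

lemma mu_bounds: "0 \<le> mu h" "mu h \<le> 2"
  unfolding mu_def using mean_le[of h] p_le[of h]
  by (auto intro!: sum_nonneg mult_nonneg_nonneg P_nonneg q_nonneg)

lemma stop_exp_mean:
  "(\<Sum>z\<in>X. P z * stop_exp x (\<lambda>h u. \<Phi> h u * q (A h) z) h k) = stop_exp x (\<lambda>h u. \<Phi> h u * mu h) h k"
  unfolding mu_def sum_distrib_left stop_exp_cmult[symmetric] stop_exp_sum[symmetric]
  by (simp add: mult.left_commute)

text \<open>\<open>W\<close> evaluates the query on an entry that influenced the transcript,
  \<open>U\<close> on an independent draw. Privacy replaces that entry by \<open>z\<close> in the
  transcript while the query still sees \<open>x i\<close>; by \<open>avg_resample\<close> the
  resulting pair is distributed like a sample and a fresh draw, whose mean is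
  \<open>mu\<close>.\<close>

lemma transfer:
  fixes k :: nat
  assumes i: "i < N"
    and y: "y = 2 * (B / N) / b" and ny: "real (Suc m) * y \<le> 1/6"
    and \<Phi>: "\<And>h u. 0 \<le> \<Phi> h u" "\<And>h u. \<Phi> h u \<le> 1"
    and \<delta>: "\<delta> = exp (- (m * \<epsilon>) + 32 * (real (Suc m) * y)\<^sup>2 * (1 + 1 / \<alpha>\<^sup>2))"
  defines "W \<equiv> avg (\<lambda>x. stop_exp x (\<lambda>h u. \<Phi> h u * q (A h) (x i)) [] k)"
    and "U \<equiv> avg (\<lambda>x. stop_exp x (\<lambda>h u. \<Phi> h u * mu h) [] k)"
  shows "W \<le> exp \<epsilon> * U + B * \<delta>" "U \<le> exp \<epsilon> * W + B * \<delta>"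
proof -
  let ?F = "\<lambda>x z. stop_exp x (\<lambda>h u. \<Phi> h u * q (A h) z) [] k"
  have R: "avg (\<lambda>x. \<Sum>z\<in>X. P z * ?F (x(i:=z)) (x i)) = U"
    using avg_resample[OF i, of ?F] unfolding U_def stop_exp_mean .
  have W: "W = avg (\<lambda>x. \<Sum>z\<in>X. P z * ?F x (x i))"
    unfolding W_def by (simp add: P_sum flip: sum_distrib_right)
  have dp: "?F x (x i) \<le> exp \<epsilon> * ?F (x(i:=z)) (x i) + B * \<delta>"
    "?F (x(i:=z)) (x i) \<le> exp \<epsilon> * ?F x (x i) + B * \<delta>" if "x \<in> XS" "z \<in> X" for x z
  proof -
    have "\<Phi> h u * q (A h) (x i) \<le> 1 * B" for h u
      by (rule mult_mono) (use \<Phi> q_le q_nonneg q_data[OF that(1) i] in auto)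
    moreover have "0 \<le> \<Phi> h u * q (A h) (x i)" for h u
      using \<Phi>(1) q_nonneg[OF q_data[OF that(1) i], of h] by simp
    moreover have "0 \<le> B" using B_ge by simp
    ultimately show "?F x (x i) \<le> exp \<epsilon> * ?F (x(i:=z)) (x i) + B * \<delta>"
      "?F (x(i:=z)) (x i) \<le> exp \<epsilon> * ?F x (x i) + B * \<delta>"
      using stop_exp_private[OF that i y ny _ _ _ \<delta>, of "\<lambda>h u. \<Phi> h u * q (A h) (x i)" B k] by simp_all
  qed
  have push: "(\<Sum>z\<in>X. P z * (exp \<epsilon> * f z + B * \<delta>)) = exp \<epsilon> * (\<Sum>z\<in>X. P z * f z) + B * \<delta>" for f
  proof -
    have "(\<Sum>z\<in>X. P z * (exp \<epsilon> * f z + B * \<delta>)) = (\<Sum>z\<in>X. exp \<epsilon> * (P z * f z) + B * \<delta> * P z)"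
      by (rule sum.cong) (simp_all add: algebra_simps)
    then show ?thesis by (simp only: sum.distrib P_sum mult_1_right flip: sum_distrib_left)
  qed
  have "W \<le> avg (\<lambda>x. \<Sum>z\<in>X. P z * (exp \<epsilon> * ?F (x(i:=z)) (x i) + B * \<delta>))"
    unfolding W by (intro avg_mono sum_mono mult_left_mono dp P_nonneg)
  then show "W \<le> exp \<epsilon> * U + B * \<delta>" unfolding push avg_affine R .
  have "U \<le> avg (\<lambda>x. \<Sum>z\<in>X. P z * (exp \<epsilon> * ?F x (x i) + B * \<delta>))"
    unfolding R[symmetric] by (intro avg_mono sum_mono mult_left_mono dp P_nonneg)
  then show "U \<le> exp \<epsilon> * W + B * \<delta>" unfolding push avg_affine W .
qed

lemma avg_emp:
  "avg (\<lambda>x. stop_exp x (\<lambda>h u. \<Phi> h u * emp x h) h k) =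
    (\<Sum>i<N. avg (\<lambda>x. stop_exp x (\<lambda>h u. \<Phi> h u * q (A h) (x i)) h k)) / N - avg (\<lambda>x. stop_exp x \<Phi> h k)"
proof -
  have "stop_exp x (\<lambda>h u. \<Phi> h u * emp x h) h k =
    (1/N) * (\<Sum>i<N. stop_exp x (\<lambda>h u. \<Phi> h u * q (A h) (x i)) h k) + (-1) * stop_exp x \<Phi> h k" for x
  proof -
    have "\<Phi> h u * emp x h = (1/N) * (\<Sum>i<N. \<Phi> h u * q (A h) (x i)) + (-1) * \<Phi> h u" for h u
      by (simp add: emp_def emp_mean_def right_diff_distrib flip: sum_distrib_left)
    then show ?thesis by (simp only: stop_exp_linear stop_exp_sum)
  qed
  then show ?thesis by (simp only: avg_linear avg_sum) simp
qed

lemma avg_add: "avg (\<lambda>x. F x + F' x) = avg F + avg F'"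
  using avg_linear[of 1 F 1 F'] by simp

text \<open>On \<open>below\<close> the empirical value lies more than \<alpha> under the truth
  unless the mechanism failed, whereas by \<open>transfer\<close> empirical and fresh means at the
  stopping round agree up to a factor \<open>exp (\<alpha>/8)\<close> and a small additive error.
  Comparing the two bounds the mass of the event. \<open>above\<close> is the mirror image, with
  sign \<sigma> = -1.\<close>

lemma private_tail:
  fixes k m :: nat
  assumes y: "y = 2 * (B / N) / b" and ny: "real (Suc m) * y \<le> 1/6"
    and \<delta>: "\<delta> = exp (- (m * (\<alpha>/8)) + 32 * (real (Suc m) * y)\<^sup>2 * (1 + 1 / \<alpha>\<^sup>2))"
  shows "avg (\<lambda>x. stop_exp x (\<lambda>h u. of_bool (below h u)) [] k) \<le> 2 * B * (\<delta> + k * \<beta>) / \<alpha>"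
    and "avg (\<lambda>x. stop_exp x (\<lambda>h u. of_bool (above h u)) [] k) \<le> 2 * B * (\<delta> + k * \<beta>) / \<alpha>"
proof -
  have \<delta>0: "\<delta> \<ge> 0" by (simp add: \<delta>)
  have B0: "B > 0" using B_ge by simp
  have main: "avg (\<lambda>x. stop_exp x \<Phi> [] k) \<le> 2 * B * (\<delta> + k * \<beta>) / \<alpha>"
    if \<Phi>: "\<And>h u. 0 \<le> \<Phi> h u" "\<And>h u. \<Phi> h u \<le> 1" and sg: "\<sigma> = 1 \<or> \<sigma> = -1"
      and dir: "\<And>x h u. x \<in> XS \<Longrightarrow> \<alpha> * \<Phi> h u \<le> \<sigma> * (\<Phi> h u * p (A h)) - \<sigma> * (\<Phi> h u * emp x h) + B * of_bool (\<not> near_opt h u (emp x h))"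
    for \<Phi> and \<sigma> :: real
  proof -
    \<comment> \<open>All quantities are taken at the stopping round with weight \<Phi>:
      \<open>F\<close> is the mass, \<open>Fp\<close> integrates the true value, \<open>U\<close>
      the mean of a fresh draw, and \<open>Wm\<close> the empirical mean before the shift by
      1.\<close>
    define F where "F = avg (\<lambda>x. stop_exp x \<Phi> [] k)"
    define Fp where "Fp = avg (\<lambda>x. stop_exp x (\<lambda>h u. \<Phi> h u * p (A h)) [] k)"
    define U where "U = avg (\<lambda>x. stop_exp x (\<lambda>h u. \<Phi> h u * mu h) [] k)"
    define W where "W i = avg (\<lambda>x. stop_exp x (\<lambda>h u. \<Phi> h u * q (A h) (x i)) [] k)" for i
    define Wm where "Wm = (\<Sum>i<N. W i) / N"
    have WU: "W i \<le> exp (\<alpha>/8) * U + B * \<delta>" "U \<le> exp (\<alpha>/8) * W i + B * \<delta>" if "i < N" for i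
      using transfer[OF that y ny _ _ \<delta>, of \<Phi> k] \<Phi> unfolding W_def U_def by auto
    have "(\<Sum>i<N. W i) \<le> (\<Sum>i<N. exp (\<alpha>/8) * U + B * \<delta>)" by (intro sum_mono WU) simp
    then have Wu: "Wm \<le> exp (\<alpha>/8) * U + B * \<delta>" using N_pos by (simp add: Wm_def field_simps)
    have "(\<Sum>i<N. U) \<le> (\<Sum>i<N. exp (\<alpha>/8) * W i + B * \<delta>)" by (intro sum_mono WU) simp
    also have "\<dots> = exp (\<alpha>/8) * (N * Wm) + N * (B * \<delta>)" using N_pos by (simp add: sum.distrib Wm_def flip: sum_distrib_left)
    finally have "N * U \<le> N * (exp (\<alpha>/8) * Wm + B * \<delta>)" by (simp add: algebra_simps)
    then have Ul: "U \<le> exp (\<alpha>/8) * Wm + B * \<delta>" using N_pos by simp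
    have F0: "F \<ge> 0" unfolding F_def using avg_mono[of "\<lambda>_. 0" "\<lambda>x. stop_exp x \<Phi> [] k"] stop_exp_nonneg[OF \<Phi>(1)]
      by (simp add: avg_const)
    have mid: "avg (\<lambda>x. stop_exp x (\<lambda>h u. \<Phi> h u * c h) [] k) \<le> K * F" if "\<And>h. c h \<le> K" for c K
    proof -
      have "stop_exp x (\<lambda>h u. \<Phi> h u * c h) [] k \<le> stop_exp x (\<lambda>h u. K * \<Phi> h u) [] k" for x
        by (rule stop_exp_mono) (use \<Phi>(1) that mult_left_mono mult.commute in metis)
      then have "avg (\<lambda>x. stop_exp x (\<lambda>h u. \<Phi> h u * c h) [] k) \<le> avg (\<lambda>x. K * stop_exp x \<Phi> [] k + 0)"
        by (intro avg_mono) (simp add: stop_exp_cmult)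
      then show ?thesis unfolding avg_affine by (simp add: F_def)
    qed
    have lin: "a * Fp + a * F - c * U \<le> K * F"
      if "\<And>h. a * (1 + p (A h)) - c * mu h \<le> K" for a c K
    proof -
      have "avg (\<lambda>x. stop_exp x (\<lambda>h u. \<Phi> h u * (a * (1 + p (A h)) - c * mu h)) [] k) \<le> K * F"
        by (rule mid[OF that])
      moreover have "(\<lambda>h u. \<Phi> h u * (a * (1 + p (A h)) - c * mu h)) =
         (\<lambda>h u. 1 * (a * (\<Phi> h u * p (A h)) + a * \<Phi> h u) + (-c) * (\<Phi> h u * mu h))"
        by (intro ext) (simp add: algebra_simps)
      ultimately show ?thesis
        by (simp only: stop_exp_linear avg_linear) (simp add: F_def Fp_def U_def)
    qed
    have insample: "\<alpha> * F \<le> \<sigma> * Fp - \<sigma> * (Wm - F) + B * (k * \<beta>)"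
    proof -
      have "\<alpha> * stop_exp x \<Phi> [] k \<le> \<sigma> * stop_exp x (\<lambda>h u. \<Phi> h u * p (A h)) [] k
          + 1 * ((-\<sigma>) * stop_exp x (\<lambda>h u. \<Phi> h u * emp x h) [] k + B * (k * \<beta>))" if x: "x \<in> XS" for x
      proof -
        have "stop_exp x (\<lambda>h u. \<alpha> * \<Phi> h u) [] k \<le>
          stop_exp x (\<lambda>h u. \<sigma> * (\<Phi> h u * p (A h)) + 1 * ((-\<sigma>) * (\<Phi> h u * emp x h) + B * of_bool (\<not> near_opt h u (emp x h)))) [] k"
        proof (rule stop_exp_mono)
          fix h u
          show "\<alpha> * \<Phi> h u \<le> \<sigma> * (\<Phi> h u * p (A h)) + 1 * ((-\<sigma>) * (\<Phi> h u * emp x h) + B * of_bool (\<not> near_opt h u (emp x h)))"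
            using dir[OF x, of h u] by simp
        qed
        moreover have "B * stop_exp x (\<lambda>h u. of_bool (\<not> near_opt h u (emp x h))) [] k \<le> B * (k * \<beta>)"
          using B0 by (intro mult_left_mono stop_exp_not_near_opt[OF x]) simp
        moreover have "r \<le> s + 1 * (t + v)" if "r \<le> s + 1 * (t + w)" "w \<le> v" for r s t v w :: real
          using that by simp
        ultimately show ?thesis unfolding stop_exp_linear stop_exp_cmult by blast
      qed
      then have "avg (\<lambda>x. \<alpha> * stop_exp x \<Phi> [] k + 0) \<le> avg (\<lambda>x. \<sigma> * stop_exp x (\<lambda>h u. \<Phi> h u * p (A h)) [] k
          + 1 * ((-\<sigma>) * stop_exp x (\<lambda>h u. \<Phi> h u * emp x h) [] k + B * (k * \<beta>)))"
        by (intro avg_mono) simp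
      then show ?thesis unfolding avg_affine avg_linear avg_emp
        by (simp add: F_def Fp_def Wm_def W_def)
    qed
    \<comment> \<open>Of the gap \<alpha>, at most half is lost. For \<sigma> = 1 the truncation
      bias and the factor \<open>exp (-(\<alpha>/8))\<close> on means of at most 2 take \<alpha>/4
      each; for \<sigma> = -1 there is no bias, and
      \<open>exp (\<alpha>/8) \<le> 1 + \<alpha>/4\<close> takes \<alpha>/2.\<close>
    have fin: "(\<alpha> / 2) * F \<le> B * \<delta> + B * (k * \<beta>)"
    proof (cases "\<sigma> = 1")
      case True
      have e: "exp (-(\<alpha>/8)) \<ge> 1 - \<alpha>/8" using exp_ge_add_one_self[of "-(\<alpha>/8)"] by simp
      have "exp (-(\<alpha>/8)) * U \<le> exp (-(\<alpha>/8)) * (exp (\<alpha>/8) * Wm + B * \<delta>)"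
        by (rule mult_left_mono[OF Ul]) simp
      also have "\<dots> = Wm + exp (-(\<alpha>/8)) * (B * \<delta>)" by (simp add: distrib_left exp_minus)
      also have "exp (-(\<alpha>/8)) * (B * \<delta>) \<le> 1 * (B * \<delta>)"
        using \<alpha>_pos B0 \<delta>0 by (intro mult_right_mono) auto
      finally have w: "exp (-(\<alpha>/8)) * U \<le> Wm + B * \<delta>" by simp
      have "1 * Fp + 1 * F - exp (-(\<alpha>/8)) * U \<le> (\<alpha>/2) * F"
      proof (rule lin)
        fix h
        have "(1 - \<alpha>/8) * mu h \<le> exp (-(\<alpha>/8)) * mu h" by (rule mult_right_mono[OF e mu_bounds(1)])
        moreover have "\<alpha>/8 * mu h \<le> \<alpha>/8 * 2" using mu_bounds(2) \<alpha>_pos by (intro mult_left_mono) auto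
        ultimately show "1 * (1 + p (A h)) - exp (-(\<alpha>/8)) * mu h \<le> \<alpha>/2"
          using mean_ge[of h] by (simp add: mu_def[symmetric] algebra_simps)
      qed
      then show ?thesis using insample w True by (simp add: algebra_simps)
    next
      case False
      then have s: "\<sigma> = -1" using sg by simp
      have e: "exp (\<alpha>/8) \<le> 1 + \<alpha>/4"
      proof -
        have "exp (\<alpha>/8) \<le> 1 + \<alpha>/8 + (\<alpha>/8)\<^sup>2" by (rule exp_le_quadratic) (use \<alpha>_pos \<alpha>_le in auto)
        moreover have "(\<alpha>/8)\<^sup>2 \<le> \<alpha>/8" using \<alpha>_pos \<alpha>_le by (simp add: power2_eq_square field_simps)
        ultimately show ?thesis by simp
      qed
      have "(-1) * Fp + (-1) * F - (- exp (\<alpha>/8)) * U \<le> (\<alpha>/2) * F"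
      proof (rule lin)
        fix h
        have "exp (\<alpha>/8) * mu h \<le> (1 + \<alpha>/4) * mu h" by (rule mult_right_mono[OF e mu_bounds(1)])
        moreover have "\<alpha>/4 * mu h \<le> \<alpha>/4 * 2" using mu_bounds(2) \<alpha>_pos by (intro mult_left_mono) auto
        ultimately show "(-1) * (1 + p (A h)) - (- exp (\<alpha>/8)) * mu h \<le> \<alpha>/2"
          using mean_le[of h] by (simp add: mu_def[symmetric] algebra_simps)
      qed
      then show ?thesis using insample Wu s by (simp add: algebra_simps)
    qed
    then show ?thesis using \<alpha>_pos by (simp add: F_def field_simps)
  qed
  show "avg (\<lambda>x. stop_exp x (\<lambda>h u. of_bool (below h u)) [] k) \<le> 2 * B * (\<delta> + k * \<beta>) / \<alpha>"
  proof (rule main[of _ 1])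
    fix x h u assume x: "x \<in> XS"
    show "\<alpha> * of_bool (below h u) \<le> 1 * (of_bool (below h u) * p (A h)) - 1 * (of_bool (below h u) * emp x h)
        + B * of_bool (\<not> near_opt h u (emp x h))"
      using emp_range[OF x, of h] p_nonneg[of h] \<alpha>_le B0 by (auto simp: below_def less_imp_le)
  qed auto
  show "avg (\<lambda>x. stop_exp x (\<lambda>h u. of_bool (above h u)) [] k) \<le> 2 * B * (\<delta> + k * \<beta>) / \<alpha>"
  proof (rule main[of _ "-1"])
    fix x h u assume x: "x \<in> XS"
    \<comment> \<open>Where \<open>near_opt\<close> fails, an empirical value of at least -1 and a
      true value of at most 1 leave \<open>B - 2\<close>, which exceeds \<alpha> because
      \<open>B \<ge> 3\<close>.\<close>
    show "\<alpha> * of_bool (above h u) \<le> (-1) * (of_bool (above h u) * p (A h)) - (-1) * (of_bool (above h u) * emp x h)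
        + B * of_bool (\<not> near_opt h u (emp x h))"
      using emp_range[OF x, of h] p_le[of h] \<alpha>_le B_ge by (auto simp: above_def less_imp_le)
  qed auto
qed

lemma failure_private:
  fixes k m :: nat
  assumes y: "y = 2 * (B / N) / b" and ny: "real (Suc m) * y \<le> 1/6"
    and \<delta>: "\<delta> = exp (- (m * (\<alpha>/8)) + 32 * (real (Suc m) * y)\<^sup>2 * (1 + 1 / \<alpha>\<^sup>2))"
  shows "avg (\<lambda>x. stop_exp x (\<lambda>h u. of_bool (\<not> good h u)) [] k) \<le> 4 * B * (\<delta> + k * \<beta>) / \<alpha>"
proof -
  have "stop_exp x (\<lambda>h u. of_bool (\<not> good h u)) [] k \<le>
     stop_exp x (\<lambda>h u. of_bool (below h u) + of_bool (above h u)) [] k" for x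
    by (rule stop_exp_mono) (use not_good_cases in \<open>auto simp: of_bool_def\<close>)
  then have "avg (\<lambda>x. stop_exp x (\<lambda>h u. of_bool (\<not> good h u)) [] k) \<le>
     avg (\<lambda>x. stop_exp x (\<lambda>h u. of_bool (below h u)) [] k + stop_exp x (\<lambda>h u. of_bool (above h u)) [] k)"
    by (intro avg_mono) (simp add: stop_exp_add)
  also have "\<dots> \<le> 2 * B * (\<delta> + k * \<beta>) / \<alpha> + 2 * B * (\<delta> + k * \<beta>) / \<alpha>"
    unfolding avg_add by (intro add_mono private_tail[OF y ny \<delta>])
  also have "\<dots> = 4 * B * (\<delta> + k * \<beta>) / \<alpha>" by simp
  finally show ?thesis .
qed

section \<open>Union bound over the tree of good transcripts\<close>

primrec dev_count :: "(nat \<Rightarrow> 'z) \<Rightarrow> ('a \<times> real) list \<Rightarrow> nat \<Rightarrow> real" where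
  "dev_count x h 0 = 0"
| "dev_count x h (Suc k) = of_bool (\<bar>emp x h - p (A h)\<bar> > \<alpha>) +
     (\<Sum>u\<in>cand h. if good h u then dev_count x (h @ [(A h, u)]) k else 0)"

primrec nodes :: "('a \<times> real) list \<Rightarrow> nat \<Rightarrow> real" where
  "nodes h 0 = 0"
| "nodes h (Suc k) = 1 + (\<Sum>u\<in>cand h. if good h u then nodes (h @ [(A h, u)]) k else 0)"

lemma dev_count_nonneg: "dev_count x h k \<ge> 0"
  by (induction k arbitrary: h) (auto intro!: add_nonneg_nonneg sum_nonneg)

text \<open>If no history along a path has an empirical value off by more than \<alpha>, a bad
  answer must violate \<open>near_opt\<close>, by \<open>not_good_cases\<close>. Deviating histories
  are counted without kernel weights, which is possible as \<open>ker\<close> is at most 1.\<close>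

lemma failure_le_dev_count:
  "stop_exp x (\<lambda>h u. of_bool (\<not> good h u)) h k \<le>
     stop_exp x (\<lambda>h u. of_bool (\<not> near_opt h u (emp x h))) h k + dev_count x h k"
proof (induction k arbitrary: h)
  case (Suc k)
  let ?d = "of_bool (\<bar>emp x h - p (A h)\<bar> > \<alpha>) :: real"
  let ?n = "\<lambda>h k. stop_exp x (\<lambda>h u. of_bool (\<not> near_opt h u (emp x h))) h k"
  have "stop_exp x (\<lambda>h u. of_bool (\<not> good h u)) h (Suc k) \<le> (\<Sum>u\<in>cand h.
      ker x h u * (if good h u then ?n (h @ [(A h, u)]) k else of_bool (\<not> near_opt h u (emp x h)))
      + (?d * ker x h u + (if good h u then dev_count x (h @ [(A h, u)]) k else 0)))"
    unfolding stop_exp.simps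
  proof (rule sum_mono)
    fix u assume u: "u \<in> cand h"
    show "ker x h u * (if good h u then stop_exp x (\<lambda>h u. of_bool (\<not> good h u)) (h @ [(A h, u)]) k
          else of_bool (\<not> good h u)) \<le>
      ker x h u * (if good h u then ?n (h @ [(A h, u)]) k else of_bool (\<not> near_opt h u (emp x h)))
      + (?d * ker x h u + (if good h u then dev_count x (h @ [(A h, u)]) k else 0))"
    proof (cases "good h u")
      case True
      have "ker x h u * stop_exp x (\<lambda>h u. of_bool (\<not> good h u)) (h @ [(A h, u)]) k \<le>
         ker x h u * (?n (h @ [(A h, u)]) k + dev_count x (h @ [(A h, u)]) k)"
        by (rule mult_left_mono[OF Suc]) (simp add: ker_pos less_imp_le)
      also have "\<dots> \<le> ker x h u * ?n (h @ [(A h, u)]) k + 1 * dev_count x (h @ [(A h, u)]) k"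
        unfolding distrib_left
        by (intro add_left_mono mult_right_mono ker_le_1[OF u] dev_count_nonneg)
      also have "\<dots> \<le> ker x h u * ?n (h @ [(A h, u)]) k + (?d * ker x h u + dev_count x (h @ [(A h, u)]) k)"
        by (simp add: ker_pos less_imp_le)
      finally show ?thesis using True by simp
    next
      case False
      have "(1::real) \<le> of_bool (\<not> near_opt h u (emp x h)) + ?d"
        using not_good_cases[OF False] by (fastforce simp: below_def above_def)
      from mult_left_mono[OF this less_imp_le[OF ker_pos[of x h u]]] show ?thesis using False
        by (simp add: distrib_left mult.commute)
    qed
  qed
  also have "\<dots> = ?n h (Suc k) + dev_count x h (Suc k)"
    by (simp add: sum.distrib ker_sum flip: sum_distrib_left)
  finally show ?case .
qed simp

text \<open>\<open>good\<close> does not look at the sample, so the tree is the same for all samples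
  and the average passes through the recursion, at a price of \<tau> per node.\<close>

lemma avg_dev_count:
  assumes "\<And>h. avg (\<lambda>x. of_bool (\<bar>emp x h - p (A h)\<bar> > \<alpha>)) \<le> \<tau>"
  shows "avg (\<lambda>x. dev_count x h k) \<le> \<tau> * nodes h k"
proof (induction k arbitrary: h)
  case 0 then show ?case by (simp add: avg_const)
next
  case (Suc k)
  have "avg (\<lambda>x. dev_count x h (Suc k)) = avg (\<lambda>x. of_bool (\<bar>emp x h - p (A h)\<bar> > \<alpha>)) +
     (\<Sum>u\<in>cand h. avg (\<lambda>x. if good h u then dev_count x (h @ [(A h, u)]) k else 0))"
    using avg_linear[of 1 _ 1] by (simp add: avg_sum)
  also have "\<dots> \<le> \<tau> + (\<Sum>u\<in>cand h. \<tau> * (if good h u then nodes (h @ [(A h, u)]) k else 0))"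
    by (intro add_mono assms sum_mono) (use Suc in \<open>auto simp: avg_const\<close>)
  also have "\<dots> = \<tau> * nodes h (Suc k)" by (simp add: distrib_left sum_distrib_left)
  finally show ?case .
qed

text \<open>The exponent \<open>e = dist h / \<alpha>\<^sup>2\<close> bounds the number of
  corrections still possible. The child that keeps the hypothesis value has exponent at most
  \<open>e\<close>, each of the others at most \<open>e - 1\<close>, so with base \<open>a\<close>
  the count is at most \<open>1 + a powr (1 + e) + card G * a powr e\<close>; increasing the base by
  \<open>card G + 1\<close> absorbs this.\<close>

lemma nodes_le: "nodes h k \<le> (1 + (card G + 1) * real k) powr (1 + dist h / \<alpha>\<^sup>2)"
proof (induction k arbitrary: h)
  case (Suc k)
  define a where "a = 1 + (card G + 1) * real k"
  define e where "e = dist h / \<alpha>\<^sup>2"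
  have a1: "a \<ge> 1" and e0: "e \<ge> 0" by (simp_all add: a_def e_def dist_nonneg)
  have "(\<Sum>u\<in>cand h. if good h u then nodes (h @ [(A h, u)]) k else 0) \<le>
      (\<Sum>u\<in>cand h. if u = hyp h (A h) then a powr (1 + e) else a powr e)"
  proof (rule sum_mono)
    fix u
    show "(if good h u then nodes (h @ [(A h, u)]) k else 0) \<le> (if u = hyp h (A h) then a powr (1 + e) else a powr e)"
    proof (cases "good h u")
      case True
      have "dist (h @ [(A h, u)]) / \<alpha>\<^sup>2 \<le> (dist h - (if u = hyp h (A h) then 0 else \<alpha>\<^sup>2)) / \<alpha>\<^sup>2"
        using dist_good[OF True] by (intro divide_right_mono) auto
      also have "\<dots> = e - (if u = hyp h (A h) then 0 else 1)" using \<alpha>_pos by (simp add: field_simps e_def)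
      finally have "a powr (1 + dist (h @ [(A h, u)]) / \<alpha>\<^sup>2) \<le> a powr (1 + (e - (if u = hyp h (A h) then 0 else 1)))"
        using a1 by (intro powr_mono) auto
      then show ?thesis using Suc[of "h @ [(A h, u)]"] True unfolding a_def[symmetric]
        by (auto split: if_splits)
    qed (use a1 in auto)
  qed
  also have "\<dots> \<le> a powr (1 + e) + card G * a powr e"
  proof -
    have "(\<Sum>u\<in>cand h. if u = hyp h (A h) then a powr (1 + e) else a powr e) =
      a powr (1 + e) + (\<Sum>u\<in>cand h - {hyp h (A h)}. a powr e)"
      using fin_cand[of h] by (subst sum.remove[of _ "hyp h (A h)"]) (auto simp: cand_def intro!: sum.cong)
    moreover have "real (card (cand h - {hyp h (A h)})) \<le> real (card G)"
      unfolding of_nat_le_iff by (rule card_mono[OF finG]) (auto simp: cand_def)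
    ultimately show ?thesis by (simp add: mult_right_mono)
  qed
  finally have "nodes h (Suc k) \<le> 1 + (a powr (1 + e) + card G * a powr e)" by simp
  also have "\<dots> \<le> a powr e + (a powr (1 + e) + card G * a powr e)" using a1 e0 by (simp add: ge_one_powr_ge_zero)
  also have "\<dots> = (a + card G + 1) * a powr e" using a1 by (simp add: powr_add algebra_simps)
  also have "\<dots> \<le> (a + card G + 1) * (a + card G + 1) powr e"
    using a1 e0 by (intro mult_left_mono powr_mono2) auto
  also have "\<dots> = (a + card G + 1) powr (1 + e)" using a1 by (simp add: powr_add)
  finally show ?case by (simp add: a_def e_def algebra_simps)
qed simp

section \<open>Concentration of the empirical value at a fixed history\<close>

lemma second_moment_le: "(\<Sum>z\<in>X. P z * (q (A h) z)\<^sup>2) \<le> 2 * B"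
proof -
  have "(\<Sum>z\<in>X. P z * (q (A h) z)\<^sup>2) \<le> (\<Sum>z\<in>X. B * (P z * q (A h) z))"
  proof (rule sum_mono)
    fix z assume z: "z \<in> X"
    have "(q (A h) z)\<^sup>2 \<le> B * q (A h) z" using q_nonneg[OF z] q_le[OF z] by (simp add: power2_eq_square mult_right_mono)
    from mult_left_mono[OF this P_nonneg[OF z]] show "P z * (q (A h) z)\<^sup>2 \<le> B * (P z * q (A h) z)"
      by (simp add: mult.left_commute)
  qed
  also have "\<dots> = B * mu h" by (simp add: mu_def sum_distrib_left)
  also have "\<dots> \<le> B * 2" using mu_bounds(2) B_ge by (intro mult_left_mono) auto
  finally show ?thesis by simp
qed

text \<open>A Bernstein-type estimate: the second moment is at most \<open>2 * B\<close> instead of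
  the square of the range, so the exponent in \<open>deviation_prob\<close> loses only one factor
  \<open>B\<close>.\<close>

lemma mgf_le:
  assumes "\<bar>s\<bar> * B \<le> 1"
  shows "(\<Sum>z\<in>X. P z * exp (s * q (A h) z)) \<le> exp (s * mu h + 2 * B * s\<^sup>2)"
proof -
  have "(\<Sum>z\<in>X. P z * exp (s * q (A h) z)) \<le> (\<Sum>z\<in>X. P z + s * (P z * q (A h) z) + s\<^sup>2 * (P z * (q (A h) z)\<^sup>2))"
  proof (rule sum_mono)
    fix z assume z: "z \<in> X"
    have "\<bar>s * q (A h) z\<bar> \<le> \<bar>s\<bar> * B" unfolding abs_mult
      using q_nonneg[OF z, of h] q_le[OF z, of h] by (intro mult_left_mono) auto
    then have "exp (s * q (A h) z) \<le> 1 + s * q (A h) z + (s * q (A h) z)\<^sup>2"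
      using assms by (intro exp_le_quadratic) auto
    from mult_left_mono[OF this P_nonneg[OF z]]
    show "P z * exp (s * q (A h) z) \<le> P z + s * (P z * q (A h) z) + s\<^sup>2 * (P z * (q (A h) z)\<^sup>2)"
      by (simp add: algebra_simps power_mult_distrib)
  qed
  also have "\<dots> = 1 + s * mu h + s\<^sup>2 * (\<Sum>z\<in>X. P z * (q (A h) z)\<^sup>2)"
    by (simp add: sum.distrib P_sum mu_def sum_distrib_left)
  also have "\<dots> \<le> 1 + s * mu h + s\<^sup>2 * (2 * B)" by (intro add_left_mono mult_left_mono second_moment_le) auto
  also have "\<dots> \<le> exp (s * mu h + s\<^sup>2 * (2 * B))"
    using exp_ge_add_one_self[of "s * mu h + s\<^sup>2 * (2 * B)"] by (simp only: add.assoc)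
  also have "s\<^sup>2 * (2 * B) = 2 * B * s\<^sup>2" by simp
  finally show ?thesis .
qed

lemma avg_exp_le:
  assumes "\<bar>s\<bar> * B \<le> 1"
  shows "avg (\<lambda>x. exp (s * (\<Sum>i<N. q (A h) (x i)))) \<le> exp (N * (s * mu h + 2 * B * s\<^sup>2))"
proof -
  have "avg (\<lambda>x. exp (s * (\<Sum>i<N. q (A h) (x i)))) = (\<Sum>x\<in>XS. \<Prod>i<N. P (x i) * exp (s * q (A h) (x i)))"
    unfolding avg_def PN_def by (simp add: sum_distrib_left exp_sum prod.distrib)
  also have "\<dots> = (\<Sum>z\<in>X. P z * exp (s * q (A h) z)) ^ N"
    unfolding XS_def using prod_sum_PiE[of "{..<N}" "\<lambda>_. X" "\<lambda>_ z. P z * exp (s * q (A h) z)"]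
    by (simp add: finX)
  also have "\<dots> \<le> exp (s * mu h + 2 * B * s\<^sup>2) ^ N"
    by (intro power_mono mgf_le assms sum_nonneg mult_nonneg_nonneg P_nonneg) auto
  also have "\<dots> = exp (N * (s * mu h + 2 * B * s\<^sup>2))" by (simp add: exp_of_nat_mult)
  finally show ?thesis .
qed

lemma deviation_prob:
  "avg (\<lambda>x. of_bool (\<bar>emp x h - p (A h)\<bar> > \<alpha>)) \<le> 2 * exp (- (N * \<alpha>\<^sup>2 / (32 * B)))"
proof -
  \<comment> \<open>The minimiser of \<open>2 * B * s\<^sup>2 - s * \<alpha> / 2\<close>.\<close>
  define s where "s = \<alpha> / (8 * B)"
  have B0: "B > 0" using B_ge by simp
  have s0: "s > 0" using \<alpha>_pos B0 by (simp add: s_def)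
  have sB: "\<bar>s\<bar> * B \<le> 1" "\<bar>-s\<bar> * B \<le> 1" using \<alpha>_pos \<alpha>_le B0 by (simp_all add: s_def)
  let ?S = "\<lambda>x. \<Sum>i<N. q (A h) (x i)"
  have pw: "of_bool (\<bar>emp x h - p (A h)\<bar> > \<alpha>) \<le>
     exp (- (N * (s * mu h + s * \<alpha> / 2))) * exp (s * ?S x) + exp (- (N * (-s * mu h + s * \<alpha> / 2))) * exp (-s * ?S x)" for x
  proof (cases "\<bar>emp x h - p (A h)\<bar> > \<alpha>")
    case True
    \<comment> \<open>The truncation bias takes at most \<alpha>/4 of the deviation, so more than
      \<alpha>/2 remains relative to the mean.\<close>
    then consider "?S x / N > mu h + \<alpha> / 2" | "?S x / N < mu h - \<alpha> / 2"
      using mean_le[of h] mean_ge[of h] \<alpha>_pos by (fastforce simp: emp_def emp_mean_def mu_def abs_if split: if_splits)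
    then show ?thesis
    proof cases
      case 1
      then have "N * (mu h + \<alpha> / 2) \<le> ?S x" using N_pos by (simp add: field_simps)
      then have "s * (N * (mu h + \<alpha> / 2)) \<le> s * ?S x" using s0 by (intro mult_left_mono) auto
      then have "1 \<le> exp (- (N * (s * mu h + s * \<alpha> / 2)) + s * ?S x)" by (simp add: algebra_simps)
      then show ?thesis using True unfolding exp_add by (simp add: add_increasing2)
    next
      case 2
      then have "?S x \<le> N * (mu h - \<alpha> / 2)" using N_pos by (simp add: field_simps)
      then have "s * ?S x \<le> s * (N * (mu h - \<alpha> / 2))" using s0 by (intro mult_left_mono) auto
      then have "1 \<le> exp (- (N * (-s * mu h + s * \<alpha> / 2)) + -s * ?S x)" by (simp add: algebra_simps)
      then show ?thesis using True unfolding exp_add by (simp add: add_increasing)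
    qed
  qed simp
  have "avg (\<lambda>x. of_bool (\<bar>emp x h - p (A h)\<bar> > \<alpha>)) \<le>
     exp (- (N * (s * mu h + s * \<alpha> / 2))) * avg (\<lambda>x. exp (s * ?S x)) +
     exp (- (N * (-s * mu h + s * \<alpha> / 2))) * avg (\<lambda>x. exp (-s * ?S x))"
    unfolding avg_linear[symmetric] by (rule avg_mono) (rule pw)
  also have "\<dots> \<le> exp (- (N * (s * mu h + s * \<alpha> / 2))) * exp (N * (s * mu h + 2 * B * s\<^sup>2)) +
     exp (- (N * (-s * mu h + s * \<alpha> / 2))) * exp (N * (-s * mu h + 2 * B * (-s)\<^sup>2))"
    by (intro add_mono mult_left_mono avg_exp_le sB) auto
  also have "\<dots> = 2 * exp (N * (2 * B * s\<^sup>2 - s * \<alpha> / 2))" by (simp add: algebra_simps flip: exp_add)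
  also have "2 * B * s\<^sup>2 - s * \<alpha> / 2 = - (\<alpha>\<^sup>2 / (32 * B))"
    using B0 by (simp add: s_def power2_eq_square field_simps)
  finally show ?thesis by simp
qed

text \<open>Independent of \<open>\<delta>\<close>, but needs order \<open>1 / \<alpha>\<^sup>4\<close> samples; used when \<open>\<delta>\<close> is so small that the
  Renyi order required by \<open>failure_private\<close> violates its condition on \<open>Suc m * y\<close>.\<close>
lemma failure_union:
  "avg (\<lambda>x. stop_exp x (\<lambda>h u. of_bool (\<not> good h u)) [] k) \<le>
     k * \<beta> + 2 * exp (- (N * \<alpha>\<^sup>2 / (32 * B))) * (1 + (card G + 1) * real k) powr (1 + 1 / \<alpha>\<^sup>2)"
proof -
  have "avg (\<lambda>x. stop_exp x (\<lambda>h u. of_bool (\<not> good h u)) [] k) \<le> avg (\<lambda>x. 1 * dev_count x [] k + k * \<beta>)"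
    using failure_le_dev_count stop_exp_not_near_opt by (intro avg_mono) (smt (verit))
  also have "\<dots> = avg (\<lambda>x. dev_count x [] k) + k * \<beta>" unfolding avg_affine by simp
  also have "avg (\<lambda>x. dev_count x [] k) \<le> 2 * exp (- (N * \<alpha>\<^sup>2 / (32 * B))) * nodes [] k"
    by (rule avg_dev_count[OF deviation_prob])
  also have "nodes [] k \<le> (1 + (card G + 1) * real k) powr (1 + 1 / \<alpha>\<^sup>2)"
  proof -
    have "dist [] / \<alpha>\<^sup>2 \<le> 1 / \<alpha>\<^sup>2" using dist_Nil by (intro divide_right_mono) auto
    then have "(1 + (card G + 1) * real k) powr (1 + dist [] / \<alpha>\<^sup>2) \<le> (1 + (card G + 1) * real k) powr (1 + 1 / \<alpha>\<^sup>2)"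
      by (intro powr_mono) auto
    with nodes_le[of "[]" k] show ?thesis by linarith
  qed
  finally show ?thesis by simp
qed

end

section \<open>Choice of the parameters\<close>

text \<open>The moment order is so large that \<open>exp (- (m * (\<alpha>/8)))\<close> outweighs
  the accumulated moment. \<open>Suc m * y\<close> is then at most
  \<open>\<alpha> * sqrt \<Lambda> / 8\<close>, which \<open>small\<close> keeps below 1/6.\<close>

lemma private_params:
  fixes \<alpha> B \<delta> \<Gamma> \<Lambda> :: real and N :: nat
  assumes \<alpha>: "0 < \<alpha>" "\<alpha> \<le> 1" and B: "B \<ge> 3" and \<delta>: "0 < \<delta>" "\<delta> < 1"
    and \<Lambda>: "\<Lambda> = ln (8 * B / (\<alpha> * \<delta>))" and \<Gamma>: "\<Gamma> > 0"
    and small: "\<alpha>\<^sup>2 * \<Lambda> \<le> 1" and N: "N \<ge> 288 * B * \<Gamma> * sqrt \<Lambda> / \<alpha> ^ 3"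
    and y: "y = 2 * (B / N) / (\<alpha> / \<Gamma>)"
  obtains m :: nat where "real (Suc m) * y \<le> 1/6"
    "exp (- (m * (\<alpha>/8)) + 32 * (real (Suc m) * y)\<^sup>2 * (1 + 1 / \<alpha>\<^sup>2)) \<le> \<alpha> * \<delta> / (8 * B)"
proof -
  have q: "8 * B / (\<alpha> * \<delta>) \<ge> 24"
  proof -
    have "\<alpha> * \<delta> \<le> 1" using \<alpha> \<delta> by (simp add: mult_le_one)
    then have "24 * (\<alpha> * \<delta>) \<le> 8 * B" using B by linarith
    then show ?thesis using \<alpha> \<delta> by (simp add: field_simps)
  qed
  have "exp (1::real) \<le> 24" using exp_le by simp
  also note q
  finally have \<Lambda>1: "\<Lambda> \<ge> 1" unfolding \<Lambda> using q by (subst ln_ge_iff) auto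
  have sq: "sqrt \<Lambda> \<ge> 1" using \<Lambda>1 by simp
  have ss: "sqrt \<Lambda> * sqrt \<Lambda> = \<Lambda>" using \<Lambda>1 by simp
  \<comment> \<open>This makes \<open>m * (\<alpha>/8)\<close> at least
    \<open>2 * \<Lambda>\<close>. The moment term costs at most \<Lambda> by the size of
    \<open>N\<close>, and the remaining \<open>exp (- \<Lambda>)\<close> is the target.\<close>
  define m where "m = nat \<lceil>16 * \<Lambda> / \<alpha>\<rceil>"
  have m1: "real m \<ge> 16 * \<Lambda> / \<alpha>" unfolding m_def by (rule real_nat_ceiling_ge)
  have "0 \<le> 16 * \<Lambda> / \<alpha>" using \<Lambda>1 \<alpha> by simp
  then have m2: "real m \<le> 16 * \<Lambda> / \<alpha> + 1" unfolding m_def by linarith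
  have "2 \<le> 2 * \<Lambda> / \<alpha>" using \<Lambda>1 \<alpha> by (simp add: field_simps)
  then have m3: "real (Suc m) \<le> 18 * \<Lambda> / \<alpha>" using m2 add_divide_distrib[of "16 * \<Lambda>" "2 * \<Lambda>" \<alpha>] by simp
  have Npos: "real N > 0"
    by (rule less_le_trans[OF _ N]) (use B \<Gamma> sq \<alpha> in auto)
  have y0: "y \<ge> 0" unfolding y using B \<Gamma> \<alpha> by simp
  have y1: "y \<le> \<alpha>\<^sup>2 / (144 * sqrt \<Lambda>)"
  proof -
    have "288 * B * \<Gamma> * sqrt \<Lambda> \<le> N * \<alpha> ^ 3" using N \<alpha> by (simp add: field_simps)
    then show ?thesis unfolding y using Npos \<alpha> sq \<Gamma>
      by (simp add: field_simps power2_eq_square power3_eq_cube)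
  qed
  have ny: "real (Suc m) * y \<le> \<alpha> * sqrt \<Lambda> / 8"
  proof -
    have "real (Suc m) * y \<le> (18 * \<Lambda> / \<alpha>) * (\<alpha>\<^sup>2 / (144 * sqrt \<Lambda>))"
      using m3 y1 y0 \<Lambda>1 \<alpha> by (intro mult_mono) auto
    also have "\<dots> = \<alpha> * (\<Lambda> / sqrt \<Lambda>) / 8" using \<alpha> sq by (simp add: field_simps power2_eq_square)
    also have "\<Lambda> / sqrt \<Lambda> = sqrt \<Lambda>" using \<Lambda>1 by (simp add: real_div_sqrt)
    finally show ?thesis .
  qed
  have as: "\<alpha> * sqrt \<Lambda> \<le> 1"
  proof (rule power2_le_imp_le)
    show "(\<alpha> * sqrt \<Lambda>)\<^sup>2 \<le> 1\<^sup>2" using small \<Lambda>1 by (simp add: power_mult_distrib)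
  qed simp
  have "(real (Suc m) * y)\<^sup>2 \<le> (\<alpha> * sqrt \<Lambda> / 8)\<^sup>2" using ny y0 by (intro power_mono) auto
  also have "\<dots> = \<alpha>\<^sup>2 * \<Lambda> / 64" using \<Lambda>1 by (simp add: power_mult_distrib power_divide)
  finally have n2: "(real (Suc m) * y)\<^sup>2 \<le> \<alpha>\<^sup>2 * \<Lambda> / 64" .
  have "1 \<le> 1 / \<alpha>\<^sup>2" using \<alpha> by (simp add: power_le_one)
  then have "1 + 1 / \<alpha>\<^sup>2 \<le> 2 / \<alpha>\<^sup>2" by simp
  then have "32 * (real (Suc m) * y)\<^sup>2 * (1 + 1 / \<alpha>\<^sup>2) \<le> 32 * (\<alpha>\<^sup>2 * \<Lambda> / 64) * (2 / \<alpha>\<^sup>2)"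
    using n2 \<Lambda>1 by (intro mult_mono) auto
  also have "\<dots> = \<Lambda>" using \<alpha> by simp
  finally have e1: "32 * (real (Suc m) * y)\<^sup>2 * (1 + 1 / \<alpha>\<^sup>2) \<le> \<Lambda>" .
  have "16 * \<Lambda> / \<alpha> * (\<alpha>/8) \<le> m * (\<alpha>/8)" using m1 \<alpha> by (intro mult_right_mono) auto
  then have "m * (\<alpha>/8) \<ge> 2 * \<Lambda>" using \<alpha> by simp
  then have "exp (- (m * (\<alpha>/8)) + 32 * (real (Suc m) * y)\<^sup>2 * (1 + 1 / \<alpha>\<^sup>2)) \<le> exp (- \<Lambda>)"
    using e1 by simp
  also have "\<dots> = \<alpha> * \<delta> / (8 * B)" unfolding \<Lambda> exp_minus using q by simp
  finally show ?thesis using that[of m] ny as by simp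
qed

text \<open>By \<open>big\<close>, \<open>N\<close> is at least
  \<open>288 * B * \<Gamma> / \<alpha> ^ 4\<close>. Concentration then contributes the exponent
  -9\<Gamma>/\<alpha>^2, against a tree size of at most exp(2\<Gamma>/\<alpha>^2).\<close>

lemma union_params:
  fixes \<alpha> B \<delta> \<Gamma> \<Lambda> K :: real and N :: nat
  assumes \<alpha>: "0 < \<alpha>" "\<alpha> \<le> 1" and B: "B \<ge> 3"
    and \<Gamma>: "\<Gamma> > 0" and big: "\<alpha>\<^sup>2 * \<Lambda> \<ge> 1" and N: "N \<ge> 288 * B * \<Gamma> * sqrt \<Lambda> / \<alpha> ^ 3"
    and K: "1 \<le> K" "K \<le> exp \<Gamma>"
  shows "exp (- (N * \<alpha>\<^sup>2 / (32 * B))) * K powr (1 + 1 / \<alpha>\<^sup>2) \<le> exp (- \<Gamma>)"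
proof -
  have "1 / \<alpha> \<le> sqrt \<Lambda>"
    by (rule real_le_rsqrt) (use big \<alpha> in \<open>simp add: power_divide field_simps\<close>)
  then have "288 * B * \<Gamma> * (1 / \<alpha>) / \<alpha> ^ 3 \<le> 288 * B * \<Gamma> * sqrt \<Lambda> / \<alpha> ^ 3"
    using B \<Gamma> \<alpha> by (intro divide_right_mono mult_left_mono) auto
  also note N
  finally have "288 * B * \<Gamma> * (1 / \<alpha>) / \<alpha> ^ 3 * (\<alpha>\<^sup>2 / (32 * B)) \<le> N * (\<alpha>\<^sup>2 / (32 * B))"
    using B by (intro mult_right_mono) auto
  then have e1: "9 * \<Gamma> / \<alpha>\<^sup>2 \<le> N * \<alpha>\<^sup>2 / (32 * B)"
    using B \<alpha> by (simp add: field_simps power2_eq_square power3_eq_cube)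
  have a2: "1 \<le> 1 / \<alpha>\<^sup>2" using \<alpha> by (simp add: power_le_one)
  have "K powr (1 + 1 / \<alpha>\<^sup>2) \<le> exp \<Gamma> powr (1 + 1 / \<alpha>\<^sup>2)" using K by (intro powr_mono2) auto
  also have "\<dots> = exp (\<Gamma> * (1 + 1 / \<alpha>\<^sup>2))" by (simp add: powr_def mult.commute)
  also have "\<Gamma> * (1 + 1 / \<alpha>\<^sup>2) \<le> \<Gamma> * (2 / \<alpha>\<^sup>2)" using a2 \<Gamma> by (intro mult_left_mono) auto
  finally have e2: "K powr (1 + 1 / \<alpha>\<^sup>2) \<le> exp (2 * \<Gamma> / \<alpha>\<^sup>2)" by (simp add: mult.commute)
  have "exp (- (N * \<alpha>\<^sup>2 / (32 * B))) * K powr (1 + 1 / \<alpha>\<^sup>2) \<le> exp (- (9 * \<Gamma> / \<alpha>\<^sup>2)) * exp (2 * \<Gamma> / \<alpha>\<^sup>2)"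
    using e1 e2 by (intro mult_mono) auto
  also have "\<dots> = exp (- (7 * \<Gamma> * (1 / \<alpha>\<^sup>2)))" by (simp flip: exp_add diff_divide_distrib)
  also have "\<dots> \<le> exp (- \<Gamma>)"
  proof -
    have "\<Gamma> * 1 \<le> (7 * \<Gamma>) * (1 / \<alpha>\<^sup>2)" using a2 \<Gamma> by (intro mult_mono) auto
    then show ?thesis by simp
  qed
  finally show ?thesis .
qed

text \<open>Since \<open>M \<ge> 2\<close> and \<open>\<epsilon> < 1/2\<close>, every logarithm
  involved is at least 1/2, so that constants and sums of logarithms are absorbed into products:
  \<Gamma> becomes a multiple of \<open>ln M * L\<close>, and \<Lambda> one of
  \<open>L\<close>.\<close>

lemma copies_bound:
  fixes c :: real
  assumes c: "c \<ge> 10"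
  obtains C :: real where "C > 0"
    "\<And>M \<epsilon> \<delta> \<alpha> B \<Lambda> \<Gamma>. \<lbrakk>M \<ge> (2::nat); 0 < \<epsilon>; \<epsilon> < 1/2; 0 < \<delta>; \<delta> < 1; \<alpha> = \<epsilon> / 8; B = c * ln (1 / \<epsilon>);
       \<Lambda> = ln (8 * B / (\<alpha> * \<delta>)); \<Gamma> = ln ((B / \<alpha> + 4) * M * (8 * B / (\<alpha> * \<delta>)))\<rbrakk> \<Longrightarrow>
      real (nat \<lceil>288 * B * \<Gamma> * sqrt \<Lambda> / \<alpha> ^ 3\<rceil>) \<le>
        C * ln (real M) * (ln (1 / (\<epsilon> * \<delta>))) powr (3/2) * ln (1 / \<epsilon>) / \<epsilon> ^ 3 \<and> \<Gamma> > 0 \<and> \<Lambda> \<ge> 1 \<and> B \<ge> 3"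
proof -
  define c2 where "c2 = 2 * ln (64 * c) + 2"
  define c3 where "c3 = 2 * ln (8 * c + 4) + 2"
  \<comment> \<open>The leading 2 absorbs the ceiling of a number that is at least 1; 512 is the
    cube of the 8 in \<open>\<alpha> = \<epsilon> / 8\<close>.\<close>
  define C where "C = 2 * 288 * c * (2 + 2 * (c2 + c3)) * sqrt c2 * 512"
  have c20: "c2 \<ge> 2" and c30: "c3 \<ge> 2" using c by (simp_all add: c2_def c3_def)
  have C0: "C > 0" unfolding C_def using c c20 c30 by (intro mult_pos_pos) auto
  have "real (nat \<lceil>288 * B * \<Gamma> * sqrt \<Lambda> / \<alpha> ^ 3\<rceil>) \<le>
        C * ln (real M) * (ln (1 / (\<epsilon> * \<delta>))) powr (3/2) * ln (1 / \<epsilon>) / \<epsilon> ^ 3 \<and> \<Gamma> > 0 \<and> \<Lambda> \<ge> 1 \<and> B \<ge> 3"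
    if M: "M \<ge> (2::nat)" and \<epsilon>: "0 < \<epsilon>" "\<epsilon> < 1/2" and \<delta>: "0 < \<delta>" "\<delta> < 1"
      and \<alpha>: "\<alpha> = \<epsilon> / 8" and B: "B = c * ln (1 / \<epsilon>)" and \<Lambda>: "\<Lambda> = ln (8 * B / (\<alpha> * \<delta>))"
      and \<Gamma>: "\<Gamma> = ln ((B / \<alpha> + 4) * M * (8 * B / (\<alpha> * \<delta>)))" for M \<epsilon> \<delta> \<alpha> B \<Lambda> \<Gamma>
  proof -
    define l where "l = ln (1 / \<epsilon>)"
    define L where "L = ln (1 / (\<epsilon> * \<delta>))"
    have ln2: "ln 2 \<ge> (1/2::real)"
    proof -
      have "exp (1/2::real) \<le> 2"
      proof -
        have "exp (1/2::real) \<le> 1 + 1/2 + (1/2)\<^sup>2" using exp_bound[of "1/2::real"] by simp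
        then show ?thesis by (simp add: power2_eq_square)
      qed
      then show ?thesis by (subst ln_ge_iff) auto
    qed
    have l: "l \<ge> 1/2"
    proof -
      have "ln 2 \<le> l" unfolding l_def using \<epsilon> by (subst ln_le_cancel_iff) (auto simp: field_simps)
      then show ?thesis using ln2 by linarith
    qed
    have lL: "l \<le> L" unfolding l_def L_def using \<epsilon> \<delta> by (subst ln_le_cancel_iff) (auto simp: field_simps mult_le_one)
    have L: "L \<ge> 1/2" using l lL by linarith
    have lM: "ln (real M) \<ge> 1/2"
    proof -
      have "ln 2 \<le> ln (real M)" using M by (subst ln_le_cancel_iff) auto
      then show ?thesis using ln2 by linarith
    qed
    have lle: "l \<le> 1 / \<epsilon>" unfolding l_def by (rule less_imp_le[OF ln_less_self]) (use \<epsilon> in auto)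
    have lnl: "ln l \<le> L" using ln_le_minus_one[of l] l lL by linarith
    have Bl: "B = c * l" by (simp add: B l_def)
    have "10 * (1/2) \<le> c * l" using c l by (intro mult_mono) auto
    then have B3: "B \<ge> 3" unfolding Bl by linarith
    have \<alpha>0: "\<alpha> > 0" and \<alpha>1: "\<alpha> \<le> 1" using \<epsilon> by (simp_all add: \<alpha>)
    have "\<Lambda> = ln ((64 * c) * l * (1 / (\<epsilon> * \<delta>)))" unfolding \<Lambda> Bl \<alpha> by (simp add: field_simps)
    also have "\<dots> = ln (64 * c) + ln l + L"     proof -
      have "ln ((64 * c) * l * (1 / (\<epsilon> * \<delta>))) = ln ((64 * c) * l) + L"
        unfolding L_def using c l \<epsilon> \<delta> by (intro ln_mult_pos) auto
      also have "ln ((64 * c) * l) = ln (64 * c) + ln l" using c l by (intro ln_mult_pos) auto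
      finally show ?thesis .
    qed
    also have "\<dots> \<le> (2 * ln (64 * c)) * L + L + L"
    proof -
      have "ln (64 * c) * 1 \<le> ln (64 * c) * (2 * L)" using c L by (intro mult_left_mono) auto
      then show ?thesis using lnl by simp
    qed
    finally have \<Lambda>L: "\<Lambda> \<le> c2 * L" by (simp add: c2_def algebra_simps)
    have q: "8 * B / (\<alpha> * \<delta>) \<ge> 24"
    proof -
      have "\<alpha> * \<delta> \<le> 1" using \<alpha>0 \<alpha>1 \<delta> by (simp add: mult_le_one)
      then have "24 * (\<alpha> * \<delta>) \<le> 8 * B" using B3 by linarith
      then show ?thesis using \<alpha>0 \<delta> by (simp add: field_simps)
    qed
    have "exp (1::real) \<le> 24" using exp_le by simp
    also note q
    finally have \<Lambda>1: "\<Lambda> \<ge> 1" unfolding \<Lambda> using q by (subst ln_ge_iff) auto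
    have g0: "B / \<alpha> + 4 \<ge> 4" using B3 \<alpha>0 by simp
    have \<Gamma>eq: "\<Gamma> = ln (B / \<alpha> + 4) + ln (real M) + \<Lambda>"
      unfolding \<Gamma> \<Lambda> using g0 M q by (subst ln_mult_pos, simp, simp, subst ln_mult_pos) auto
    have "ln (B / \<alpha> + 4) \<le> c3 * L"
    proof -
      have "1 \<le> 1 / \<epsilon>\<^sup>2" using \<epsilon> by (simp add: power_le_one)
      moreover have "B / \<alpha> \<le> 8 * c * (1 / \<epsilon>\<^sup>2)"
      proof -
        have "B / \<alpha> = 8 * c * (l * (1 / \<epsilon>))" by (simp add: Bl \<alpha>)
        also have "\<dots> \<le> 8 * c * ((1 / \<epsilon>) * (1 / \<epsilon>))"
          using lle c \<epsilon> by (intro mult_left_mono mult_right_mono) auto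
        finally show ?thesis by (simp add: power2_eq_square)
      qed
      ultimately have "B / \<alpha> + 4 \<le> (8 * c + 4) * (1 / \<epsilon>)\<^sup>2" by (simp add: power_divide algebra_simps)
      then have "ln (B / \<alpha> + 4) \<le> ln ((8 * c + 4) * (1 / \<epsilon>)\<^sup>2)" using g0 by (intro ln_mono) auto
      also have "\<dots> = ln (8 * c + 4) + 2 * l" unfolding l_def using c \<epsilon> by (simp add: ln_mult ln_realpow)
      also have "\<dots> \<le> ln (8 * c + 4) * (2 * L) + 2 * L"
      proof -
        have "ln (8 * c + 4) * 1 \<le> ln (8 * c + 4) * (2 * L)" using c L by (intro mult_left_mono) auto
        then show ?thesis using lL by simp
      qed
      finally show ?thesis by (simp add: c3_def algebra_simps)
    qed
    then have "\<Gamma> \<le> ln (real M) + (c2 + c3) * L" using \<Lambda>L \<Gamma>eq by (simp add: algebra_simps)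
    also have "\<dots> \<le> ln (real M) * (2 * L) + (c2 + c3) * (L * (2 * ln (real M)))"
    proof (rule add_mono)
      show "ln (real M) \<le> ln (real M) * (2 * L)" using L lM mult_left_mono[of 1 "2 * L" "ln (real M)"] by simp
      have "L * 1 \<le> L * (2 * ln (real M))" using L lM by (intro mult_left_mono) auto
      then show "(c2 + c3) * L \<le> (c2 + c3) * (L * (2 * ln (real M)))" using c20 c30 by (intro mult_left_mono) auto
    qed
    finally have \<Gamma>le: "\<Gamma> \<le> (2 + 2 * (c2 + c3)) * ln (real M) * L" by (simp add: algebra_simps)
    have \<Gamma>1: "\<Gamma> \<ge> 1"
    proof -
      have "ln (B / \<alpha> + 4) \<ge> 0" using g0 by simp
      then show ?thesis using \<Gamma>eq \<Lambda>1 lM by linarith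
    qed
    define Q where "Q = 288 * B * \<Gamma> * sqrt \<Lambda> / \<alpha> ^ 3"
    have Q1: "Q \<ge> 1"
    proof -
      have "1 * 1 * 1 \<le> 288 * B * \<Gamma> * sqrt \<Lambda>" using B3 \<Gamma>1 \<Lambda>1 by (intro mult_mono) auto
      moreover have "\<alpha> ^ 3 \<le> 1" using \<alpha>0 \<alpha>1 by (intro power_le_one) auto
      ultimately show ?thesis unfolding Q_def using \<alpha>0 by (simp add: field_simps)
    qed
    have "real (nat \<lceil>Q\<rceil>) \<le> 2 * Q" using Q1 by linarith
    also have "\<dots> = 2 * (288 * (c * l) * \<Gamma> * sqrt \<Lambda> * 512) / \<epsilon> ^ 3"
      unfolding Q_def Bl \<alpha> by (simp add: power_divide)
    also have "\<dots> \<le> 2 * (288 * (c * l) * ((2 + 2 * (c2 + c3)) * ln (real M) * L) * sqrt (c2 * L) * 512) / \<epsilon> ^ 3"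
      using \<Gamma>le \<Lambda>L \<Gamma>1 \<Lambda>1 c l \<epsilon> lM L c20 c30
      by (intro divide_right_mono mult_left_mono mult_right_mono mult_mono real_sqrt_le_mono) auto
    also have "\<dots> = C * ln (real M) * (L * sqrt L) * l / \<epsilon> ^ 3"
      by (simp add: C_def real_sqrt_mult mult_ac)
    also have "L * sqrt L = L powr (3/2)"
    proof -
      have "L powr (3/2) = L powr (1 + 1/2)" by simp
      also have "\<dots> = L * sqrt L" using L unfolding powr_add by (simp add: powr_half_sqrt)
      finally show ?thesis by simp
    qed
    finally show ?thesis using \<Gamma>1 \<Lambda>1 B3 by (simp add: Q_def l_def L_def)
  qed
  then show ?thesis using that[OF C0] by blast
qed

section \<open>The random product measurement\<close>

text \<open>The eight equally likely values have the moments
  \<open>E v = E v\<^sup>2 = E \<bar>v\<bar>\<^sup>2 v = 0\<close>, \<open>E \<bar>v\<bar>\<^sup>2 = 1\<close>, \<open>E \<bar>v\<bar>\<^sup>4 = 2\<close> of a standard complex Gaussian.\<close>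
definition ent :: "nat \<Rightarrow> complex" where
  "ent k = (if k < 4 then of_real (sqrt 2) * \<i> ^ k else 0)"

lemma sum_ent: "(\<Sum>k<8. f (ent k)) =
    f (of_real (sqrt 2)) + f (of_real (sqrt 2) * \<i>) + f (- of_real (sqrt 2)) + f (- (of_real (sqrt 2) * \<i>)) + 4 * f 0"
  for f :: "complex \<Rightarrow> 'a::comm_ring_1"
proof -
  have "{..<8::nat} = {0,1,2,3,4,5,6,7}" by auto
  then show ?thesis by (simp add: ent_def power3_eq_cube algebra_simps)
qed

definition mom :: "nat \<Rightarrow> nat \<Rightarrow> complex" where
  "mom a b = (\<Sum>k<8. cnj (ent k) ^ a * ent k ^ b)"

lemma mom_simps:
  "mom 0 0 = 8" "mom (Suc 0) (Suc 0) = 8" "mom 2 2 = 16"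
  "mom 0 (Suc 0) = 0" "mom (Suc 0) 0 = 0" "mom 0 2 = 0" "mom 2 0 = 0" "mom (Suc 0) 2 = 0" "mom 2 (Suc 0) = 0"
proof -
  define s where "s = complex_of_real (sqrt 2)"
  have s: "cnj s = s" "s * s = 2" by (simp_all add: s_def flip: of_real_mult)
  then have s': "s * (s * x) = 2 * x" for x by (simp flip: mult.assoc)
  have "mom a b = s ^ a * s ^ b + (- (s * \<i>)) ^ a * (s * \<i>) ^ b + (- s) ^ a * (- s) ^ b
     + (s * \<i>) ^ a * (- (s * \<i>)) ^ b + 4 * (0 ^ a * 0 ^ b)" for a b
    unfolding mom_def sum_ent[where f = "\<lambda>v. cnj v ^ a * v ^ b"] by (simp add: s flip: s_def)
  then show "mom 0 0 = 8" "mom (Suc 0) (Suc 0) = 8" "mom 2 2 = 16"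
    "mom 0 (Suc 0) = 0" "mom (Suc 0) 0 = 0" "mom 0 2 = 0" "mom 2 0 = 0" "mom (Suc 0) 2 = 0" "mom 2 (Suc 0) = 0"
    by (simp_all add: s s' power2_eq_square mult_ac)
qed

definition outcomes :: "nat \<Rightarrow> (nat \<Rightarrow> nat) set" where
  "outcomes d = PiE {..<d} (\<lambda>_. {..<8})"

lemma finite_outcomes: "finite (outcomes d)" unfolding outcomes_def by (intro finite_PiE) auto

lemma card_outcomes: "card (outcomes d) = 8 ^ d" unfolding outcomes_def by (simp add: card_PiE)

lemma sum_outcomes_prod:
  "(\<Sum>z\<in>outcomes d. \<Prod>i<d. f i (z i)) = (\<Prod>i<d. \<Sum>k<8. f i k)" for f :: "nat \<Rightarrow> nat \<Rightarrow> 'a::comm_semiring_1"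
  unfolding outcomes_def by (subst prod_sum_PiE) auto

lemma prod_indicator: "i < d \<Longrightarrow> (\<Prod>m<d. f m ^ of_bool (m = i)) = f i" for f :: "nat \<Rightarrow> complex"
  by (subst prod.remove[of _ i]) (auto intro!: prod.neutral)

lemma second_moment:
  assumes "i < d" "j < d"
  shows "(\<Sum>z\<in>outcomes d. cnj (ent (z i)) * ent (z j)) = 8 ^ d * of_bool (i = j)"
proof -
  let ?a = "\<lambda>m. of_bool (m = i)" and ?b = "\<lambda>m. of_bool (m = j)"
  have "(\<Sum>z\<in>outcomes d. cnj (ent (z i)) * ent (z j)) =
      (\<Sum>z\<in>outcomes d. \<Prod>m<d. cnj (ent (z m)) ^ ?a m * ent (z m) ^ ?b m)"
    using assms by (intro sum.cong) (auto simp: prod.distrib prod_indicator)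
  also have "\<dots> = (\<Prod>m<d. mom (?a m) (?b m))"
    by (simp add: sum_outcomes_prod[where f = "\<lambda>m k. cnj (ent k) ^ ?a m * ent k ^ ?b m"] mom_def)
  also have "\<dots> = 8 ^ d * of_bool (i = j)"
  proof (cases "i = j")
    case True
    then have "(\<Prod>m<d. mom (?a m) (?b m)) = (\<Prod>m<d. 8)" by (intro prod.cong) (auto simp: mom_simps)
    then show ?thesis using True by simp
  next
    case False
    then have "mom (?a i) (?b i) = 0" by (simp add: mom_simps)
    then show ?thesis using False assms by (auto intro!: bexI[of _ i])
  qed
  finally show ?thesis .
qed

text \<open>The Wick formula for complex Gaussians. If all four indices coincide, both pairings
  count, and this is the value \<open>E \<bar>v\<bar>^4 = 2\<close>; hence no diagonal correction
  appears.\<close>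

lemma fourth_moment:
  assumes "i < d" "j < d" "k < d" "l < d"
  shows "(\<Sum>z\<in>outcomes d. (cnj (ent (z i)) * ent (z j)) * (cnj (ent (z k)) * ent (z l))) =
    8 ^ d * (of_bool (i = j \<and> k = l) + of_bool (i = l \<and> j = k))"
proof -
  define a b :: "nat \<Rightarrow> nat" where "a m = of_bool (m = i) + of_bool (m = k)"
    and "b m = of_bool (m = j) + of_bool (m = l)" for m
  have "(\<Sum>z\<in>outcomes d. (cnj (ent (z i)) * ent (z j)) * (cnj (ent (z k)) * ent (z l))) =
      (\<Sum>z\<in>outcomes d. \<Prod>m<d. cnj (ent (z m)) ^ a m * ent (z m) ^ b m)"
    unfolding a_def b_def power_add
    using assms by (intro sum.cong) (auto simp: prod.distrib prod_indicator)
  also have "\<dots> = (\<Prod>m<d. mom (a m) (b m))"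
    by (simp add: sum_outcomes_prod[where f = "\<lambda>m k. cnj (ent k) ^ a m * ent k ^ b m"] mom_def)
  also have "\<dots> = 8 ^ d * (of_bool (i = j \<and> k = l) + of_bool (i = l \<and> j = k))"
  proof (cases "(i = j \<and> k = l) \<or> (i = l \<and> j = k)")
    case True
    then have ab: "b m = a m" for m by (auto simp: a_def b_def)
    have "mom (a m) (a m) = 8 * (if m = i \<and> i = k then 2 else 1)" for m
      unfolding a_def by (auto simp: mom_simps numeral_2_eq_2[symmetric])
    then have "(\<Prod>m<d. mom (a m) (b m)) = (\<Prod>m<d. 8 * (if m = i \<and> i = k then 2 else 1))"
      unfolding ab by simp
    also have "\<dots> = 8 ^ d * (\<Prod>m<d. if m = i then (if i = k then 2 else 1) else 1)"
      unfolding prod.distrib by (auto intro!: prod.cong)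
    also have "\<dots> = 8 ^ d * (if i = k then 2 else 1)" using assms by (simp add: prod.delta)
    finally show ?thesis using True by auto
  next
    case False
    \<comment> \<open>If \<open>i\<close> equals neither \<open>j\<close> nor \<open>l\<close>, its
      factor contains only conjugates and vanishes. Otherwise the factor at \<open>k\<close>
      vanishes, as a first moment or as a third one.\<close>
    have "\<exists>m<d. mom (a m) (b m) = 0"
    proof (cases "i \<noteq> j \<and> i \<noteq> l")
      case True
      then have "mom (a i) (b i) = 0" by (auto simp: a_def b_def mom_simps numeral_2_eq_2[symmetric])
      then show ?thesis using assms by blast
    next
      case nF: False
      then have "mom (a k) (b k) = 0" using False
        by (auto simp: a_def b_def mom_simps numeral_2_eq_2[symmetric])
      then show ?thesis using assms by blast
    qed
    then have "(\<Prod>m<d. mom (a m) (b m)) = 0" by (intro prod_zero) auto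
    moreover have "\<not> (i = j \<and> k = l)" "\<not> (i = l \<and> j = k)" using False by auto
    ultimately show ?thesis by (simp only: of_bool_eq) simp
  qed
  finally show ?thesis .
qed

text \<open>Functions in place of matrices and vectors, so that random vectors and hypotheses can be
  inserted without dimension bookkeeping.\<close>

definition sesq :: "nat \<Rightarrow> (nat \<Rightarrow> nat \<Rightarrow> complex) \<Rightarrow> (nat \<Rightarrow> complex) \<Rightarrow> complex" where
  "sesq d R v = (\<Sum>i<d. \<Sum>j<d. cnj (v i) * R i j * v j)"

lemma sum_sesq: "(\<Sum>z\<in>outcomes d. sesq d R (\<lambda>i. ent (z i))) = 8 ^ d * (\<Sum>i<d. R i i)"
proof -
  have "(\<Sum>z\<in>outcomes d. sesq d R (\<lambda>i. ent (z i))) =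
     (\<Sum>i<d. \<Sum>j<d. R i j * (\<Sum>z\<in>outcomes d. cnj (ent (z i)) * ent (z j)))"
    unfolding sesq_def sum_distrib_left
    by (subst sum.swap, rule sum.cong[OF refl], subst sum.swap) (simp add: mult_ac)
  also have "\<dots> = (\<Sum>i<d. \<Sum>j<d. 8 ^ d * (if i = j then R i j else 0))"
    by (intro sum.cong) (auto simp: second_moment)
  also have "\<dots> = 8 ^ d * (\<Sum>i<d. R i i)"
    unfolding sum_distrib_left[symmetric] by simp
  finally show ?thesis .
qed

text \<open>The two Wick pairings give tr(R) tr(S) and tr(RS). A rank-one \<open>S\<close> yields
  the unbiased estimator, and \<open>S = R\<close> the second moment of the outcome weights.\<close>

lemma sum_sesq_sesq:
  "(\<Sum>z\<in>outcomes d. sesq d R (\<lambda>i. ent (z i)) * sesq d S (\<lambda>i. ent (z i))) =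
     8 ^ d * ((\<Sum>i<d. R i i) * (\<Sum>i<d. S i i) + (\<Sum>i<d. \<Sum>j<d. R i j * S j i))"
proof -
  have "(\<Sum>z\<in>outcomes d. sesq d R (\<lambda>i. ent (z i)) * sesq d S (\<lambda>i. ent (z i))) =
     (\<Sum>z\<in>outcomes d. \<Sum>i<d. \<Sum>j<d. \<Sum>k<d. \<Sum>l<d. (R i j * S k l) *
        ((cnj (ent (z i)) * ent (z j)) * (cnj (ent (z k)) * ent (z l))))"
  proof (rule sum.cong[OF refl])
    fix z
    have pull: "(\<Sum>i<d. \<Sum>j<d. f i j) * (\<Sum>k<d. \<Sum>l<d. g k l) = (\<Sum>i<d. \<Sum>j<d. \<Sum>k<d. \<Sum>l<d. f i j * g k l)"
      for f g :: "nat \<Rightarrow> nat \<Rightarrow> complex"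
      unfolding sum_distrib_right unfolding sum_distrib_left ..
    show "sesq d R (\<lambda>i. ent (z i)) * sesq d S (\<lambda>i. ent (z i)) = (\<Sum>i<d. \<Sum>j<d. \<Sum>k<d. \<Sum>l<d. (R i j * S k l) *
        ((cnj (ent (z i)) * ent (z j)) * (cnj (ent (z k)) * ent (z l))))"
      unfolding sesq_def pull by (intro sum.cong refl) (simp add: mult_ac)
  qed
  also have "\<dots> = (\<Sum>i<d. \<Sum>j<d. \<Sum>k<d. \<Sum>l<d. (R i j * S k l) *
        (\<Sum>z\<in>outcomes d. (cnj (ent (z i)) * ent (z j)) * (cnj (ent (z k)) * ent (z l))))"
    unfolding sum_distrib_left
    apply (subst sum.swap, rule sum.cong[OF refl])
    apply (subst sum.swap, rule sum.cong[OF refl])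
    apply (subst sum.swap, rule sum.cong[OF refl])
    apply (subst sum.swap, rule sum.cong[OF refl])
    apply (rule refl)
    done
  also have "\<dots> = (\<Sum>i<d. \<Sum>j<d. \<Sum>k<d. 8 ^ d * ((if j = i then R i j * S k k else 0) + (if k = j then R i j * S k i else 0)))"
  proof (intro sum.cong refl)
    fix i j k assume "i \<in> {..<d}" "j \<in> {..<d}" "k \<in> {..<d}"
    then have ijk: "i < d" "j < d" "k < d" by auto
    have "(\<Sum>l<d. (R i j * S k l) * (\<Sum>z\<in>outcomes d. (cnj (ent (z i)) * ent (z j)) * (cnj (ent (z k)) * ent (z l)))) =
      (\<Sum>l<d. 8 ^ d * ((if l = k then if j = i then R i j * S k l else 0 else 0) + (if l = i then if k = j then R i j * S k l else 0 else 0)))"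
      by (rule sum.cong) (use ijk in \<open>auto simp: fourth_moment\<close>)
    also have "\<dots> = 8 ^ d * ((if j = i then R i j * S k k else 0) + (if k = j then R i j * S k i else 0))"
      unfolding sum_distrib_left[symmetric] sum.distrib using ijk by simp
    finally show "(\<Sum>l<d. (R i j * S k l) * (\<Sum>z\<in>outcomes d. (cnj (ent (z i)) * ent (z j)) * (cnj (ent (z k)) * ent (z l)))) =
      8 ^ d * ((if j = i then R i j * S k k else 0) + (if k = j then R i j * S k i else 0))" .
  qed
  also have "\<dots> = (\<Sum>i<d. \<Sum>j<d. 8 ^ d * ((if j = i then R i j * (\<Sum>k<d. S k k) else 0) + R i j * S j i))"
    unfolding sum_distrib_left[symmetric] sum.distrib
    by (intro arg_cong2[where f = "(*)"] arg_cong2[where f = "(+)"] sum.cong refl) (auto simp: sum_distrib_left)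
  also have "\<dots> = 8 ^ d * ((\<Sum>i<d. R i i * (\<Sum>k<d. S k k)) + (\<Sum>i<d. \<Sum>j<d. R i j * S j i))"
    unfolding sum_distrib_left[symmetric] sum.distrib by simp
  finally show ?thesis by (simp add: sum_distrib_right)
qed

section \<open>Dimension-free tails and the truncation error\<close>

lemma cosh_le: "exp x + exp (- x) \<le> 2 * exp (x\<^sup>2)" for x :: real
proof (cases "\<bar>x\<bar> \<le> 1")
  case True
  from exp_le_quadratic[of x] exp_le_quadratic[of "-x"] True have "exp x + exp (- x) \<le> 2 * (1 + x\<^sup>2)" by simp
  also have "\<dots> \<le> 2 * exp (x\<^sup>2)" by (intro mult_left_mono exp_ge_add_one_self) simp
  finally show ?thesis .
next
  case False
  then have "\<bar>x\<bar> * 1 \<le> \<bar>x\<bar> * \<bar>x\<bar>" by (intro mult_left_mono) auto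
  then have "\<bar>x\<bar> \<le> x\<^sup>2" by (simp add: power2_eq_square)
  then have "exp x \<le> exp (x\<^sup>2)" "exp (-x) \<le> exp (x\<^sup>2)" by auto
  from add_mono[OF this] show ?thesis by (simp only: mult_2)
qed

lemma sum_exp_ent: "(\<Sum>k<8. exp (s * Re (cnj (ent k) * c))) \<le> 8 * exp (2 * s\<^sup>2 * (cmod c)\<^sup>2)"
proof -
  let ?E = "exp (2 * s\<^sup>2 * (cmod c)\<^sup>2)"
  have b: "exp y + exp (-y) \<le> 2 * ?E" if "y\<^sup>2 \<le> 2 * s\<^sup>2 * (cmod c)\<^sup>2" for y
  proof -
    have "2 * exp (y\<^sup>2) \<le> 2 * ?E" using that by simp
    with cosh_le[of y] show ?thesis by (rule order_trans)
  qed
  have q: "(s * (sqrt 2 * w))\<^sup>2 \<le> 2 * s\<^sup>2 * (cmod c)\<^sup>2" if "\<bar>w\<bar> \<le> cmod c" for w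
  proof -
    have "w\<^sup>2 \<le> (cmod c)\<^sup>2" using power_mono[OF that, of 2] by simp
    then have "2 * s\<^sup>2 * w\<^sup>2 \<le> 2 * s\<^sup>2 * (cmod c)\<^sup>2" by (intro mult_left_mono) auto
    then show ?thesis by (simp add: power_mult_distrib mult_ac)
  qed
  have "(\<Sum>k<8. exp (s * Re (cnj (ent k) * c))) =
     (exp (s * (sqrt 2 * Re c)) + exp (- (s * (sqrt 2 * Re c)))) + (exp (s * (sqrt 2 * Im c)) + exp (- (s * (sqrt 2 * Im c)))) + 4"
    using sum_ent[of "\<lambda>v. exp (s * Re (cnj v * c))"] by simp
  also have "\<dots> \<le> 2 * ?E + 2 * ?E + 4 * ?E"
    by (intro add_mono b q abs_Re_le_cmod abs_Im_le_cmod) auto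
  finally show ?thesis by simp
qed

text \<open>Independence of the entries multiplies the coordinate bounds, so only the norm of
  \<open>c\<close> enters and the number of coordinates drops out.\<close>

lemma sum_exp_inner:
  "(\<Sum>z\<in>outcomes d. exp (s * Re (\<Sum>i<d. cnj (ent (z i)) * c i))) \<le> 8 ^ d * exp (2 * s\<^sup>2 * (\<Sum>i<d. (cmod (c i))\<^sup>2))"
proof -
  have "(\<Sum>z\<in>outcomes d. exp (s * Re (\<Sum>i<d. cnj (ent (z i)) * c i))) =
     (\<Sum>z\<in>outcomes d. \<Prod>i<d. exp (s * Re (cnj (ent (z i)) * c i)))"
    by (simp only: Re_sum sum_distrib_left exp_sum[OF finite_lessThan])
  also have "\<dots> = (\<Prod>i<d. \<Sum>k<8. exp (s * Re (cnj (ent k) * c i)))"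
    by (rule sum_outcomes_prod)
  also have "\<dots> \<le> (\<Prod>i<d. 8 * exp (2 * s\<^sup>2 * (cmod (c i))\<^sup>2))"
    by (intro prod_mono conjI sum_exp_ent sum_nonneg) auto
  also have "\<dots> = 8 ^ d * exp (2 * s\<^sup>2 * (\<Sum>i<d. (cmod (c i))\<^sup>2))"
    by (simp only: prod.distrib prod_constant card_lessThan sum_distrib_left exp_sum[OF finite_lessThan])
  finally show ?thesis .
qed

lemma pow4_le_exp: "y ^ 4 \<le> 24 * exp \<bar>y\<bar>" for y :: real
proof -
  have "\<bar>y\<bar> ^ 4 / fact 4 \<le> exp \<bar>y\<bar>"
    unfolding exp_def
    using sum_le_suminf[OF summable_exp, of "{4}" "\<bar>y\<bar>"] by (simp add: divide_inverse mult.commute)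
  then show ?thesis by (simp add: fact_numeral power_even_abs field_simps)
qed

text \<open>Beyond \<open>t\<close>, a factor \<open>exp (t/4 * (\<bar>y\<bar> - t))\<close> can be
  inserted for free. The slope t/4 suits the moment bound \<open>exp (2 * s\<^sup>2)\<close>: it
  gains t^2/4 and costs only t^2/8 in leading order.\<close>

lemma truncation_pointwise:
  fixes y t :: real
  assumes "t \<ge> 0"
  shows "(max 0 (y\<^sup>2 - t\<^sup>2))\<^sup>2 \<le> 24 * exp (- (t/4 * t)) * (exp ((1 + t/4) * y) + exp (- (1 + t/4) * y))"
proof (cases "\<bar>y\<bar> \<le> t")
  case True
  then have "y\<^sup>2 \<le> t\<^sup>2" using power_mono[OF True, of 2] by simp
  then show ?thesis by (simp add: add_nonneg_nonneg)
next
  case False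
  have "(max 0 (y\<^sup>2 - t\<^sup>2))\<^sup>2 \<le> (y\<^sup>2)\<^sup>2" by (intro power_mono) auto
  also have "\<dots> \<le> 24 * exp \<bar>y\<bar>" using pow4_le_exp[of y] by (simp add: power2_eq_square power4_eq_xxxx mult.assoc)
  also have "\<dots> \<le> 24 * (exp (t/4 * (\<bar>y\<bar> - t)) * exp \<bar>y\<bar>)"
    using False assms by simp
  also have "exp (t/4 * (\<bar>y\<bar> - t)) * exp \<bar>y\<bar> = exp (- (t/4 * t)) * exp ((1 + t/4) * \<bar>y\<bar>)"
  proof -
    have "t/4 * (\<bar>y\<bar> - t) + \<bar>y\<bar> = - (t/4 * t) + (1 + t/4) * \<bar>y\<bar>" by (simp add: field_simps)
    then show ?thesis by (simp only: exp_add[symmetric])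
  qed
  also have "exp ((1 + t/4) * \<bar>y\<bar>) \<le> exp ((1 + t/4) * y) + exp (- (1 + t/4) * y)"
  proof (cases "y \<ge> 0")
    case False
    then have "(1 + t/4) * \<bar>y\<bar> = - (1 + t/4) * y" by (simp add: algebra_simps)
    then show ?thesis by (simp only: add_increasing[OF exp_ge_zero order_refl])
  qed (simp add: add_increasing2)
  finally show ?thesis by simp
qed

text \<open>The outcome law is \<open>w\<close> relative to the uniform distribution, and only its
  second moment is controlled. Cauchy-Schwarz, in the form of a weighted AM-GM inequality, reduces
  the claim to uniformly distributed vectors, whose tails are sub-Gaussian.\<close>

lemma truncation_error:
  fixes c :: "nat \<Rightarrow> complex" and B :: real
  assumes c: "(\<Sum>i<d. (cmod (c i))\<^sup>2) = 1" and B: "B \<ge> 0"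
    and w: "(\<Sum>z\<in>outcomes d. (w z)\<^sup>2) \<le> 8 ^ d * 2"
  defines "Y \<equiv> \<lambda>z. (cmod (\<Sum>i<d. cnj (ent (z i)) * c i))\<^sup>2"
  shows "(\<Sum>z\<in>outcomes d. w z * (Y z - min (Y z) B)) \<le> 8 ^ d * ((1 + 96 * exp 6) * exp (- B / 64))"
proof -
  \<comment> \<open>With B split equally between the squares of the real and the imaginary part, the
    excess of \<open>Y\<close> over \<open>B\<close> is at most the sum of the two excesses over
    \<open>t\<^sup>2\<close>.\<close>
  define t where "t = sqrt (B / 2)"
  have t0: "t \<ge> 0" and t2: "t\<^sup>2 = B / 2" using B by (simp_all add: t_def)
  define y1 y2 where "y1 z = Re (\<Sum>i<d. cnj (ent (z i)) * c i)"
    and "y2 z = Re (\<Sum>i<d. cnj (ent (z i)) * (- \<i> * c i))" for z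
  have Yy: "Y z = (y1 z)\<^sup>2 + (y2 z)\<^sup>2" for z
  proof -
    have "(\<Sum>i<d. cnj (ent (z i)) * (- \<i> * c i)) = - \<i> * (\<Sum>i<d. cnj (ent (z i)) * c i)"
      by (simp add: sum_distrib_left mult_ac)
    then show ?thesis by (simp add: Y_def y1_def y2_def cmod_power2)
  qed
  define e where "e = (\<lambda>y. 24 * exp (- (t/4 * t)) * (exp ((1 + t/4) * y) + exp (- (1 + t/4) * y)))"
  have sq: "(Y z - min (Y z) B)\<^sup>2 \<le> 2 * (e (y1 z) + e (y2 z))" for z
  proof -
    let ?a = "max 0 ((y1 z)\<^sup>2 - t\<^sup>2)" and ?b = "max 0 ((y2 z)\<^sup>2 - t\<^sup>2)"
    have "0 \<le> Y z - min (Y z) B" "Y z - min (Y z) B \<le> ?a + ?b" using t2 by (auto simp: Yy)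
    then have "(Y z - min (Y z) B)\<^sup>2 \<le> (?a + ?b)\<^sup>2" by (intro power_mono) auto
    also have "\<dots> \<le> 2 * (?a\<^sup>2 + ?b\<^sup>2)"
      using sum_squares_bound[of ?a ?b] by (simp add: power2_sum)
    also have "\<dots> \<le> 2 * (e (y1 z) + e (y2 z))"
      unfolding e_def by (intro mult_left_mono add_mono truncation_pointwise t0) auto
    finally show ?thesis .
  qed
  have E1: "(\<Sum>z\<in>outcomes d. exp (s * y1 z)) \<le> 8 ^ d * exp (2 * s\<^sup>2)" for s
    using sum_exp_inner[where c = c and s = s and d = d] unfolding c y1_def mult_1_right .
  have c': "(\<Sum>i<d. (cmod (- \<i> * c i))\<^sup>2) = 1" using c by (simp add: norm_mult)
  have E2: "(\<Sum>z\<in>outcomes d. exp (s * y2 z)) \<le> 8 ^ d * exp (2 * s\<^sup>2)" for s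
    using sum_exp_inner[where c = "\<lambda>i. - \<i> * c i" and s = s and d = d] unfolding c' y2_def mult_1_right .
  let ?K = "exp (2 * (1 + t/4)\<^sup>2)"
  have Ee: "(\<Sum>z\<in>outcomes d. e (y z)) \<le> 24 * exp (- (t/4 * t)) * (8 ^ d * ?K + 8 ^ d * ?K)"
    if "\<And>s. (\<Sum>z\<in>outcomes d. exp (s * y z)) \<le> 8 ^ d * exp (2 * s\<^sup>2)" for y :: "(nat \<Rightarrow> nat) \<Rightarrow> real"
  proof -
    have "(\<Sum>z\<in>outcomes d. exp ((1 + t/4) * y z)) \<le> 8 ^ d * ?K" by (rule that)
    moreover have "(\<Sum>z\<in>outcomes d. exp (- (1 + t/4) * y z)) \<le> 8 ^ d * ?K"
      using that[of "- (1 + t/4)"] by (simp only: power2_minus)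
    ultimately show ?thesis
      unfolding e_def sum_distrib_left[symmetric] sum.distrib by (intro mult_left_mono add_mono) auto
  qed
  have "(\<Sum>z\<in>outcomes d. (Y z - min (Y z) B)\<^sup>2) \<le> (\<Sum>z\<in>outcomes d. 2 * (e (y1 z) + e (y2 z)))"
    by (rule sum_mono) (rule sq)
  also have "\<dots> \<le> 2 * (24 * exp (- (t/4 * t)) * (8 ^ d * ?K + 8 ^ d * ?K) + 24 * exp (- (t/4 * t)) * (8 ^ d * ?K + 8 ^ d * ?K))"
    unfolding sum_distrib_left[symmetric] sum.distrib
    by (intro mult_left_mono add_mono Ee E1 E2) auto
  also have "\<dots> = 8 ^ d * (192 * (exp (- (t/4 * t)) * ?K))" by simp
  also have "exp (- (t/4 * t)) * ?K = exp (2 * (1 + t/4)\<^sup>2 - t/4 * t)" by (simp flip: exp_add)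
  also have "2 * (1 + t/4)\<^sup>2 - t/4 * t = 2 + t - t\<^sup>2 / 8" by (simp add: power2_eq_square field_simps)
  also have "8 ^ d * (192 * exp (2 + t - t\<^sup>2 / 8)) \<le> 8 ^ d * (192 * exp (6 - B / 32))"
  proof -
    \<comment> \<open>Completing the square absorbs the linear term \<open>t\<close> at the cost of
      half the quadratic decay.\<close>
    have "0 \<le> (t / 4 - 2)\<^sup>2" by simp
    then have "2 + t - t\<^sup>2 / 8 \<le> 6 - B / 32" using t2 by (simp add: power2_eq_square field_simps)
    then show ?thesis by simp
  qed
  finally have X2: "(\<Sum>z\<in>outcomes d. (Y z - min (Y z) B)\<^sup>2) \<le> 8 ^ d * (192 * exp (6 - B / 32))" .
  \<comment> \<open>The square root of the decay \<open>exp (- B / 32)\<close>, so that both halves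
    of the AM-GM bound become multiples of \<open>g\<close>.\<close>
  define g where "g = exp (- B / 64)"
  have g0: "g > 0" by (simp add: g_def)
  have amgm: "w z * X \<le> (g / 2) * (w z)\<^sup>2 + (1 / (2 * g)) * X\<^sup>2" for z and X :: real
  proof -
    have "0 \<le> (g * w z - X)\<^sup>2" by simp
    then show ?thesis using g0 by (simp add: power2_eq_square field_simps)
  qed
  have "(\<Sum>z\<in>outcomes d. w z * (Y z - min (Y z) B)) \<le>
     (\<Sum>z\<in>outcomes d. (g / 2) * (w z)\<^sup>2 + (1 / (2 * g)) * (Y z - min (Y z) B)\<^sup>2)"
    by (rule sum_mono) (rule amgm)
  also have "\<dots> = (g / 2) * (\<Sum>z\<in>outcomes d. (w z)\<^sup>2) + (1 / (2 * g)) * (\<Sum>z\<in>outcomes d. (Y z - min (Y z) B)\<^sup>2)"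
    by (simp add: sum.distrib sum_distrib_left)
  also have "\<dots> \<le> (g / 2) * (8 ^ d * 2) + (1 / (2 * g)) * (8 ^ d * (192 * exp (6 - B / 32)))"
    using g0 by (intro add_mono mult_left_mono w X2) auto
  also have "exp (6 - B / 32) = exp 6 * (g * g)"
    by (simp add: g_def flip: exp_add)
  also have "(g / 2) * (8 ^ d * 2) + (1 / (2 * g)) * (8 ^ d * (192 * (exp 6 * (g * g)))) = 8 ^ d * ((1 + 96 * exp 6) * g)"
    using g0 by (simp add: field_simps)
  finally show ?thesis by (simp add: g_def)
qed

section \<open>States and hypothesis matrices\<close>

definition entries :: "complex mat \<Rightarrow> nat \<Rightarrow> nat \<Rightarrow> complex" where "entries A i j = A $$ (i, j)"

lemma qform_sesq: "dim_vec v = d \<Longrightarrow> qform A v = sesq d (entries A) (\<lambda>i. v $ i)"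
  by (simp add: qform_def sesq_def entries_def)

lemma sesq_cong: "(\<And>i. i < d \<Longrightarrow> f i = g i) \<Longrightarrow> sesq d R f = sesq d R g"
  unfolding sesq_def by (intro sum.cong) auto

lemma psd_sesq:
  assumes "psd d A"
  shows "Im (sesq d (entries A) f) = 0" "Re (sesq d (entries A) f) \<ge> 0"
proof -
  have "qform A (vec d f) = sesq d (entries A) f"
    unfolding qform_sesq[OF dim_vec] by (rule sesq_cong) simp
  then show "Im (sesq d (entries A) f) = 0" "Re (sesq d (entries A) f) \<ge> 0"
    using assms unfolding psd_def by (metis vec_carrier)+
qed

lemma sesq_two:
  assumes "i < d" "j < d" "i \<noteq> j"
  shows "sesq d R (\<lambda>m. if m = i then x else if m = j then y else 0) =
    cnj x * R i i * x + cnj x * R i j * y + cnj y * R j i * x + cnj y * R j j * y"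
proof -
  let ?v = "\<lambda>m. if m = i then x else if m = j then y else (0::complex)"
  have red: "(\<Sum>m<d. F m) = F i + F j" if "\<And>m. m \<noteq> i \<Longrightarrow> m \<noteq> j \<Longrightarrow> F m = 0" for F :: "nat \<Rightarrow> complex"
  proof -
    have "(\<Sum>m<d. F m) = (\<Sum>m\<in>{i,j}. F m)"
      by (rule sum.mono_neutral_right) (use assms that in auto)
    then show ?thesis using assms by simp
  qed
  have "sesq d R ?v = (\<Sum>m<d. cnj (?v m) * R m i * x + cnj (?v m) * R m j * y)"
    unfolding sesq_def by (intro sum.cong refl, subst red) (use assms in auto)
  also have "\<dots> = cnj x * R i i * x + cnj x * R i j * y + (cnj y * R j i * x + cnj y * R j j * y)"
    by (subst red) (use assms in auto)
  finally show ?thesis by simp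
qed

lemma sesq_one: "i < d \<Longrightarrow> sesq d R (\<lambda>m. if m = i then x else 0) = cnj x * R i i * x"
proof -
  assume i: "i < d"
  have red: "(\<Sum>m<d. F m) = F i" if "\<And>m. m \<noteq> i \<Longrightarrow> F m = 0" for F :: "nat \<Rightarrow> complex"
    using sum.mono_neutral_right[of "{..<d}" "{i}" F] i that by simp
  have "sesq d R (\<lambda>m. if m = i then x else 0) = (\<Sum>m<d. cnj (if m = i then x else 0) * R m i * x)"
    unfolding sesq_def by (intro sum.cong refl, subst red) auto
  also have "\<dots> = cnj x * R i i * x" by (subst red) auto
  finally show ?thesis .
qed

context
  fixes d :: nat and R :: "nat \<Rightarrow> nat \<Rightarrow> complex"
  assumes im0: "\<And>f. Im (sesq d R f) = 0" and re0: "\<And>f. Re (sesq d R f) \<ge> 0"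
begin

lemma diag_real: "i < d \<Longrightarrow> Im (R i i) = 0" "i < d \<Longrightarrow> Re (R i i) \<ge> 0"
  using im0[of "\<lambda>m. if m = i then 1 else 0"] re0[of "\<lambda>m. if m = i then 1 else 0"] by (auto simp: sesq_one)

lemma hermitian: assumes "i < d" "j < d" shows "R j i = cnj (R i j)"
proof (cases "i = j")
  case True then show ?thesis using diag_real[of i] assms by (simp add: complex_eq_iff)
next
  case False
  have "Im (R i j + R j i) = 0"
    using im0[of "\<lambda>m. if m = i then 1 else if m = j then 1 else 0"] diag_real assms
    by (simp add: sesq_two[OF assms False])
  moreover have "Im (R i j * \<i> - \<i> * R j i) = 0"
    using im0[of "\<lambda>m. if m = i then 1 else if m = j then \<i> else 0"] diag_real assms
    by (simp add: sesq_two[OF assms False])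
  ultimately show ?thesis by (simp add: complex_eq_iff)
qed

text \<open>Testing the form on \<open>t * R i j\<close> at \<open>i\<close> and -1 at
  \<open>j\<close> gives a real polynomial in \<open>t\<close> that is nonnegative. For
  \<open>a > 0\<close> take \<open>t = 1 / a\<close>; for \<open>a = 0\<close> the polynomial is
  affine in \<open>t\<close>, which forces \<open>w = 0\<close>.\<close>

lemma minor: assumes "i < d" "j < d" shows "(cmod (R i j))\<^sup>2 \<le> Re (R i i) * Re (R j j)"
proof (cases "i = j")
  case True then show ?thesis using diag_real[of i] assms unfolding cmod_power2 by (simp add: power2_eq_square)
next
  case False
  define w a c where "w = (cmod (R i j))\<^sup>2" and "a = Re (R i i)" and "c = Re (R j j)"
  have ac: "a \<ge> 0" "c \<ge> 0" using diag_real assms by (simp_all add: a_def c_def)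
  have w: "R i j * cnj (R i j) = of_real w" unfolding w_def by (rule complex_norm_square[symmetric])
  have Ra: "R i i = of_real a" "R j j = of_real c" using diag_real assms by (simp_all add: complex_eq_iff a_def c_def)
  have key: "t * t * w * a - 2 * t * w + c \<ge> 0" for t :: real
  proof -
    have "sesq d R (\<lambda>m. if m = i then of_real t * R i j else if m = j then -1 else 0) =
      of_real t * cnj (R i j) * R i i * (of_real t * R i j) - of_real t * (R i j * cnj (R i j))
      - of_real t * (R i j * cnj (R i j)) + R j j"
      unfolding sesq_two[OF assms False] using hermitian[OF assms] by (simp add: mult_ac)
    also have "\<dots> = of_real t * of_real t * (R i j * cnj (R i j)) * of_real a - 2 * of_real t * (R i j * cnj (R i j)) + of_real c"
      by (simp add: Ra algebra_simps)
    also have "\<dots> = of_real (t * t * w * a - 2 * t * w + c)" unfolding w by simp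
    finally show ?thesis using re0 by (metis Re_complex_of_real)
  qed
  have "w \<le> a * c"
  proof (cases "a = 0")
    case True
    have "w = 0"
    proof (rule ccontr)
      assume "w \<noteq> 0"
      then show False using key[of "(c + 1) / w"] True ac by simp
    qed
    then show ?thesis using True by simp
  next
    case False
    have "a * (1 / a * (1 / a) * w * a - 2 * (1 / a) * w + c) \<ge> 0" using key[of "1/a"] ac by (intro mult_nonneg_nonneg) auto
    then show ?thesis using False by (simp add: algebra_simps)
  qed
  then show ?thesis by (simp add: w_def a_def c_def)
qed

text \<open>The purity bound tr(R^2) \<le> (tr R)^2, obtained entrywise from the 2-by-2
  minors.\<close>

lemma frobenius_le:
  assumes "(\<Sum>i<d. R i i) = 1"
  shows "(\<Sum>i<d. \<Sum>j<d. (cmod (R i j))\<^sup>2) \<le> 1"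
proof -
  have t: "(\<Sum>i<d. Re (R i i)) = 1" using assms by (metis Re_sum one_complex.simps(1))
  have "(\<Sum>i<d. \<Sum>j<d. (cmod (R i j))\<^sup>2) \<le> (\<Sum>i<d. \<Sum>j<d. Re (R i i) * Re (R j j))"
    by (intro sum_mono minor) auto
  also have "\<dots> = 1" by (simp add: t flip: sum_distrib_left)
  finally show ?thesis .
qed

text \<open>The second moment is 1 plus the purity of the state, whatever the dimension; this is the
  hypothesis on \<open>w\<close> in \<open>truncation_error\<close>.\<close>

lemma sum_sesq_square:
  assumes "(\<Sum>i<d. R i i) = 1"
  shows "(\<Sum>z\<in>outcomes d. (Re (sesq d R (\<lambda>i. ent (z i))))\<^sup>2) \<le> 8 ^ d * 2"
proof -
  have "complex_of_real (\<Sum>z\<in>outcomes d. (Re (sesq d R (\<lambda>i. ent (z i))))\<^sup>2) =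
    (\<Sum>z\<in>outcomes d. sesq d R (\<lambda>i. ent (z i)) * sesq d R (\<lambda>i. ent (z i)))"
    unfolding of_real_sum using im0 by (intro sum.cong refl) (simp add: complex_eq_iff power2_eq_square)
  also have "\<dots> = 8 ^ d * (1 + (\<Sum>i<d. \<Sum>j<d. R i j * R j i))" unfolding sum_sesq_sesq assms by simp
  also have "(\<Sum>i<d. \<Sum>j<d. R i j * R j i) = (\<Sum>i<d. \<Sum>j<d. complex_of_real ((cmod (R i j))\<^sup>2))"
  proof (intro sum.cong refl)
    fix i j assume "i \<in> {..<d}" "j \<in> {..<d}"
    then have "R j i = cnj (R i j)" by (intro hermitian) auto
    then show "R i j * R j i = complex_of_real ((cmod (R i j))\<^sup>2)" by (simp only: complex_norm_square)
  qed
  also have "8 ^ d * (1 + \<dots>) = complex_of_real (8 ^ d * (1 + (\<Sum>i<d. \<Sum>j<d. (cmod (R i j))\<^sup>2)))" by simp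
  finally have "(\<Sum>z\<in>outcomes d. (Re (sesq d R (\<lambda>i. ent (z i))))\<^sup>2) = 8 ^ d * (1 + (\<Sum>i<d. \<Sum>j<d. (cmod (R i j))\<^sup>2))"
    by (simp only: of_real_eq_iff)
  then show ?thesis using frobenius_le[OF assms] by simp
qed

end

text \<open>Unbiasedness: apply \<open>sum_sesq_sesq\<close> to the projector onto \<open>c\<close>.
  The summand 1 is the product of the two traces.\<close>

lemma sum_sesq_overlap:
  assumes "(\<Sum>i<d. R i i) = 1" "(\<Sum>i<d. (cmod (c i))\<^sup>2) = 1"
  shows "(\<Sum>z\<in>outcomes d. Re (sesq d R (\<lambda>i. ent (z i))) * (cmod (\<Sum>i<d. cnj (ent (z i)) * c i))\<^sup>2) =
    8 ^ d * (1 + Re (sesq d R c))"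
proof -
  define S where "S k l = c k * cnj (c l)" for k l
  have S: "sesq d S v = of_real ((cmod (\<Sum>i<d. cnj (v i) * c i))\<^sup>2)" for v
  proof -
    have "sesq d S v = (\<Sum>i<d. cnj (v i) * c i) * cnj (\<Sum>i<d. cnj (v i) * c i)"
      unfolding sesq_def S_def cnj_sum sum_product by (intro sum.cong refl) simp
    then show ?thesis by (simp only: complex_norm_square)
  qed
  have tr: "(\<Sum>i<d. S i i) = 1"
  proof -
    have "(\<Sum>i<d. S i i) = of_real (\<Sum>i<d. (cmod (c i))\<^sup>2)"
      unfolding S_def of_real_sum by (intro sum.cong refl) (simp only: complex_norm_square)
    then show ?thesis using assms by simp
  qed
  have x: "(\<Sum>i<d. \<Sum>j<d. R i j * S j i) = sesq d R c"
    unfolding sesq_def S_def by (intro sum.cong refl) simp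
  have "(\<Sum>z\<in>outcomes d. Re (sesq d R (\<lambda>i. ent (z i))) * (cmod (\<Sum>i<d. cnj (ent (z i)) * c i))\<^sup>2) =
    Re (\<Sum>z\<in>outcomes d. sesq d R (\<lambda>i. ent (z i)) * sesq d S (\<lambda>i. ent (z i)))"
    unfolding Re_sum S by (intro sum.cong refl) simp
  also have "\<dots> = Re (of_real (8 ^ d) * (1 + sesq d R c))" unfolding sum_sesq_sesq assms tr x by simp
  finally show ?thesis by (simp only: Re_complex_of_real times_complex.simps Im_complex_of_real plus_complex.simps one_complex.simps)
qed

section \<open>The hypothesis matrix and its Frobenius distance\<close>

definition fdist :: "nat \<Rightarrow> (nat \<Rightarrow> nat \<Rightarrow> complex) \<Rightarrow> (nat \<Rightarrow> nat \<Rightarrow> complex) \<Rightarrow> real" where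
  "fdist d H R = (\<Sum>i<d. \<Sum>j<d. (cmod (H i j - R i j))\<^sup>2)"

lemma fdist_rank_one:
  fixes c :: real
  assumes "(\<Sum>i<d. (cmod (v i))\<^sup>2) = 1"
  shows "fdist d (\<lambda>i j. H i j + of_real c * v i * cnj (v j)) R =
    fdist d H R + 2 * c * (Re (sesq d H v) - Re (sesq d R v)) + c\<^sup>2"
proof -
  have e: "(cmod (H i j + of_real c * v i * cnj (v j) - R i j))\<^sup>2 =
     (cmod (H i j - R i j))\<^sup>2 + 2 * c * (Re (cnj (v i) * H i j * v j) - Re (cnj (v i) * R i j * v j))
       + c\<^sup>2 * ((cmod (v i))\<^sup>2 * (cmod (v j))\<^sup>2)" for i j
    unfolding cmod_power2 by (simp add: power2_eq_square algebra_simps)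
  have "(\<Sum>i<d. \<Sum>j<d. (cmod (v i))\<^sup>2 * (cmod (v j))\<^sup>2) = 1"
    using assms by (simp flip: sum_distrib_left)
  then show ?thesis
    unfolding fdist_def e sum.distrib sum_distrib_left[symmetric] sum_subtractf
    by (simp add: sesq_def Re_sum)
qed

text \<open>The rank-one update is the Frobenius-orthogonal projection onto the matrices with
  <psi|H|psi> = u. If the answer equals the current value, the coefficient is 0, so the whole
  history can be folded without marking the corrections. Starting from 0, the initial squared
  distance is the purity of the state.\<close>

definition hyp_mat :: "nat \<Rightarrow> history \<Rightarrow> nat \<Rightarrow> nat \<Rightarrow> complex" where
  "hyp_mat d h = foldl (\<lambda>H (\<psi>, u) i j. H i j +
      of_real (u - Re (sesq d H (\<lambda>i. \<psi> $ i))) * \<psi> $ i * cnj (\<psi> $ j)) (\<lambda>_ _. 0) h"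

definition hyp_val :: "nat \<Rightarrow> history \<Rightarrow> complex vec \<Rightarrow> real" where
  "hyp_val d h \<psi> = Re (sesq d (hyp_mat d h) (\<lambda>i. \<psi> $ i))"

text \<open>With \<open>c = u - hyp_val d h \<psi>\<close>, the change in
  \<open>fdist_rank_one\<close> is a difference of squares.\<close>

lemma fdist_hyp_snoc:
  assumes "(\<Sum>i<d. (cmod (\<psi> $ i))\<^sup>2) = 1"
  shows "fdist d (hyp_mat d (h @ [(\<psi>, u)])) R = fdist d (hyp_mat d h) R
    - (hyp_val d h \<psi> - Re (sesq d R (\<lambda>i. \<psi> $ i)))\<^sup>2 + (u - Re (sesq d R (\<lambda>i. \<psi> $ i)))\<^sup>2"
proof -
  have eq: "hyp_mat d (h @ [(\<psi>, u)]) = (\<lambda>i j. hyp_mat d h i j + of_real (u - hyp_val d h \<psi>) * \<psi> $ i * cnj (\<psi> $ j))"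
    by (simp add: hyp_mat_def hyp_val_def)
  show ?thesis unfolding eq fdist_rank_one[OF assms] hyp_val_def[symmetric]
    by (simp add: power2_eq_square algebra_simps)
qed

definition overlap :: "nat \<Rightarrow> real \<Rightarrow> complex vec \<Rightarrow> (nat \<Rightarrow> nat) \<Rightarrow> real" where
  "overlap d B \<psi> z = min ((cmod (\<Sum>i<d. cnj (ent (z i)) * \<psi> $ i))\<^sup>2) B"

definition born :: "nat \<Rightarrow> complex mat \<Rightarrow> (nat \<Rightarrow> nat) \<Rightarrow> real" where
  "born d \<rho> z = Re (sesq d (entries \<rho>) (\<lambda>i. ent (z i))) / 8 ^ d"

lemma expval_bounds:
  assumes \<rho>: "psd d \<rho>" "tr \<rho> = 1" and \<psi>: "dim_vec \<psi> = d" "(\<Sum>i<d. (cmod (\<psi> $ i))\<^sup>2) = 1"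
  shows "0 \<le> expval \<rho> \<psi>" "expval \<rho> \<psi> \<le> 1"
proof -
  have dim: "dim_row \<rho> = d" using \<rho> by (auto simp: psd_def)
  have tr1: "(\<Sum>i<d. entries \<rho> i i) = 1" using \<rho>(2) by (simp add: tr_def entries_def dim)
  let ?p = "Re (sesq d (entries \<rho>) (\<lambda>i. \<psi> $ i))"
  have p: "expval \<rho> \<psi> = ?p" by (simp add: expval_def qform_sesq[OF \<psi>(1)])
  show "0 \<le> expval \<rho> \<psi>" unfolding p by (rule psd_sesq[OF \<rho>(1)])
  \<comment> \<open>Cauchy-Schwarz by way of the distance between the state and its component along
    the projector, which is the purity minus \<open>?p\<^sup>2\<close>.\<close>
  have "0 \<le> fdist d (\<lambda>i j. 0 + of_real ?p * \<psi> $ i * cnj (\<psi> $ j)) (entries \<rho>)"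
    unfolding fdist_def by (intro sum_nonneg) auto
  also have "\<dots> = fdist d (\<lambda>_ _. 0) (entries \<rho>) - ?p\<^sup>2"
    unfolding fdist_rank_one[OF \<psi>(2)] by (simp add: sesq_def power2_eq_square)
  also have "fdist d (\<lambda>_ _. 0) (entries \<rho>) \<le> 1"
    unfolding fdist_def using frobenius_le[OF psd_sesq[OF \<rho>(1)] tr1] by simp
  finally have "?p\<^sup>2 \<le> 1\<^sup>2" by simp
  then show "expval \<rho> \<psi> \<le> 1" unfolding p by (rule power2_le_imp_le) simp
qed

section \<open>Instruments with a classical register\<close>

lemma msum_carrier: "(\<And>A. A \<in> set xs \<Longrightarrow> A \<in> carrier_mat D D) \<Longrightarrow> msum D xs \<in> carrier_mat D D"
  unfolding msum_def by (induction xs) auto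

lemma msum_index:
  assumes "\<And>A. A \<in> set xs \<Longrightarrow> A \<in> carrier_mat D D" "a < D" "b < D"
  shows "msum D xs $$ (a, b) = (\<Sum>A\<leftarrow>xs. A $$ (a, b))"
  using assms(1)
proof (induction xs)
  case Nil then show ?case using assms by (simp add: msum_def)
next
  case (Cons A xs)
  have "msum D xs \<in> carrier_mat D D" using Cons by (intro msum_carrier) auto
  moreover have "msum D (A # xs) = A + msum D xs" by (simp add: msum_def)
  ultimately show ?case using Cons assms by (simp add: carrier_matD)
qed

text \<open>The operator c|i><u|: it tests the vector \<open>u\<close> and leaves the record
  \<open>i\<close> in the memory.\<close>

definition ket_bra :: "nat \<Rightarrow> real \<Rightarrow> nat \<Rightarrow> (nat \<Rightarrow> complex) \<Rightarrow> complex mat" where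
  "ket_bra D c i u = mat D D (\<lambda>(a,b). if a = i then of_real c * cnj (u b) else 0)"

lemma ket_bra_carrier: "ket_bra D c i u \<in> carrier_mat D D" by (simp add: ket_bra_def)

lemma adj_carrier: "A \<in> carrier_mat D D \<Longrightarrow> adj A \<in> carrier_mat D D" by (auto simp: adj_def)

lemma adj_ket_bra_mult:
  assumes "i < D" "a < D" "b < D"
  shows "(adj (ket_bra D c i u) * ket_bra D c i u) $$ (a, b) = of_real (c\<^sup>2) * (u a * cnj (u b))"
proof -
  have "(adj (ket_bra D c i u) * ket_bra D c i u) $$ (a, b) =
    (\<Sum>k<D. cnj (if k = i then of_real c * cnj (u a) else 0) * (if k = i then of_real c * cnj (u b) else 0))"
    using assms by (simp add: scalar_prod_def adj_def ket_bra_def atLeast0LessThan)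
  also have "\<dots> = (\<Sum>k<D. if k = i then of_real c * u a * (of_real c * cnj (u b)) else 0)"
    by (rule sum.cong) auto
  also have "\<dots> = of_real (c\<^sup>2) * (u a * cnj (u b))" using assms by (simp add: power2_eq_square mult_ac)
  finally show ?thesis .
qed

lemma ket_bra_conj:
  assumes "S \<in> carrier_mat D D" "a < D" "b < D"
  shows "(ket_bra D c i u * S * adj (ket_bra D c i u)) $$ (a, b) =
    (if a = i \<and> b = i then of_real (c\<^sup>2) * sesq D (entries S) u else 0)"
proof -
  have KS: "(ket_bra D c i u * S) $$ (a, k) = (if a = i then of_real c * (\<Sum>j<D. cnj (u j) * S $$ (j, k)) else 0)" if "k < D" for k
    using assms that by (auto simp: scalar_prod_def ket_bra_def atLeast0LessThan sum_distrib_left mult_ac intro!: sum.cong sum.neutral)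
  have "(ket_bra D c i u * S * adj (ket_bra D c i u)) $$ (a, b) =
    (\<Sum>k<D. (ket_bra D c i u * S) $$ (a, k) * adj (ket_bra D c i u) $$ (k, b))"
    using assms by (auto simp: scalar_prod_def adj_def ket_bra_def atLeast0LessThan intro!: sum.cong)
  also have "\<dots> = (\<Sum>k<D. if a = i \<and> b = i then of_real c * (\<Sum>j<D. cnj (u j) * S $$ (j, k)) * (of_real c * u k) else 0)"
  proof (rule sum.cong[OF refl])
    fix k assume "k \<in> {..<D}"
    then have k: "k < D" by simp
    show "(ket_bra D c i u * S) $$ (a, k) * adj (ket_bra D c i u) $$ (k, b) =
      (if a = i \<and> b = i then of_real c * (\<Sum>j<D. cnj (u j) * S $$ (j, k)) * (of_real c * u k) else 0)"
      unfolding KS[OF k] using k assms by (auto simp: adj_def ket_bra_def)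
  qed
  also have "\<dots> = (if a = i \<and> b = i then of_real (c\<^sup>2) * (\<Sum>k<D. \<Sum>j<D. cnj (u j) * S $$ (j, k) * u k) else 0)"
    by (cases "a = i \<and> b = i") (auto simp: sum_distrib_left sum_distrib_right power2_eq_square mult_ac)
  also have "(\<Sum>k<D. \<Sum>j<D. cnj (u j) * S $$ (j, k) * u k) = sesq D (entries S) u"
    unfolding sesq_def entries_def by (rule sum.swap)
  finally show ?thesis .
qed

text \<open>Measure the vectors \<open>u\<close>, keep the index \<open>i\<close>, and answer
  \<open>r\<close> with classical probability \<open>k r i\<close>. The square root turns this
  probability into a Kraus amplitude.\<close>

definition mk_instr :: "nat \<Rightarrow> (nat \<times> (nat \<Rightarrow> complex)) list \<Rightarrow> (real \<Rightarrow> nat \<Rightarrow> real) \<Rightarrow> real list \<Rightarrow> instrument" where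
  "mk_instr D us k outs = map (\<lambda>r. (r, map (\<lambda>(i,u). ket_bra D (sqrt (k r i)) i u) us)) outs"

lemma sum_list_swap: "(\<Sum>x\<leftarrow>xs. \<Sum>y\<leftarrow>ys. f x y) = (\<Sum>y\<leftarrow>ys. \<Sum>x\<leftarrow>xs. f x y)" for f :: "'a \<Rightarrow> 'b \<Rightarrow> 'c::comm_monoid_add"
  by (induction xs) (auto simp: sum_list_addf)

lemma sum_sum_list_swap: "(\<Sum>i\<in>I. \<Sum>r\<leftarrow>xs. f i r) = (\<Sum>r\<leftarrow>xs. \<Sum>i\<in>I. f i r)" for f :: "'a \<Rightarrow> 'b \<Rightarrow> 'c::comm_monoid_add"
  by (induction xs) (auto simp: sum.distrib)

lemma valid_mk_instr:
  assumes us: "\<And>i u. (i,u) \<in> set us \<Longrightarrow> i < D"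
    and k: "\<And>r i. k r i \<ge> 0" and ks: "\<And>i. i < D \<Longrightarrow> (\<Sum>r\<leftarrow>outs. k r i) = 1"
    and complete: "\<And>a b. a < D \<Longrightarrow> b < D \<Longrightarrow> (\<Sum>(i,u)\<leftarrow>us. u a * cnj (u b)) = of_bool (a = b)"
  shows "valid_instrument D (mk_instr D us k outs)"
proof -
  define M where "M r = msum D (map (\<lambda>K. adj K * K) (map (\<lambda>(i,u). ket_bra D (sqrt (k r i)) i u) us))" for r
  have car: "A \<in> carrier_mat D D" if "A \<in> set (map (\<lambda>K. adj K * K) (map (\<lambda>(i,u). ket_bra D (sqrt (k r i)) i u) us))" for A r
    using that by (auto intro!: mult_carrier_mat[of _ D D] adj_carrier ket_bra_carrier)
  have Mc: "M r \<in> carrier_mat D D" for r unfolding M_def by (rule msum_carrier) (rule car)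
  have Mi: "M r $$ (a, b) = (\<Sum>(i,u)\<leftarrow>us. of_real (k r i) * (u a * cnj (u b)))" if "a < D" "b < D" for r a b
  proof -
    have "M r $$ (a, b) = (\<Sum>A\<leftarrow>map (\<lambda>K. adj K * K) (map (\<lambda>(i,u). ket_bra D (sqrt (k r i)) i u) us). A $$ (a, b))"
      unfolding M_def by (rule msum_index[OF _ that]) (rule car)
    also have "\<dots> = (\<Sum>(i,u)\<leftarrow>us. (adj (ket_bra D (sqrt (k r i)) i u) * ket_bra D (sqrt (k r i)) i u) $$ (a, b))"
      unfolding map_map by (intro arg_cong[where f = sum_list] map_cong refl) auto
    also have "\<dots> = (\<Sum>(i,u)\<leftarrow>us. of_real (k r i) * (u a * cnj (u b)))"
      by (intro arg_cong[where f = sum_list] map_cong refl)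
         (use us that k in \<open>auto simp: adj_ket_bra_mult simp del: of_real_power\<close>)
    finally show ?thesis .
  qed
  have "msum D (map M outs) = 1\<^sub>m D"
  proof (rule eq_matI)
    show "dim_row (msum D (map M outs)) = dim_row (1\<^sub>m D)" "dim_col (msum D (map M outs)) = dim_col (1\<^sub>m D)"
      using msum_carrier[of "map M outs" D] Mc by auto
    fix a b assume "a < dim_row (1\<^sub>m D)" "b < dim_col (1\<^sub>m D)"
    then have ab: "a < D" "b < D" by auto
    have "msum D (map M outs) $$ (a, b) = (\<Sum>r\<leftarrow>outs. \<Sum>(i,u)\<leftarrow>us. of_real (k r i) * (u a * cnj (u b)))"
      using Mc by (subst msum_index) (auto simp: ab comp_def Mi intro!: arg_cong[where f = sum_list])
    also have "\<dots> = (\<Sum>(i,u)\<leftarrow>us. \<Sum>r\<leftarrow>outs. of_real (k r i) * (u a * cnj (u b)))"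
      by (subst sum_list_swap) (simp only: case_prod_unfold)
    also have "\<dots> = (\<Sum>(i,u)\<leftarrow>us. u a * cnj (u b))"
    proof (intro arg_cong[where f = sum_list] map_cong refl)
      fix x assume "x \<in> set us"
      obtain i u where x: "x = (i, u)" by (cases x)
      have "(\<Sum>r\<leftarrow>outs. complex_of_real (k r i)) = of_real (\<Sum>r\<leftarrow>outs. k r i)"
        by (induction outs) auto
      also have "\<dots> = 1" using ks us \<open>x \<in> set us\<close> x by simp
      finally show "(case x of (i, u) \<Rightarrow> \<Sum>r\<leftarrow>outs. of_real (k r i) * (u a * cnj (u b))) = (case x of (i, u) \<Rightarrow> u a * cnj (u b))"
        by (simp add: x sum_list_mult_const)
    qed
    also have "\<dots> = 1\<^sub>m D $$ (a, b)" using complete[OF ab] ab by simp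
    finally show "msum D (map M outs) $$ (a, b) = 1\<^sub>m D $$ (a, b)" .
  qed
  moreover have "map (\<lambda>(out,Ks). msum D (map (\<lambda>K. adj K * K) Ks)) (mk_instr D us k outs) = map M outs"
    by (simp add: mk_instr_def M_def)
  moreover have "\<forall>(out,Ks) \<in> set (mk_instr D us k outs). \<forall>K \<in> set Ks. K \<in> carrier_mat D D"
    by (auto simp: mk_instr_def ket_bra_carrier)
  ultimately show ?thesis unfolding valid_instrument_def by (simp only:)
qed

definition diag :: "nat \<Rightarrow> (nat \<Rightarrow> real) \<Rightarrow> complex mat" where
  "diag D s = mat D D (\<lambda>(a,b). if a = b then of_real (s a) else 0)"

text \<open>After such an instrument the memory is diagonal, a classical register with unnormalised
  weights. Several vectors may write to the same index, so \<open>s a\<close> collects all their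
  contributions.\<close>

lemma apply_ket_bras:
  assumes S: "S \<in> carrier_mat D D" and k: "\<And>i. k i \<ge> 0"
    and s: "\<And>a. a < D \<Longrightarrow> (\<Sum>(i,u)\<leftarrow>us. if i = a then sesq D (entries S) u else 0) = of_real (s a)"
  shows "apply_kraus D (map (\<lambda>(i,u). ket_bra D (sqrt (k i)) i u) us) S = diag D (\<lambda>a. k a * s a)"
proof -
  let ?Ks = "map (\<lambda>K. K * S * adj K) (map (\<lambda>(i,u). ket_bra D (sqrt (k i)) i u) us)"
  have car: "A \<in> carrier_mat D D" if "A \<in> set ?Ks" for A
    using that S by (auto intro!: mult_carrier_mat[of _ D D] adj_carrier ket_bra_carrier)
  have Kc: "msum D ?Ks \<in> carrier_mat D D" by (rule msum_carrier) (rule car)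
  show ?thesis unfolding apply_kraus_def
  proof (rule eq_matI)
    show "dim_row (msum D ?Ks) = dim_row (diag D (\<lambda>a. k a * s a))" "dim_col (msum D ?Ks) = dim_col (diag D (\<lambda>a. k a * s a))"
      by (simp_all only: carrier_matD[OF Kc] diag_def dim_row_mat dim_col_mat)
    fix a b assume "a < dim_row (diag D (\<lambda>a. k a * s a))" "b < dim_col (diag D (\<lambda>a. k a * s a))"
    then have ab: "a < D" "b < D" by (auto simp: diag_def)
    have "msum D ?Ks $$ (a, b) = (\<Sum>A\<leftarrow>?Ks. A $$ (a, b))"
      by (rule msum_index[OF _ ab]) (rule car)
    also have "\<dots> = (\<Sum>(i,u)\<leftarrow>us. (ket_bra D (sqrt (k i)) i u * S * adj (ket_bra D (sqrt (k i)) i u)) $$ (a, b))"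
      unfolding map_map by (intro arg_cong[where f = sum_list] map_cong refl) auto
    also have "\<dots> = (\<Sum>(i,u)\<leftarrow>us. of_real (if a = b then k a else 0) * (if i = a then sesq D (entries S) u else 0))"
      by (intro arg_cong[where f = sum_list] map_cong refl)
         (use S ab k in \<open>auto simp: ket_bra_conj simp del: of_real_power\<close>)
    also have "\<dots> = of_real (if a = b then k a else 0) * of_real (s a)"
      unfolding s[OF ab(1), symmetric] by (simp only: case_prod_unfold sum_list_const_mult)
    finally show "msum D ?Ks $$ (a, b) = diag D (\<lambda>a. k a * s a) $$ (a, b)"
      using ab by (simp add: diag_def)
  qed
qed

section \<open>Measuring the copies and reading the stored index\<close>

definition basis :: "nat \<Rightarrow> nat \<Rightarrow> complex" where "basis i j = of_bool (i = j)"

lemma sesq_basis: "i < D \<Longrightarrow> sesq D R (basis i) = R i i"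
  using sesq_one[of i D R 1] sesq_cong[of D "basis i" "\<lambda>m. if m = i then 1 else 0" R]
  by (auto simp: basis_def)

lemma sum_list_upt: "(\<Sum>i\<leftarrow>[m..<n]. f i) = (\<Sum>i=m..<n. f i)" for f :: "nat \<Rightarrow> 'a::comm_monoid_add"
  by (simp add: interv_sum_list_conv_sum_set_nat)

text \<open>The first instrument of the algorithm measures the \<open>V i\<close> (acting on the first \<open>D0\<close>
  coordinates) and stores \<open>i\<close>; all later ones only read the stored index.\<close>
definition measure_kets :: "nat \<Rightarrow> nat \<Rightarrow> (nat \<Rightarrow> nat \<Rightarrow> complex) \<Rightarrow> (nat \<times> (nat \<Rightarrow> complex)) list" where
  "measure_kets D0 D V = map (\<lambda>i. (i, V i)) [0..<D] @ map (\<lambda>j. (0, basis j)) [D0..<D]"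

definition read_kets :: "nat \<Rightarrow> (nat \<times> (nat \<Rightarrow> complex)) list" where
  "read_kets D = map (\<lambda>i. (i, basis i)) [0..<D]"

lemma read_kets_complete:
  assumes "a < D" "b < D" shows "(\<Sum>(i,u)\<leftarrow>read_kets D. u a * cnj (u b)) = of_bool (a = b)"
proof -
  have "(\<Sum>(i,u)\<leftarrow>read_kets D. u a * cnj (u b)) = (\<Sum>i=0..<D. if i = a then of_bool (a = b) else 0)"
    by (auto simp: read_kets_def comp_def sum_list_upt basis_def intro!: sum.cong)
  then show ?thesis using assms by simp
qed

lemma measure_kets_complete:
  assumes V: "\<And>a b. a < D0 \<Longrightarrow> b < D0 \<Longrightarrow> (\<Sum>i<D. V i a * cnj (V i b)) = of_bool (a = b)"
    and V0: "\<And>i a. a \<ge> D0 \<Longrightarrow> V i a = 0"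
    and ab: "a < D" "b < D"
  shows "(\<Sum>(i,u)\<leftarrow>measure_kets D0 D V. u a * cnj (u b)) = of_bool (a = b)"
proof -
  have "(\<Sum>(i,u)\<leftarrow>measure_kets D0 D V. u a * cnj (u b)) =
     (\<Sum>i<D. V i a * cnj (V i b)) + (\<Sum>j=D0..<D. if j = a then of_bool (a = b) else 0)"
    by (auto simp: measure_kets_def comp_def sum_list_upt basis_def atLeast0LessThan intro!: arg_cong2[where f = "(+)"] sum.cong)
  also have "\<dots> = of_bool (a = b)"
    using ab V V0 by (cases "a < D0"; cases "b < D0") auto
  finally show ?thesis .
qed

section \<open>Product vectors on the copies\<close>

lemma digits_inj:
  fixes a b d :: nat
  assumes "a < d ^ N" "b < d ^ N" "\<And>j. j < N \<Longrightarrow> (a div d ^ j) mod d = (b div d ^ j) mod d"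
  shows "a = b"
  using assms
proof (induction N arbitrary: a b)
  case (Suc N)
  have "a div d = b div d"
  proof (rule Suc.IH)
    show "a div d < d ^ N" "b div d < d ^ N" using Suc.prems(1,2) by (simp_all add: less_mult_imp_div_less mult.commute)
    fix j assume "j < N"
    then show "(a div d) div d ^ j mod d = (b div d) div d ^ j mod d"
      using Suc.prems(3)[of "Suc j"] by (simp add: div_mult2_eq)
  qed
  moreover have "a mod d = b mod d" using Suc.prems(3)[of 0] by simp
  ultimately show ?case by (metis div_mult_mod_eq)
qed simp

text \<open>The digits are ordered as in \<open>tensor_pow\<close>, so digit \<open>k\<close> is the
  coordinate within copy \<open>k\<close>.\<close>

definition digs :: "nat \<Rightarrow> nat \<Rightarrow> nat \<Rightarrow> nat \<Rightarrow> nat" where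
  "digs d N a = (\<lambda>k\<in>{..<N}. (a div d ^ (N - 1 - k)) mod d)"

lemma digs_bij:
  assumes "d > 0"
  shows "bij_betw (digs d N) {..<d ^ N} (PiE {..<N} (\<lambda>_. {..<d}))"
proof -
  have inj: "inj_on (digs d N) {..<d ^ N}"
  proof (rule inj_onI)
    fix a b assume ab: "a \<in> {..<d ^ N}" "b \<in> {..<d ^ N}" and eq: "digs d N a = digs d N b"
    show "a = b"
    proof (rule digits_inj)
      show "a < d ^ N" "b < d ^ N" using ab by auto
      fix j assume "j < N"
      then have "N - 1 - j < N" "N - 1 - (N - 1 - j) = j" by auto
      then show "a div d ^ j mod d = b div d ^ j mod d"
        using fun_cong[OF eq, of "N - 1 - j"] by (simp add: digs_def)
    qed
  qed
  have sub: "digs d N ` {..<d ^ N} \<subseteq> PiE {..<N} (\<lambda>_. {..<d})"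
    using assms by (auto simp: digs_def split: if_splits)
  have "card (digs d N ` {..<d ^ N}) = card (PiE {..<N} (\<lambda>_. {..<d}))"
    by (simp add: card_image[OF inj] card_PiE)
  then have "digs d N ` {..<d ^ N} = PiE {..<N} (\<lambda>_. {..<d})"
    by (intro card_subset_eq finite_PiE sub) auto
  then show ?thesis using inj by (simp add: bij_betw_def)
qed

lemma digs_less: "d > 0 \<Longrightarrow> k < N \<Longrightarrow> digs d N a k < d" by (simp add: digs_def)

definition prod_ket :: "nat \<Rightarrow> nat \<Rightarrow> (nat \<Rightarrow> nat \<Rightarrow> nat) \<Rightarrow> nat \<Rightarrow> complex" where
  "prod_ket d N x a = (if a < d ^ N then of_real (1 / sqrt (8 ^ (d * N))) * (\<Prod>k<N. ent (x k (digs d N a k))) else 0)"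

lemma norm_const: "complex_of_real (1 / sqrt (8 ^ m)) * complex_of_real (1 / sqrt (8 ^ m)) = 1 / 8 ^ m"
proof -
  have "complex_of_real (1 / sqrt (8 ^ m)) * complex_of_real (1 / sqrt (8 ^ m)) = of_real (1 / 8 ^ m)"
    unfolding of_real_mult[symmetric] by simp
  then show ?thesis by simp
qed

lemma prod_ket_complete:
  assumes d: "d > 0" and ab: "a < d ^ N" "b < d ^ N"
  shows "(\<Sum>x\<in>PiE {..<N} (\<lambda>_. outcomes d). prod_ket d N x a * cnj (prod_ket d N x b)) = of_bool (a = b)"
proof -
  let ?a = "digs d N a" and ?b = "digs d N b"
  have "(\<Sum>x\<in>PiE {..<N} (\<lambda>_. outcomes d). prod_ket d N x a * cnj (prod_ket d N x b)) =
    (\<Sum>x\<in>PiE {..<N} (\<lambda>_. outcomes d). (1 / 8 ^ (d * N)) * (\<Prod>k<N. cnj (ent (x k (?b k))) * ent (x k (?a k))))"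
  proof (rule sum.cong[OF refl])
    fix x
    have "prod_ket d N x a * cnj (prod_ket d N x b) =
      (complex_of_real (1 / sqrt (8 ^ (d * N))) * complex_of_real (1 / sqrt (8 ^ (d * N)))) *
      (\<Prod>k<N. cnj (ent (x k (?b k))) * ent (x k (?a k)))"
      using ab by (simp add: prod_ket_def prod.distrib cnj_prod mult_ac)
    then show "prod_ket d N x a * cnj (prod_ket d N x b) = (1 / 8 ^ (d * N)) * (\<Prod>k<N. cnj (ent (x k (?b k))) * ent (x k (?a k)))"
      unfolding norm_const .
  qed
  also have "\<dots> = (1 / 8 ^ (d * N)) * (\<Prod>k<N. \<Sum>z\<in>outcomes d. cnj (ent (z (?b k))) * ent (z (?a k)))"
    unfolding sum_distrib_left[symmetric] by (subst prod_sum_PiE) (auto simp: finite_outcomes)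
  also have "\<dots> = (1 / 8 ^ (d * N)) * (\<Prod>k<N. 8 ^ d * of_bool (?b k = ?a k))"
    by (intro arg_cong2[where f = "(*)"] prod.cong refl second_moment) (simp_all add: digs_less d)
  also have "\<dots> = (\<Prod>k<N. of_bool (?b k = ?a k))"
    by (simp add: prod.distrib power_mult)
  also have "\<dots> = of_bool (a = b)"
  proof (cases "a = b")
    case False
    have "?a \<noteq> ?b" using bij_betw_imp_inj_on[OF digs_bij[OF d, of N]] ab False by (auto dest: inj_onD)
    then obtain k where "?a k \<noteq> ?b k" by auto
    moreover then have "k < N" by (auto simp: digs_def split: if_splits)
    ultimately show ?thesis using False by (auto intro!: bexI[of _ k])
  qed simp
  finally show ?thesis .
qed

text \<open>A product state measured along product vectors gives independent outcomes: the digit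
  bijection turns the double sum over basis indices into a product of one-copy sums.\<close>

lemma sesq_prod_ket:
  assumes d: "d > 0" and D: "d ^ N \<le> D" and psd: "psd d \<rho>"
  shows "sesq D (entries (init_state d \<rho> N D)) (prod_ket d N x) = of_real (\<Prod>k<N. born d \<rho> (x k))"
proof -
  let ?f = "\<lambda>k i j. cnj (ent (x k i)) * entries \<rho> i j * ent (x k j)"
  let ?P = "PiE {..<N} (\<lambda>_. {..<d})"
  have "sesq D (entries (init_state d \<rho> N D)) (prod_ket d N x) =
    (\<Sum>a<d ^ N. \<Sum>b<d ^ N. cnj (prod_ket d N x a) * entries (init_state d \<rho> N D) a b * prod_ket d N x b)"
  proof -
    have zero: "prod_ket d N x a = 0" if "\<not> a < d ^ N" for a using that by (simp add: prod_ket_def)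
    have "sesq D (entries (init_state d \<rho> N D)) (prod_ket d N x) =
      (\<Sum>a<D. \<Sum>b<d ^ N. cnj (prod_ket d N x a) * entries (init_state d \<rho> N D) a b * prod_ket d N x b)"
      unfolding sesq_def by (rule sum.cong[OF refl], rule sum.mono_neutral_right) (use D zero in auto)
    also have "\<dots> = (\<Sum>a<d ^ N. \<Sum>b<d ^ N. cnj (prod_ket d N x a) * entries (init_state d \<rho> N D) a b * prod_ket d N x b)"
      by (rule sum.mono_neutral_right) (use D zero in auto)
    finally show ?thesis .
  qed
  also have "\<dots> = (\<Sum>a<d ^ N. \<Sum>b<d ^ N. (1 / 8 ^ (d * N)) * (\<Prod>k<N. ?f k (digs d N a k) (digs d N b k)))"
  proof (intro sum.cong refl)
    fix a b assume "a \<in> {..<d ^ N}" "b \<in> {..<d ^ N}"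
    then have ab: "a < d ^ N" "b < d ^ N" by auto
    have "entries (init_state d \<rho> N D) a b = (\<Prod>k<N. entries \<rho> (digs d N a k) (digs d N b k))"
      using ab D unfolding entries_def init_state_def tensor_pow_def
      by (auto simp: digs_def intro!: prod.cong)
    then have "cnj (prod_ket d N x a) * entries (init_state d \<rho> N D) a b * prod_ket d N x b =
      (complex_of_real (1 / sqrt (8 ^ (d * N))) * complex_of_real (1 / sqrt (8 ^ (d * N)))) *
      (\<Prod>k<N. ?f k (digs d N a k) (digs d N b k))"
      using ab by (simp add: prod_ket_def prod.distrib cnj_prod mult_ac)
    then show "cnj (prod_ket d N x a) * entries (init_state d \<rho> N D) a b * prod_ket d N x b =
      (1 / 8 ^ (d * N)) * (\<Prod>k<N. ?f k (digs d N a k) (digs d N b k))"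
      unfolding norm_const .
  qed
  also have "\<dots> = (1 / 8 ^ (d * N)) * (\<Sum>g\<in>?P. \<Sum>g'\<in>?P. \<Prod>k<N. ?f k (g k) (g' k))"
    unfolding sum_distrib_left[symmetric]
      sum.reindex_bij_betw[OF digs_bij[OF d], of "\<lambda>g'. \<Prod>k<N. ?f k (digs d N a k) (g' k)" N for a]
    by (simp only: sum.reindex_bij_betw[OF digs_bij[OF d], of "\<lambda>g. \<Sum>g'\<in>?P. \<Prod>k<N. ?f k (g k) (g' k)" N])
  also have "(\<Sum>g\<in>?P. \<Sum>g'\<in>?P. \<Prod>k<N. ?f k (g k) (g' k)) = (\<Prod>k<N. \<Sum>i<d. \<Sum>j<d. ?f k i j)"
    by (subst prod_sum_PiE, simp, simp, intro sum.cong refl, subst prod_sum_PiE) auto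
  also have "\<dots> = (\<Prod>k<N. 8 ^ d * complex_of_real (born d \<rho> (x k)))"
  proof (rule prod.cong[OF refl])
    fix k
    have "(\<Sum>i<d. \<Sum>j<d. ?f k i j) = sesq d (entries \<rho>) (\<lambda>i. ent (x k i))" by (simp add: sesq_def)
    also have "\<dots> = of_real (Re (sesq d (entries \<rho>) (\<lambda>i. ent (x k i))))"
      using psd_sesq[OF psd] by (simp add: complex_eq_iff)
    finally show "(\<Sum>i<d. \<Sum>j<d. ?f k i j) = 8 ^ d * complex_of_real (born d \<rho> (x k))"
      by (simp add: born_def)
  qed
  finally show ?thesis by (simp add: prod.distrib power_mult)
qed

lemma init_state_carrier: "init_state d \<rho> N D \<in> carrier_mat D D" by (simp add: init_state_def)

lemma read_kets_diag:
  assumes "a < D"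
  shows "(\<Sum>(i,u)\<leftarrow>read_kets D. if i = a then sesq D (entries (diag D s)) u else 0) = of_real (s a)"
proof -
  have "(\<Sum>(i,u)\<leftarrow>read_kets D. if i = a then sesq D (entries (diag D s)) u else 0) =
    (\<Sum>i=0..<D. if i = a then of_real (s a) else 0)"
    using assms by (auto simp: read_kets_def comp_def sum_list_upt sesq_basis entries_def diag_def intro!: sum.cong)
  then show ?thesis using assms by simp
qed

text \<open>The padding vectors, although recorded under index 0, test only the zero block of
  \<open>init_state\<close> and add no weight.\<close>

lemma measure_kets_init:
  assumes d: "d > 0" and D: "d ^ N \<le> D" and psd: "psd d \<rho>" and a: "a < D"
  shows "(\<Sum>(i,u)\<leftarrow>measure_kets (d ^ N) D (\<lambda>i. prod_ket d N (e i)).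
      if i = a then sesq D (entries (init_state d \<rho> N D)) u else 0) = of_real (\<Prod>k<N. born d \<rho> (e a k))"
proof -
  have "(\<Sum>(i,u)\<leftarrow>measure_kets (d ^ N) D (\<lambda>i. prod_ket d N (e i)).
      if i = a then sesq D (entries (init_state d \<rho> N D)) u else 0) =
    (\<Sum>i=0..<D. if i = a then of_real (\<Prod>k<N. born d \<rho> (e a k)) else 0) + (\<Sum>j=d^N..<D. 0)"
    unfolding measure_kets_def map_append sum_list_append map_map comp_def prod.case sum_list_upt
  proof (intro arg_cong2[where f = "(+)"] sum.cong refl)
    fix j assume "j \<in> {d ^ N..<D}"
    then show "(if 0 = a then sesq D (entries (init_state d \<rho> N D)) (basis j) else 0) = 0"
      by (simp add: sesq_basis) (simp add: entries_def init_state_def)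
  qed (simp add: sesq_prod_ket[OF d D psd])
  then show ?thesis using a by simp
qed

text \<open>\<open>s i\<close> is the weight of record \<open>i\<close>, and \<open>F i\<close> the
  probability, given that record, of ever leaving the good answers. Only an inequality holds,
  because an accurate answer that is not good still counts as a success.\<close>

lemma succ_prob_step:
  assumes alg: "alg h (A h) = mk_instr D us (\<lambda>r i. K i h r) (outs h)"
    and S: "S \<in> carrier_mat D D"
    and s: "\<And>a. a < D \<Longrightarrow> (\<Sum>(i,u)\<leftarrow>us. if i = a then sesq D (entries S) u else 0) = of_real (s a)"
    and s0: "\<And>i. i < D \<Longrightarrow> s i \<ge> 0"
    and K0: "\<And>i h r. K i h r \<ge> 0" and K1: "\<And>i. (\<Sum>r\<leftarrow>outs h. K i h r) = 1"
    and ok: "\<And>r. gd h r \<Longrightarrow> \<bar>r - expval \<rho> (A h)\<bar> \<le> \<epsilon>"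
    and F: "\<And>i. F i h (Suc k) = (\<Sum>r\<leftarrow>outs h. K i h r * (if gd h r then F i (h @ [(A h, r)]) k else 1))"
    and F1: "\<And>i h. F i h k \<le> 1"
    and IH: "\<And>s r. (\<And>i. i < D \<Longrightarrow> s i \<ge> 0) \<Longrightarrow>
      (\<Sum>i<D. s i * (1 - F i (h @ [(A h, r)]) k)) \<le> succ_prob D alg A \<rho> \<epsilon> (diag D s) (h @ [(A h, r)]) k"
  shows "(\<Sum>i<D. s i * (1 - F i h (Suc k))) \<le> succ_prob D alg A \<rho> \<epsilon> S h (Suc k)"
proof -
  have "(\<Sum>i<D. s i * (1 - F i h (Suc k))) =
    (\<Sum>i<D. \<Sum>r\<leftarrow>outs h. K i h r * s i * (if gd h r then 1 - F i (h @ [(A h, r)]) k else 0))"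
  proof (rule sum.cong[OF refl])
    fix i
    have "1 - F i h (Suc k) = (\<Sum>r\<leftarrow>outs h. K i h r) - (\<Sum>r\<leftarrow>outs h. K i h r * (if gd h r then F i (h @ [(A h, r)]) k else 1))"
      by (simp only: K1 F)
    also have "\<dots> = (\<Sum>r\<leftarrow>outs h. K i h r * (if gd h r then 1 - F i (h @ [(A h, r)]) k else 0))"
      unfolding sum_list_subtractf[symmetric] by (intro arg_cong[where f = sum_list] map_cong refl) (auto simp: algebra_simps)
    finally show "s i * (1 - F i h (Suc k)) = (\<Sum>r\<leftarrow>outs h. K i h r * s i * (if gd h r then 1 - F i (h @ [(A h, r)]) k else 0))"
      by (simp add: mult_ac flip: sum_list_const_mult)
  qed
  also have "\<dots> = (\<Sum>r\<leftarrow>outs h. \<Sum>i<D. K i h r * s i * (if gd h r then 1 - F i (h @ [(A h, r)]) k else 0))"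
    by (rule sum_sum_list_swap)
  also have "\<dots> \<le> (\<Sum>r\<leftarrow>outs h. if \<bar>r - expval \<rho> (A h)\<bar> \<le> \<epsilon>
      then succ_prob D alg A \<rho> \<epsilon> (diag D (\<lambda>a. K a h r * s a)) (h @ [(A h, r)]) k else 0)"
  proof (rule sum_list_mono)
    fix r
    have pos: "K i h r * s i \<ge> 0" if "i < D" for i using that s0 K0 by simp
    have "(\<Sum>i<D. K i h r * s i * (if gd h r then 1 - F i (h @ [(A h, r)]) k else 0)) \<le>
      (\<Sum>i<D. K i h r * s i * (1 - F i (h @ [(A h, r)]) k))"
      using F1 pos by (intro sum_mono mult_left_mono) auto
    also have "\<dots> \<le> succ_prob D alg A \<rho> \<epsilon> (diag D (\<lambda>a. K a h r * s a)) (h @ [(A h, r)]) k"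
      by (rule IH) (rule pos)
    \<comment> \<open>For an answer that is not good the left side is 0, and \<open>le\<close> then
      says that the continuation has nonnegative probability.\<close>
    finally have le: "(\<Sum>i<D. K i h r * s i * (if gd h r then 1 - F i (h @ [(A h, r)]) k else 0)) \<le> \<dots>" .
    show "(\<Sum>i<D. K i h r * s i * (if gd h r then 1 - F i (h @ [(A h, r)]) k else 0)) \<le>
      (if \<bar>r - expval \<rho> (A h)\<bar> \<le> \<epsilon> then succ_prob D alg A \<rho> \<epsilon> (diag D (\<lambda>a. K a h r * s a)) (h @ [(A h, r)]) k else 0)"
      using le ok[of r] by (cases "gd h r") auto
  qed
  also have "\<dots> = succ_prob D alg A \<rho> \<epsilon> S h (Suc k)"
  proof -
    have ap: "apply_kraus D (map (\<lambda>(i,u). ket_bra D (sqrt (K i h r)) i u) us) S = diag D (\<lambda>a. K a h r * s a)" for r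
      by (rule apply_ket_bras[OF S K0 s])
    show ?thesis
      unfolding succ_prob.simps Let_def alg mk_instr_def map_map
      by (intro arg_cong[where f = sum_list] map_cong refl) (simp add: ap)
  qed
  finally show ?thesis .
qed

lemma trace_diag: "Re (tr (diag D s)) = (\<Sum>i<D. s i)"
  by (simp add: tr_def diag_def Re_sum)

text \<open>The empty history is excluded because only there the copies are still unmeasured;
  afterwards each round just rescales the diagonal.\<close>

lemma succ_prob_read:
  assumes alg: "\<And>h. h \<noteq> [] \<Longrightarrow> alg h (A h) = mk_instr D (read_kets D) (\<lambda>r i. K i h r) (outs h)"
    and K0: "\<And>i h r. K i h r \<ge> 0" and K1: "\<And>i h. (\<Sum>r\<leftarrow>outs h. K i h r) = 1"
    and ok: "\<And>h r. gd h r \<Longrightarrow> \<bar>r - expval \<rho> (A h)\<bar> \<le> \<epsilon>"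
    and F0: "\<And>i h. F i h 0 = 0"
    and F: "\<And>i h k. F i h (Suc k) = (\<Sum>r\<leftarrow>outs h. K i h r * (if gd h r then F i (h @ [(A h, r)]) k else 1))"
    and F1: "\<And>i h k. F i h k \<le> 1"
  shows "h \<noteq> [] \<Longrightarrow> (\<And>i. i < D \<Longrightarrow> s i \<ge> 0) \<Longrightarrow>
    (\<Sum>i<D. s i * (1 - F i h k)) \<le> succ_prob D alg A \<rho> \<epsilon> (diag D s) h k"
proof (induction k arbitrary: h s)
  case 0 then show ?case by (simp add: F0 trace_diag)
next
  case (Suc k)
  show ?case
  proof (rule succ_prob_step[where gd = gd])
    show "alg h (A h) = mk_instr D (read_kets D) (\<lambda>r i. K i h r) (outs h)" by (rule alg) fact
    show "diag D s \<in> carrier_mat D D" by (simp add: diag_def)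
  qed (use Suc K0 K1 ok F F1 read_kets_diag in auto)
qed

section \<open>The learning algorithm\<close>

lemma adaptive_analysis_quantum:
  fixes A :: analyst
  assumes \<rho>: "psd d \<rho>" "tr \<rho> = 1"
    and A: "\<And>h. dim_vec (A h) = d" "\<And>h. (\<Sum>i<d. (cmod (A h $ i))\<^sup>2) = 1"
    and err: "(1 + 96 * exp 6) * exp (- B / 64) \<le> \<alpha> / 4"
    and N: "N > 0" and B: "B \<ge> 3" and \<alpha>: "0 < \<alpha>" "\<alpha> \<le> 1" and b: "b > 0" and G: "finite G"
    and grid: "\<And>t. -1 \<le> t \<Longrightarrow> t \<le> B - 1 \<Longrightarrow> \<exists>u\<in>G. \<bar>u - t\<bar> \<le> \<alpha>"
  shows "adaptive_analysis (outcomes d) (born d \<rho>) (overlap d B) N B \<alpha> b G (hyp_val d) A (expval \<rho>)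
    (\<lambda>h. fdist d (hyp_mat d h) (entries \<rho>))"
proof -
  have dim: "dim_row \<rho> = d" using \<rho> by (auto simp: psd_def)
  have tr1: "(\<Sum>i<d. entries \<rho> i i) = 1" using \<rho>(2) by (simp add: tr_def entries_def dim)
  note pos = psd_sesq[OF \<rho>(1)]
  have p: "expval \<rho> (A h) = Re (sesq d (entries \<rho>) (\<lambda>i. A h $ i))" for h
    by (simp add: expval_def qform_sesq[OF A(1)])
  define Y where "Y h z = (cmod (\<Sum>i<d. cnj (ent (z i)) * A h $ i))\<^sup>2" for h z
  have ov: "overlap d B (A h) z = min (Y h z) B" for h z by (simp add: overlap_def Y_def)
  have EY: "(\<Sum>z\<in>outcomes d. born d \<rho> z * Y h z) = 1 + expval \<rho> (A h)" for h
  proof -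
    have "(\<Sum>z\<in>outcomes d. born d \<rho> z * Y h z) =
      (\<Sum>z\<in>outcomes d. Re (sesq d (entries \<rho>) (\<lambda>i. ent (z i))) * Y h z) / 8 ^ d"
      by (simp add: born_def sum_divide_distrib)
    then show ?thesis unfolding Y_def sum_sesq_overlap[where R = "entries \<rho>" and c = "\<lambda>i. A h $ i", OF tr1 A(2)[of h]] p by simp
  qed
  have born0: "born d \<rho> z \<ge> 0" for z using pos by (simp add: born_def)
  \<comment> \<open>The Born weights play the role of \<open>w\<close>; division by
    \<open>8 ^ d\<close> normalises them.\<close>
  have diff: "(\<Sum>z\<in>outcomes d. born d \<rho> z * (Y h z - min (Y h z) B)) \<le> \<alpha> / 4" for h
  proof -
    have "(\<Sum>z\<in>outcomes d. Re (sesq d (entries \<rho>) (\<lambda>i. ent (z i))) * (Y h z - min (Y h z) B))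
      \<le> 8 ^ d * ((1 + 96 * exp 6) * exp (- B / 64))"
      unfolding Y_def by (rule truncation_error[where c = "\<lambda>i. A h $ i", OF A(2)[of h] _ sum_sesq_square[OF pos tr1]]) (use B in auto)
    also have "\<dots> \<le> 8 ^ d * (\<alpha> / 4)" by (intro mult_left_mono err) simp
    finally have "(\<Sum>z\<in>outcomes d. Re (sesq d (entries \<rho>) (\<lambda>i. ent (z i))) * (Y h z - min (Y h z) B)) / 8 ^ d \<le> \<alpha> / 4"
      by (simp add: field_simps)
    then show ?thesis by (simp add: born_def sum_divide_distrib)
  qed
  have F: "fdist d (hyp_mat d []) (entries \<rho>) \<le> 1"
    using frobenius_le[OF pos tr1] by (simp add: fdist_def hyp_mat_def)
  show ?thesis
  proof
    show "finite (outcomes d)" by (rule finite_outcomes)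
    show "sum (born d \<rho>) (outcomes d) = 1"
    proof -
      have "(\<Sum>z\<in>outcomes d. Re (sesq d (entries \<rho>) (\<lambda>i. ent (z i)))) = Re (\<Sum>z\<in>outcomes d. sesq d (entries \<rho>) (\<lambda>i. ent (z i)))"
        by (simp add: Re_sum)
      also have "\<dots> = Re (of_real (8 ^ d))" unfolding sum_sesq tr1 by simp
      finally have "(\<Sum>z\<in>outcomes d. Re (sesq d (entries \<rho>) (\<lambda>i. ent (z i)))) = 8 ^ d"
        by (simp only: Re_complex_of_real)
      then show ?thesis unfolding born_def by (simp flip: sum_divide_distrib)
    qed
    fix h z
    show "born d \<rho> z \<ge> 0" by (rule born0)
    show "0 \<le> overlap d B (A h) z" using B by (simp add: ov Y_def)
    show "overlap d B (A h) z \<le> B" by (simp add: ov)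
    show "(\<Sum>z\<in>outcomes d. born d \<rho> z * overlap d B (A h) z) \<le> 1 + expval \<rho> (A h)"
      unfolding EY[symmetric] ov by (intro sum_mono mult_left_mono born0) simp
    show "1 + expval \<rho> (A h) - \<alpha> / 4 \<le> (\<Sum>z\<in>outcomes d. born d \<rho> z * overlap d B (A h) z)"
      using diff[of h] unfolding EY[symmetric] ov by (simp add: right_diff_distrib sum_subtractf)
    show "0 \<le> expval \<rho> (A h)" "expval \<rho> (A h) \<le> 1" using expval_bounds[OF \<rho> A] by auto
    show "0 \<le> fdist d (hyp_mat d h) (entries \<rho>)" unfolding fdist_def by (intro sum_nonneg) auto
    show "fdist d (hyp_mat d (h @ [(A h, u)])) (entries \<rho>) = fdist d (hyp_mat d h) (entries \<rho>)
      - (hyp_val d h (A h) - expval \<rho> (A h))\<^sup>2 + (u - expval \<rho> (A h))\<^sup>2" for u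
      unfolding fdist_hyp_snoc[OF A(2)] p ..
  qed (use F N B \<alpha> b G grid in auto)
qed

text \<open>Memory state \<open>i\<close> stands for the sample \<open>e i\<close>. The first
  instrument measures all copies and answers the first query at once, since each round of the
  interaction has a single instrument.\<close>

definition learner :: "nat \<Rightarrow> nat \<Rightarrow> nat \<Rightarrow> (nat \<Rightarrow> nat \<Rightarrow> nat \<Rightarrow> nat) \<Rightarrow> real \<Rightarrow> real \<Rightarrow> real \<Rightarrow> real set \<Rightarrow> algorithm" where
  "learner d N D e B \<alpha> b G h \<psi> =
     mk_instr D (if h = [] then measure_kets (d ^ N) D (\<lambda>i. prod_ket d N (e i)) else read_kets D)
       (\<lambda>r i. exp_mech G \<alpha> b (hyp_val d h \<psi>) (emp_mean N (overlap d B \<psi>) (e i)) r)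
       (sorted_list_of_set (insert (hyp_val d h \<psi>) G))"

lemma sum_list_sorted_set: "finite S \<Longrightarrow> (\<Sum>r\<leftarrow>sorted_list_of_set S. f r) = (\<Sum>r\<in>S. f r)" for f :: "real \<Rightarrow> 'a::comm_monoid_add"
  using sum.distinct_set_conv_list[OF distinct_sorted_list_of_set, of f S] by simp

lemma learner_valid:
  assumes d: "d > 0" and e: "bij_betw e {..<D} (PiE {..<N} (\<lambda>_. outcomes d))"
    and D: "d ^ N \<le> D" and G: "finite G"
  shows "valid_instrument D (learner d N D e B \<alpha> b G h \<psi>)"
  unfolding learner_def
proof (rule valid_mk_instr)
  let ?us = "if h = [] then measure_kets (d ^ N) D (\<lambda>i. prod_ket d N (e i)) else read_kets D"
  fix i u assume "(i, u) \<in> set ?us"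
  then show "i < D" by (auto simp: measure_kets_def read_kets_def split: if_splits)
next
  fix r i
  show "0 \<le> exp_mech G \<alpha> b (hyp_val d h \<psi>) (emp_mean N (overlap d B \<psi>) (e i)) r"
    by (rule less_imp_le[OF exp_mech_pos[OF G]])
next
  fix i
  show "(\<Sum>r\<leftarrow>sorted_list_of_set (insert (hyp_val d h \<psi>) G).
     exp_mech G \<alpha> b (hyp_val d h \<psi>) (emp_mean N (overlap d B \<psi>) (e i)) r) = 1"
    using G by (subst sum_list_sorted_set) (auto intro: exp_mech_sum)
next
  fix a b' assume ab: "a < D" "b' < D"
  have "(\<Sum>(i,u)\<leftarrow>measure_kets (d ^ N) D (\<lambda>i. prod_ket d N (e i)). u a * cnj (u b')) = of_bool (a = b')"
  proof (rule measure_kets_complete[OF _ _ ab])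
    fix a b' assume "a < d ^ N" "b' < d ^ N"
    then show "(\<Sum>i<D. prod_ket d N (e i) a * cnj (prod_ket d N (e i) b')) = of_bool (a = b')"
      using sum.reindex_bij_betw[OF e, of "\<lambda>x. prod_ket d N x a * cnj (prod_ket d N x b')"]
        prod_ket_complete[OF d] by simp
  qed (simp add: prod_ket_def)
  then show "(\<Sum>(i,u)\<leftarrow>(if h = [] then measure_kets (d ^ N) D (\<lambda>i. prod_ket d N (e i)) else read_kets D). u a * cnj (u b')) = of_bool (a = b')"
    using read_kets_complete[OF ab] by simp
qed

lemma learner_success:
  fixes A :: analyst
  assumes aa: "adaptive_analysis (outcomes d) (born d \<rho>) (overlap d B) N B \<alpha> b G (hyp_val d) A (expval \<rho>) ds"
    and d: "d > 0" and e: "bij_betw e {..<D} (PiE {..<N} (\<lambda>_. outcomes d))" and D: "d ^ N \<le> D"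
    and \<rho>: "psd d \<rho>" and \<epsilon>: "7 * \<alpha> \<le> \<epsilon>"
    and fail: "adaptive_analysis.avg (outcomes d) (born d \<rho>) N
       (\<lambda>x. adaptive_analysis.stop_exp (overlap d B) N \<alpha> b G (hyp_val d) A (expval \<rho>) x
          (\<lambda>h u. of_bool (\<not> adaptive_analysis.good \<alpha> (hyp_val d) A (expval \<rho>) h u)) [] (Suc k)) \<le> \<delta>"
  shows "1 - \<delta> \<le> succ_prob D (learner d N D e B \<alpha> b G) A \<rho> \<epsilon> (init_state d \<rho> N D) [] (Suc k)"
proof -
  interpret adaptive_analysis "outcomes d" "born d \<rho>" "overlap d B" N B \<alpha> b G "hyp_val d" A "expval \<rho>" ds
    by (rule aa)
  let ?bad = "\<lambda>h u. of_bool (\<not> good h u)"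
  define K where "K i h r = exp_mech G \<alpha> b (hyp_val d h (A h)) (emp_mean N (overlap d B (A h)) (e i)) r" for i h r
  define outs where "outs h = sorted_list_of_set (insert (hyp_val d h (A h)) G)" for h
  define F where "F i h k = stop_exp (e i) ?bad h k" for i h k
  have K_ker: "K i h r = ker (e i) h r" for i h r by (simp add: K_def ker_def emp_def)
  have outs_sum: "(\<Sum>r\<leftarrow>outs h. f r) = (\<Sum>r\<in>cand h. f r)" for h and f :: "real \<Rightarrow> real"
    unfolding outs_def cand_def using finG by (intro sum_list_sorted_set) auto
  have alg: "learner d N D e B \<alpha> b G h (A h) = mk_instr D
     (if h = [] then measure_kets (d ^ N) D (\<lambda>i. prod_ket d N (e i)) else read_kets D) (\<lambda>r i. K i h r) (outs h)" for h
    by (simp add: learner_def K_def outs_def)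
  have K0: "K i h r \<ge> 0" for i h r unfolding K_ker by (rule less_imp_le[OF ker_pos])
  have K1: "(\<Sum>r\<leftarrow>outs h. K i h r) = 1" for i h unfolding outs_sum K_ker by (rule ker_sum)
  have ok: "\<bar>r - expval \<rho> (A h)\<bar> \<le> \<epsilon>" if "good h r" for h r using that \<epsilon> by (auto simp: good_def)
  have F0: "F i h 0 = 0" for i h by (simp add: F_def)
  have FS: "F i h (Suc k) = (\<Sum>r\<leftarrow>outs h. K i h r * (if good h r then F i (h @ [(A h, r)]) k else 1))" for i h k
    unfolding outs_sum K_ker F_def stop_exp.simps by (intro sum.cong refl) auto
  have F1: "F i h k \<le> 1" for i h k
  proof (induction k arbitrary: h)
    case (Suc k)
    have "F i h (Suc k) \<le> (\<Sum>r\<leftarrow>outs h. K i h r * 1)"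
      unfolding FS by (intro sum_list_mono mult_left_mono K0) (use Suc in auto)
    then show ?case by (simp add: K1)
  qed (simp add: F0)
  have PN0: "PN (e i) \<ge> 0" if "i < D" for i
    using bij_betwE[OF e] that by (intro PN_nonneg) (simp add: XS_def)
  have "1 - \<delta> \<le> 1 - avg (\<lambda>x. stop_exp x ?bad [] (Suc k))" using fail by simp
  also have "\<dots> = avg (\<lambda>x. 1 - stop_exp x ?bad [] (Suc k))"
    using avg_affine[of "-1" "\<lambda>x. stop_exp x ?bad [] (Suc k)" 1] by simp
  also have "\<dots> = (\<Sum>i<D. PN (e i) * (1 - F i [] (Suc k)))"
    unfolding avg_def F_def XS_def by (rule sum.reindex_bij_betw[OF e, symmetric])
  also have "\<dots> \<le> succ_prob D (learner d N D e B \<alpha> b G) A \<rho> \<epsilon> (init_state d \<rho> N D) [] (Suc k)"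
  proof (rule succ_prob_step[where gd = good])
    show "learner d N D e B \<alpha> b G [] (A []) = mk_instr D (measure_kets (d ^ N) D (\<lambda>i. prod_ket d N (e i))) (\<lambda>r i. K i [] r) (outs [])"
      by (simp add: alg)
    show "(\<Sum>(i,u)\<leftarrow>measure_kets (d ^ N) D (\<lambda>i. prod_ket d N (e i)). if i = a then sesq D (entries (init_state d \<rho> N D)) u else 0)
      = of_real (PN (e a))" if "a < D" for a
      unfolding PN_def by (rule measure_kets_init[OF d D \<rho> that])
    show "(\<Sum>i<D. s i * (1 - F i ([] @ [(A [], r)]) k)) \<le>
      succ_prob D (learner d N D e B \<alpha> b G) A \<rho> \<epsilon> (diag D s) ([] @ [(A [], r)]) k"
      if "\<And>i. i < D \<Longrightarrow> s i \<ge> 0" for s r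
      by (rule succ_prob_read[where gd = good, OF _ K0 K1 ok F0 FS F1]) (use that in \<open>auto simp: alg\<close>)
  qed (use init_state_carrier PN0 K0 K1 ok FS F1 in auto)
  finally show ?thesis .
qed

lemma learner_exists:
  fixes n M :: nat and \<epsilon> \<delta> \<alpha> B \<Lambda> \<Gamma> :: real
  assumes M: "M \<ge> 2" and \<epsilon>: "0 < \<epsilon>" "\<epsilon> < 1/2" and \<delta>: "0 < \<delta>" "\<delta> < 1"
    and \<alpha>: "\<alpha> = \<epsilon> / 8" and B: "B \<ge> 3" and \<Lambda>: "\<Lambda> = ln (8 * B / (\<alpha> * \<delta>))" "\<Lambda> \<ge> 1"
    and \<Gamma>: "\<Gamma> = ln ((B / \<alpha> + 4) * M * (8 * B / (\<alpha> * \<delta>)))" "\<Gamma> > 0"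
    and err: "(1 + 96 * exp 6) * exp (- B / 64) \<le> \<alpha> / 4"
    and N: "real N \<ge> 288 * B * \<Gamma> * sqrt \<Lambda> / \<alpha> ^ 3"
  shows "\<exists>(D::nat) (alg::algorithm). D \<ge> (2^n)^N \<and> (\<forall>h \<psi>. valid_instrument D (alg h \<psi>)) \<and>
           (\<forall>\<rho> (A::analyst). qstate n \<rho> \<and> (\<forall>h. unit_vec n (A h)) \<longrightarrow>
              succ_prob D alg A \<rho> \<epsilon> (init_state (2^n) \<rho> N D) [] M \<ge> 1 - \<delta>)"
proof -
  define d where "d = (2::nat) ^ n"
  \<comment> \<open>Step \<alpha>, starting at -1: the empirical values lie between -1 and
    \<open>B - 1\<close>.\<close>
  define G where "G = (\<lambda>k. \<alpha> * real k - 1) ` {..nat \<lceil>B / \<alpha>\<rceil>}"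
  \<comment> \<open>A candidate beaten by \<alpha> then has probability at most
    \<open>exp (- \<Gamma>)\<close>. \<Gamma> collects the logarithms of the number of rounds, of
    the number of candidates and of the inverse error share
    \<open>\<alpha> * \<delta> / (8 * B)\<close>.\<close>
  define b where "b = \<alpha> / \<Gamma>"
  define D where "D = card (PiE {..<N} (\<lambda>_. outcomes d))"
  have d0: "d > 0" by (simp add: d_def)
  have \<alpha>0: "\<alpha> > 0" "\<alpha> \<le> 1" using \<epsilon> by (simp_all add: \<alpha>)
  have b0: "b > 0" using \<alpha>0 \<Gamma> by (simp add: b_def)
  have "288 * B * \<Gamma> * sqrt \<Lambda> / \<alpha> ^ 3 > 0" using B \<Gamma> \<Lambda> \<alpha>0 by simp
  then have N0: "N > 0" using N by (cases N) auto
  have finG: "finite G" by (simp add: G_def)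
  have "real (card G) \<le> real (nat \<lceil>B / \<alpha>\<rceil>) + 1"
    unfolding G_def using card_image_le[of "{..nat \<lceil>B / \<alpha>\<rceil>}" "\<lambda>k. \<alpha> * real k - 1"] by simp
  moreover have "B / \<alpha> \<ge> 0" using B \<alpha>0 by simp
  ultimately have cardG: "real (card G) \<le> B / \<alpha> + 2" by linarith
  have grid: "\<exists>u\<in>G. \<bar>u - t\<bar> \<le> \<alpha>" if "-1 \<le> t" "t \<le> B - 1" for t
  proof -
    define k where "k = nat \<lfloor>(t + 1) / \<alpha>\<rfloor>"
    have t0: "(t + 1) / \<alpha> \<ge> 0" using that \<alpha>0 by simp
    have k: "real k \<le> (t + 1) / \<alpha>" "(t + 1) / \<alpha> \<le> real k + 1" using t0 by (simp_all add: k_def)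
    then have "\<alpha> * real k \<le> t + 1" "t + 1 \<le> \<alpha> * real k + \<alpha>" using \<alpha>0 by (simp_all add: field_simps)
    then have "\<bar>(\<alpha> * real k - 1) - t\<bar> \<le> \<alpha>" by auto
    moreover have "(t + 1) / \<alpha> \<le> B / \<alpha>" using that \<alpha>0 by (simp add: divide_right_mono)
    then have "k \<le> nat \<lceil>B / \<alpha>\<rceil>" using k by linarith
    ultimately show ?thesis by (auto simp: G_def)
  qed
  have finP: "finite (PiE {..<N} (\<lambda>_. outcomes d))" by (intro finite_PiE) (auto simp: finite_outcomes)
  obtain e where e: "bij_betw e {..<D} (PiE {..<N} (\<lambda>_. outcomes d))"
    unfolding D_def using ex_bij_betw_nat_finite[OF finP] by (auto simp: atLeast0LessThan)
  have D: "d ^ N \<le> D"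
  proof -
    have "d \<le> 8 ^ d" using less_exp[of d] power_mono[of 2 "8::nat" d] by linarith
    then have "d ^ N \<le> (8 ^ d) ^ N" by (rule power_mono) simp
    then show ?thesis by (simp add: D_def card_PiE card_outcomes)
  qed
  have x0: "8 * B / (\<alpha> * \<delta>) > 0" using B \<alpha>0 \<delta> by simp
  have x1: "(B / \<alpha> + 4) * M * (8 * B / (\<alpha> * \<delta>)) > 0" using B \<alpha>0 \<delta> M by (intro mult_pos_pos add_nonneg_pos) auto
  have expG: "exp (- \<Gamma>) = 1 / ((B / \<alpha> + 4) * M) * (\<alpha> * \<delta> / (8 * B))"
    unfolding \<Gamma> exp_minus using x1 by (simp add: divide_simps)
  have G1: "exp \<Gamma> = (B / \<alpha> + 4) * M * (8 * B / (\<alpha> * \<delta>))" unfolding \<Gamma> using x1 by simp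
  have insample: "M * ((card G + 1) * exp (- \<alpha> / b)) \<le> \<alpha> * \<delta> / (8 * B)"
  proof -
    have "M * ((card G + 1) * exp (- \<alpha> / b)) = M * (card G + 1) * exp (- \<Gamma>)"
    proof -
      have "- \<alpha> / b = - \<Gamma>" using \<alpha>0 \<Gamma>(2) by (simp add: b_def)
      then show ?thesis by (simp only: of_nat_mult mult.assoc)
    qed
    also have "\<dots> = (card G + 1) / (B / \<alpha> + 4) * (\<alpha> * \<delta> / (8 * B))"
    proof -
      have "m * c * (1 / (X * m) * w) = c / X * w" if "m \<noteq> 0" for m c X w :: real
        using that by simp
      moreover have "real M \<noteq> 0" using M by simp
      ultimately show ?thesis unfolding expG by (simp only: of_nat_mult)
    qed
    also have "\<dots> \<le> 1 * (\<alpha> * \<delta> / (8 * B))"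
      using cardG B \<alpha>0 \<delta> by (intro mult_right_mono) auto
    finally show ?thesis by simp
  qed
  have "succ_prob D (learner d N D e B \<alpha> b G) A \<rho> \<epsilon> (init_state (2^n) \<rho> N D) [] M \<ge> 1 - \<delta>"
    if \<rho>: "qstate n \<rho>" and A: "\<And>h. unit_vec n (A h)" for \<rho> and A :: analyst
  proof -
    have psd: "psd d \<rho>" "tr \<rho> = 1" using \<rho> by (auto simp: qstate_def d_def)
    have Ah: "dim_vec (A h) = d" "(\<Sum>i<d. (cmod (A h $ i))\<^sup>2) = 1" for h
      using A[of h] by (auto simp: unit_vec_def d_def)
    note aa = adaptive_analysis_quantum[where A = A, OF psd Ah err N0 B \<alpha>0 b0 finG grid]
    interpret adaptive_analysis "outcomes d" "born d \<rho>" "overlap d B" N B \<alpha> b G "hyp_val d" A "expval \<rho>"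
      "\<lambda>h. fdist d (hyp_mat d h) (entries \<rho>)"
      by (rule aa)
    have \<beta>M: "M * \<beta> \<le> \<alpha> * \<delta> / (8 * B)" using insample by (simp add: \<beta>_def)
    have "avg (\<lambda>x. stop_exp x (\<lambda>h u. of_bool (\<not> good h u)) [] M) \<le> \<delta>"
    proof (cases "\<alpha>\<^sup>2 * \<Lambda> \<le> 1")
      case True
      obtain m where m: "real (Suc m) * (2 * (B / N) / b) \<le> 1/6"
        "exp (- (m * (\<alpha>/8)) + 32 * (real (Suc m) * (2 * (B / N) / b))\<^sup>2 * (1 + 1 / \<alpha>\<^sup>2)) \<le> \<alpha> * \<delta> / (8 * B)"
        using private_params[OF \<alpha>0 B \<delta> \<Lambda>(1) \<Gamma>(2) True N refl] unfolding b_def by blast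
      have "avg (\<lambda>x. stop_exp x (\<lambda>h u. of_bool (\<not> good h u)) [] M) \<le>
        4 * B * (exp (- (m * (\<alpha>/8)) + 32 * (real (Suc m) * (2 * (B / N) / b))\<^sup>2 * (1 + 1 / \<alpha>\<^sup>2)) + M * \<beta>) / \<alpha>"
        by (rule failure_private[OF refl m(1) refl])
      \<comment> \<open>Privacy and inaccuracy of the mechanism contribute \<delta>/2 each.\<close>
      also have "\<dots> \<le> 4 * B * (\<alpha> * \<delta> / (8 * B) + \<alpha> * \<delta> / (8 * B)) / \<alpha>"
        using m(2) \<beta>M B \<alpha>0 by (intro divide_right_mono mult_left_mono add_mono) auto
      also have "\<dots> = \<delta>" using B \<alpha>0 by (simp add: field_simps)
      finally show ?thesis .
    next
      case False
      have K: "1 + (card G + 1) * real M \<le> exp \<Gamma>"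
      proof -
        have "1 + (card G + 1) * real M \<le> (B / \<alpha> + 4) * M * 1"
        proof -
          have "1 + (card G + 1) * real M \<le> 1 * real M + (B / \<alpha> + 3) * real M"
            using M cardG by (intro add_mono mult_right_mono) auto
          also have "\<dots> = (B / \<alpha> + 4) * M * 1" by (simp add: algebra_simps)
          finally show ?thesis .
        qed
        also have "\<dots> \<le> (B / \<alpha> + 4) * M * (8 * B / (\<alpha> * \<delta>))"
        proof (intro mult_left_mono)
          have "\<alpha> * \<delta> \<le> 1" using \<alpha>0 \<delta> by (simp add: mult_le_one)
          then show "1 \<le> 8 * B / (\<alpha> * \<delta>)" using B \<alpha>0 \<delta> by (simp add: field_simps)
        qed (use B \<alpha>0 in auto)
        finally show ?thesis by (simp add: G1)
      qed
      have "avg (\<lambda>x. stop_exp x (\<lambda>h u. of_bool (\<not> good h u)) [] M) \<le>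
        M * \<beta> + 2 * (exp (- (N * \<alpha>\<^sup>2 / (32 * B))) * (1 + (card G + 1) * real M) powr (1 + 1 / \<alpha>\<^sup>2))"
        using failure_union[of M] by (simp only: mult.assoc)
      also have "\<dots> \<le> \<alpha> * \<delta> / (8 * B) + 2 * exp (- \<Gamma>)"
        using False K by (intro add_mono \<beta>M mult_left_mono union_params[OF \<alpha>0 B \<Gamma>(2) _ N]) auto
      also have "\<dots> \<le> \<delta> / 8 + 2 * (\<delta> / 8)"
      proof (intro add_mono mult_left_mono)
        have "\<alpha> \<le> B" using \<alpha>0 B by simp
        then have "\<alpha> * \<delta> \<le> B * \<delta>" using \<delta> by (intro mult_right_mono) auto
        then show le: "\<alpha> * \<delta> / (8 * B) \<le> \<delta> / 8" using B by (simp add: field_simps)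
        have "1 * 1 \<le> (B / \<alpha> + 4) * real M" using B \<alpha>0 M by (intro mult_mono) auto
        then have "1 / ((B / \<alpha> + 4) * M) \<le> 1" by simp
        then have "1 / ((B / \<alpha> + 4) * M) * (\<alpha> * \<delta> / (8 * B)) \<le> 1 * (\<alpha> * \<delta> / (8 * B))"
          using B \<alpha>0 \<delta> by (intro mult_right_mono) auto
        then show "exp (- \<Gamma>) \<le> \<delta> / 8" unfolding expG using le by linarith
      qed simp
      also have "\<dots> \<le> \<delta>" using \<delta> by simp
      finally show ?thesis .
    qed
    moreover obtain k where "M = Suc k" using M by (cases M) auto
    ultimately show ?thesis
      using learner_success[OF aa d0 e D psd(1), of \<epsilon> k \<delta>] \<epsilon> by (simp add: \<alpha> d_def)
  qed
  moreover have "valid_instrument D (learner d N D e B \<alpha> b G h \<psi>)" for h \<psi>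
    by (rule learner_valid[OF d0 e D finG])
  moreover have "(2 ^ n) ^ N \<le> D" using D by (simp add: d_def)
  ultimately show ?thesis by blast
qed

text \<open>As \<epsilon> approaches 1, the factor ln(1/\<epsilon>) sends the allowed number of
  copies below 1, so for large \<epsilon> the answers must come from zero copies. The constant
  answer 1/2 is within 1/2 of every expectation value.\<close>

lemma trivial_learner:
  fixes n M :: nat and \<epsilon> \<delta> :: real
  assumes \<epsilon>: "1/2 \<le> \<epsilon>" and \<delta>: "0 < \<delta>"
  shows "\<exists>(D::nat) (alg::algorithm). D \<ge> (2^n)^0 \<and> (\<forall>h \<psi>. valid_instrument D (alg h \<psi>)) \<and>
           (\<forall>\<rho> (A::analyst). qstate n \<rho> \<and> (\<forall>h. unit_vec n (A h)) \<longrightarrow>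
              succ_prob D alg A \<rho> \<epsilon> (init_state (2^n) \<rho> 0 D) [] M \<ge> 1 - \<delta>)"
proof -
  define alg :: algorithm where "alg = (\<lambda>h \<psi>. [(1/2, [1\<^sub>m 1])])"
  have adj1: "adj (1\<^sub>m 1) = 1\<^sub>m 1" by (rule eq_matI) (auto simp: adj_def)
  have val: "valid_instrument 1 (alg h \<psi>)" for h \<psi>
    by (simp add: valid_instrument_def alg_def msum_def adj1[simplified])
  have ap: "apply_kraus 1 [1\<^sub>m 1] S = S" if "S \<in> carrier_mat 1 1" for S
    using that by (simp add: apply_kraus_def msum_def adj1[simplified])
  have "succ_prob 1 alg A \<rho> \<epsilon> S h k = Re (tr S)"
    if \<rho>: "qstate n \<rho>" and A: "\<And>h. unit_vec n (A h)" and S: "S \<in> carrier_mat 1 1" for \<rho> A S h k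
  proof (induction k arbitrary: h)
    case (Suc k)
    have "psd (2^n) \<rho>" "tr \<rho> = 1" using \<rho> by (auto simp: qstate_def)
    moreover have "dim_vec (A h) = 2^n" "(\<Sum>i<2^n. (cmod (A h $ i))\<^sup>2) = 1" using A[of h] by (auto simp: unit_vec_def)
    ultimately have "0 \<le> expval \<rho> (A h)" "expval \<rho> (A h) \<le> 1"
      using expval_bounds[of "2^n" \<rho> "A h"] by auto
    then have "\<bar>1/2 - expval \<rho> (A h)\<bar> \<le> \<epsilon>" using \<epsilon> by linarith
    then show ?case using Suc ap[OF S] by (simp add: alg_def)
  qed simp
  moreover have "init_state (2^n) \<rho> 0 1 \<in> carrier_mat 1 1" "Re (tr (init_state (2^n) \<rho> 0 1)) = 1" for \<rho>
    by (simp_all add: init_state_def tr_def tensor_pow_def)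
  ultimately have "succ_prob 1 alg A \<rho> \<epsilon> (init_state (2^n) \<rho> 0 1) [] M \<ge> 1 - \<delta>"
    if "qstate n \<rho>" "\<And>h. unit_vec n (A h)" for \<rho> A
    using that \<delta> by simp
  then show ?thesis using val by (intro exI[of _ 1] exI[of _ alg]) auto
qed

theorem mainTheorem13:
  "\<exists>C::real. C > 0 \<and>
     (\<forall>(n::nat) (M::nat) (\<epsilon>::real) (\<delta>::real).
        M \<ge> 2 \<and> 0 < \<epsilon> \<and> \<epsilon> < 1 \<and> 0 < \<delta> \<and> \<delta> < 1 \<longrightarrow>
        (\<exists>(N::nat) (D::nat) (alg::algorithm).
           real N \<le> C * ln (real M) * (ln (1 / (\<epsilon> * \<delta>))) powr (3/2) * ln (1 / \<epsilon>) / \<epsilon> ^ 3 \<and>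
           D \<ge> (2^n)^N \<and>
           (\<forall>h \<psi>. valid_instrument D (alg h \<psi>)) \<and>
           (\<forall>\<rho> (A::analyst). qstate n \<rho> \<and> (\<forall>h. unit_vec n (A h)) \<longrightarrow>
              succ_prob D alg A \<rho> \<epsilon> (init_state (2^n) \<rho> N D) [] M \<ge> 1 - \<delta>)))"
proof -
  define C1 where "C1 = 1 + 96 * exp (6::real)"
  \<comment> \<open>Since ln(1/\<epsilon>) is at least 1/2, this gives
    \<open>B / 64 \<ge> ln (32 * C1) + ln (1 / \<epsilon>)\<close>, so the truncation error is at
    most \<open>\<epsilon> / 32 = \<alpha> / 4\<close>.\<close>
  define c where "c = 64 * (2 * ln (32 * C1) + 1)"
  have C1: "C1 \<ge> 1" by (simp add: C1_def)
  have c: "c \<ge> 10" using C1 by (simp add: c_def)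
  obtain C where C: "C > 0" and bound: "\<And>M \<epsilon> \<delta> \<alpha> B \<Lambda> \<Gamma>. \<lbrakk>M \<ge> (2::nat); 0 < \<epsilon>; \<epsilon> < 1/2; 0 < \<delta>; \<delta> < 1; \<alpha> = \<epsilon> / 8; B = c * ln (1 / \<epsilon>);
       \<Lambda> = ln (8 * B / (\<alpha> * \<delta>)); \<Gamma> = ln ((B / \<alpha> + 4) * M * (8 * B / (\<alpha> * \<delta>)))\<rbrakk> \<Longrightarrow>
      real (nat \<lceil>288 * B * \<Gamma> * sqrt \<Lambda> / \<alpha> ^ 3\<rceil>) \<le>
        C * ln (real M) * (ln (1 / (\<epsilon> * \<delta>))) powr (3/2) * ln (1 / \<epsilon>) / \<epsilon> ^ 3 \<and> \<Gamma> > 0 \<and> \<Lambda> \<ge> 1 \<and> B \<ge> 3"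
    using copies_bound[OF c] by blast
  show ?thesis
  proof (intro exI[of _ C] conjI C allI impI)
    fix n M :: nat and \<epsilon> \<delta> :: real
    assume "M \<ge> 2 \<and> 0 < \<epsilon> \<and> \<epsilon> < 1 \<and> 0 < \<delta> \<and> \<delta> < 1"
    then have M: "M \<ge> 2" and \<epsilon>: "0 < \<epsilon>" "\<epsilon> < 1" and \<delta>: "0 < \<delta>" "\<delta> < 1" by auto
    show "\<exists>(N::nat) (D::nat) (alg::algorithm).
           real N \<le> C * ln (real M) * (ln (1 / (\<epsilon> * \<delta>))) powr (3/2) * ln (1 / \<epsilon>) / \<epsilon> ^ 3 \<and>
           D \<ge> (2^n)^N \<and>
           (\<forall>h \<psi>. valid_instrument D (alg h \<psi>)) \<and>
           (\<forall>\<rho> (A::analyst). qstate n \<rho> \<and> (\<forall>h. unit_vec n (A h)) \<longrightarrow>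
              succ_prob D alg A \<rho> \<epsilon> (init_state (2^n) \<rho> N D) [] M \<ge> 1 - \<delta>)"
    proof (cases "\<epsilon> < 1/2")
      case True
      define \<alpha> B \<Lambda> \<Gamma> N where "\<alpha> = \<epsilon> / 8" and "B = c * ln (1 / \<epsilon>)" and "\<Lambda> = ln (8 * B / (\<alpha> * \<delta>))"
        and "\<Gamma> = ln ((B / \<alpha> + 4) * M * (8 * B / (\<alpha> * \<delta>)))" and "N = nat \<lceil>288 * B * \<Gamma> * sqrt \<Lambda> / \<alpha> ^ 3\<rceil>"
      have bd: "real N \<le> C * ln (real M) * (ln (1 / (\<epsilon> * \<delta>))) powr (3/2) * ln (1 / \<epsilon>) / \<epsilon> ^ 3 \<and> \<Gamma> > 0 \<and> \<Lambda> \<ge> 1 \<and> B \<ge> 3"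
        unfolding N_def by (rule bound[OF M \<epsilon>(1) True \<delta> \<alpha>_def B_def \<Lambda>_def \<Gamma>_def])
      have err: "(1 + 96 * exp 6) * exp (- B / 64) \<le> \<alpha> / 4"
      proof -
        have "ln (1 / \<epsilon>) \<ge> 1/2"
        proof -
          have "exp (1/2::real) \<le> 1 + 1/2 + (1/2)\<^sup>2" using exp_bound[of "1/2::real"] by simp
          also have "\<dots> \<le> 1 / \<epsilon>" using True \<epsilon> by (simp add: power2_eq_square field_simps)
          finally show ?thesis using \<epsilon> by (subst ln_ge_iff) auto
        qed
        then have "ln (32 * C1) * 1 \<le> ln (32 * C1) * (2 * ln (1 / \<epsilon>))" using C1 by (intro mult_left_mono) auto
        then have "ln (32 * C1) + ln (1 / \<epsilon>) \<le> B / 64" by (simp add: B_def c_def algebra_simps)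
        then have "exp (- B / 64) \<le> exp (- (ln (32 * C1) + ln (1 / \<epsilon>)))" by simp
        also have "\<dots> = \<epsilon> / (32 * C1)" 
        proof -
          have "exp (- (ln (32 * C1) + ln (1 / \<epsilon>))) = inverse (exp (ln (32 * C1)) * exp (ln (1 / \<epsilon>)))"
            by (simp only: exp_minus exp_add)
          also have "\<dots> = \<epsilon> / (32 * C1)" using C1 \<epsilon> by (simp add: exp_ln field_simps del: ln_mult)
          finally show ?thesis .
        qed
        finally have "C1 * exp (- B / 64) \<le> C1 * (\<epsilon> / (32 * C1))" using C1 by (intro mult_left_mono) auto
        then show ?thesis using C1 by (simp add: C1_def[symmetric] \<alpha>_def)
      qed
      have "real N \<ge> 288 * B * \<Gamma> * sqrt \<Lambda> / \<alpha> ^ 3" unfolding N_def by (rule real_nat_ceiling_ge)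
      then show ?thesis
        using learner_exists[OF M \<epsilon>(1) True \<delta> \<alpha>_def _ \<Lambda>_def _ \<Gamma>_def _ err, of N n] bd by blast
    next
      case False
      have "1 \<le> 1 / \<epsilon>" using \<epsilon> by simp
      then have bd: "0 \<le> C * ln (real M) * (ln (1 / (\<epsilon> * \<delta>))) powr (3/2) * ln (1 / \<epsilon>) / \<epsilon> ^ 3"
        using C M \<epsilon> by (intro divide_nonneg_nonneg mult_nonneg_nonneg) auto
      have "1/2 \<le> \<epsilon>" using False by simp
      then obtain D :: nat and alg :: algorithm where t: "D \<ge> (2^n)^0" "\<forall>h \<psi>. valid_instrument D (alg h \<psi>)"
        "\<forall>\<rho> (A::analyst). qstate n \<rho> \<and> (\<forall>h. unit_vec n (A h)) \<longrightarrow>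
           succ_prob D alg A \<rho> \<epsilon> (init_state (2^n) \<rho> 0 D) [] M \<ge> 1 - \<delta>"
        using trivial_learner[of \<epsilon> \<delta> n M] \<delta>(1) by blast
      show ?thesis
      proof (rule exI[of _ "0::nat"], rule exI[of _ D], rule exI[of _ alg], intro conjI)
        show "real 0 \<le> C * ln (real M) * (ln (1 / (\<epsilon> * \<delta>))) powr (3/2) * ln (1 / \<epsilon>) / \<epsilon> ^ 3"
          using bd by simp
      qed (rule t(1), rule t(2), rule t(3))
    qed
  qed
qed

end
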